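(* For every $\varepsilon>0$ there exists $d_0$ such that the following holds. Let $d=d(n)$ satisfy $d_0\le d$ and $d=o(n)$, and let $p=d/n$. Then with high probability (i.e. with probability $1-o(1)$ as $n\to\infty$) the random graph $G(n,p)$ contains an induced path of length at least $(3/2-\varepsilon)\frac{n}{d}\log d$.
   Context: $G(n,p)$ denotes the binomial random graph on vertex set $\{1,\dots,n\}$ in which each pair of vertices is an edge independently with probability $p$. $\log$ is the natural logarithm. A subgraph is induced if it contains every edge of the host graph between its vertices. *)

theory Defs
  imports
    "HOL-Probability.Probability"
    "HOL-Probability.Product_PMF"
    "HOL-Library.Landau_Symbols"
    "HOL-Library.Ramsey"
begin

text \<open>Simple graphs are pairs of a vertex set and a set of edges, every edge being a two-element
  set of vertices.\<close>

type_synonym 'a graph = "'a set \<times> 'a set set"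

abbreviation verts :: "'a graph \<Rightarrow> 'a set" where
  "verts G \<equiv> fst G"

abbreviation edges :: "'a graph \<Rightarrow> 'a set set" where
  "edges G \<equiv> snd G"

text \<open>The binomial random graph, as a distribution on graphs with vertex set \<open>{1..n}\<close>. Here
  \<open>nsets {1..n} 2\<close> is the set of all pairs of vertices. Outside \<open>0 \<le> p \<le> 1\<close>,
  \<^const>\<open>bernoulli_pmf\<close> truncates \<open>p\<close> to the unit interval.\<close>

definition gnp :: "nat \<Rightarrow> real \<Rightarrow> nat graph pmf" where
  "gnp n p =
     map_pmf (\<lambda>X. ({1..n}, {e \<in> nsets {1..n} 2. X e}))
       (Pi_pmf (nsets {1..n} 2) False (\<lambda>_. bernoulli_pmf p))"

definition subgraph :: "'a graph \<Rightarrow> 'a graph \<Rightarrow> bool" where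
  "subgraph H G \<longleftrightarrow> verts H \<subseteq> verts G \<and> edges H \<subseteq> edges G"

definition induced_subgraph :: "'a graph \<Rightarrow> 'a graph \<Rightarrow> bool" where
  "induced_subgraph H G \<longleftrightarrow>
     subgraph H G \<and> (\<forall>e \<in> edges G. e \<subseteq> verts H \<longrightarrow> e \<in> edges H)"

definition path_graph :: "'a list \<Rightarrow> 'a graph" where
  "path_graph vs = (set vs, {{vs ! i, vs ! Suc i} | i. Suc i < length vs})"

text \<open>The length of a path is its number of edges, one less than its number of vertices.\<close>

definition is_path_of_length :: "'a graph \<Rightarrow> nat \<Rightarrow> bool" where
  "is_path_of_length P k \<longleftrightarrow>
     (\<exists>vs. distinct vs \<and> length vs = Suc k \<and> P = path_graph vs)"

end

(*
  Write p = d/n and call k = (3/2 - eps/2) (n/d) log d.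

  A second moment computation on half of the vertices shows that an induced path on k vertices
  exists with probability at least exp(-O(n (log d)^2 / d^2)). The common part of two paths is a
  union of segments, and each segment costs a factor O(k^2/n); the factor (1-p)^(-s^2/2) from s
  common vertices is harmless because k < 2 (n/d) log d. If n (log d)^2 / d^2 is small, this
  already finishes the proof.

  Otherwise the small probability is boosted by McDiarmid's inequality. The vertices are split
  into 2k blocks and only sequences with at most one vertex per block are considered, so that
  resampling the edges of one block spoils one vertex. In order to have a Lipschitz function, one
  maximises length - L * (number of missing edges between consecutive vertices) over all sequences
  without chords, with L about d^(1/2 - eps/8). With high probability this maximum is at least
  (1 - o(1)) k. Cutting an optimal sequence into pieces of L vertices gives about k/L induced paths
  with no edges between them.

  The remaining half of the vertices serves to connect these paths. A vertex is a connector if it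
  has exactly two neighbours on the paths, one near the end of a path and one near the beginning
  of another one. There are so many of them, since L > d^(1/2 - eps/4), that any two large families
  of paths are joined by a connector avoiding and not adjacent to any given small set of vertices.
  A depth-first search then arranges almost all paths into one induced path.
*)

theory Submission
  imports Defs "HOL-Real_Asymp.Real_Asymp"
begin

section \<open>Product measures and bounded differences\<close>

text \<open>The constant 3/2 is 1 + 1/2. Write k = c (n/d) log d and ignore constants and powers of
  log d. With Lipschitz constant L and about k blocks, McDiarmid's inequality for deviations of
  order k has exponent k/L^2, about n/(d L^2). This must exceed the exponent n/d^2 of the second
  moment bound, so L has to stay below d^(1/2). A vertex of the other half is a connector with
  probability about (1-p)^k = d^(-c), and these n d^(-c) connectors have to beat a union bound over
  families of the k/L, about n/(d L), paths and over sets of as many forbidden vertices. This needs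
  d^c < d L, that is, c < 1 + 1/2. The small powers of d with exponent eps/8 or eps/4 are the slack
  in these comparisons. The boosted failure probabilities are small only if n d^(eps/4 - 2) is
  large, which fails for large d; this forces the case distinction. As d0 may depend on eps only,
  every condition is put either on d and eps alone or on the ratio n/d.\<close>

definition glue :: "'a set \<Rightarrow> ('a \<Rightarrow> 'b) \<Rightarrow> ('a \<Rightarrow> 'b) \<Rightarrow> 'a \<Rightarrow> 'b" where
  "glue D f g = (\<lambda>x. if x \<in> D then f x else g x)"

lemma finite_set_Pi_pmf:
  assumes "finite A" "\<And>x. finite (set_pmf (q x))"
  shows "finite (set_pmf (Pi_pmf A dflt q))"
  using assms by (auto simp: set_Pi_pmf intro!: finite_PiE_dflt)

lemma expectation_pair_pmf:
  fixes h :: "'a \<times> 'b \<Rightarrow> real"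
  assumes "finite (set_pmf P)" "finite (set_pmf Q)"
  shows "measure_pmf.expectation (pair_pmf P Q) h =
    measure_pmf.expectation P (\<lambda>a. measure_pmf.expectation Q (\<lambda>b. h (a, b)))"
proof -
  have "pair_pmf P Q = P \<bind> (\<lambda>a. map_pmf (Pair a) Q)"
    by (simp add: pair_pmf_def map_pmf_def)
  hence "measure_pmf.expectation (pair_pmf P Q) h =
     (\<Sum>a\<in>set_pmf P. pmf P a *\<^sub>R measure_pmf.expectation (map_pmf (Pair a) Q) h)"
    using assms by (simp add: pmf_expectation_bind[of "set_pmf P"])
  also have "\<dots> = measure_pmf.expectation P (\<lambda>a. measure_pmf.expectation Q (\<lambda>b. h (a, b)))"
    by (subst integral_measure_pmf[OF assms(1)]) auto
  finally show ?thesis .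
qed

lemma Pi_pmf_glue:
  assumes "finite A" "D \<subseteq> A"
  shows "Pi_pmf A dflt q = map_pmf (\<lambda>(f, g). glue D f g) (pair_pmf (Pi_pmf D dflt q) (Pi_pmf (A - D) dflt q))"
  using Pi_pmf_union[of D "A - D" dflt q] assms
  by (simp add: glue_def Un_absorb1 finite_subset)

lemma expectation_Pi_pmf_glue:
  fixes h :: "('a \<Rightarrow> 'b) \<Rightarrow> real"
  assumes "finite A" "D \<subseteq> A" "\<And>x. finite (set_pmf (q x))"
  shows "measure_pmf.expectation (Pi_pmf A dflt q) h =
    measure_pmf.expectation (Pi_pmf D dflt q) (\<lambda>f.
      measure_pmf.expectation (Pi_pmf (A - D) dflt q) (\<lambda>g. h (glue D f g)))"
  using assms
  by (subst Pi_pmf_glue[OF assms(1,2)])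
     (simp add: expectation_pair_pmf finite_set_Pi_pmf finite_subset[OF assms(2)] case_prod_unfold)

lemma expectation_Pi_pmf_glue_swap:
  fixes h :: "('a \<Rightarrow> 'b) \<Rightarrow> real"
  assumes "finite A" "D \<subseteq> A" "\<And>x. finite (set_pmf (q x))"
  shows "measure_pmf.expectation (Pi_pmf A dflt q) h =
    measure_pmf.expectation (Pi_pmf (A - D) dflt q) (\<lambda>g.
      measure_pmf.expectation (Pi_pmf D dflt q) (\<lambda>f. h (glue D f g)))"
  using assms
  by (subst Pi_pmf_glue[OF assms(1,2)], subst pair_commute_pmf)
     (simp add: expectation_pair_pmf finite_set_Pi_pmf finite_subset[OF assms(2)] case_prod_unfold)

section \<open>Independence of events that depend on disjoint sets of coordinates\<close>

lemma prob_eq_expectation_of_bool: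
  "measure_pmf.prob P {x. Q x} = measure_pmf.expectation P (\<lambda>x. of_bool (Q x))"
proof -
  have "(\<lambda>x. of_bool (Q x)) = (indicator {x. Q x} :: _ \<Rightarrow> real)"
    by (auto simp: indicator_def)
  thus ?thesis by simp
qed

definition dep_on :: "'a set \<Rightarrow> (('a \<Rightarrow> 'b) \<Rightarrow> 'c) \<Rightarrow> bool" where
  "dep_on D Q \<longleftrightarrow> (\<forall>f g. (\<forall>x\<in>D. f x = g x) \<longrightarrow> Q f = Q g)"

lemma dep_onD: "dep_on D Q \<Longrightarrow> (\<And>x. x \<in> D \<Longrightarrow> f x = g x) \<Longrightarrow> Q f = Q g"
  by (auto simp: dep_on_def)

lemma prob_Pi_pmf_indep:
  assumes "finite A" "D1 \<subseteq> A" "D2 \<subseteq> A" "D1 \<inter> D2 = {}" "\<And>x. finite (set_pmf (q x))"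
    and "dep_on D1 Q1" "dep_on D2 Q2"
  shows "measure_pmf.prob (Pi_pmf A dflt q) {f. Q1 f \<and> Q2 f} =
    measure_pmf.prob (Pi_pmf A dflt q) {f. Q1 f} * measure_pmf.prob (Pi_pmf A dflt q) {f. Q2 f}"
proof -
  note * = prob_eq_expectation_of_bool expectation_Pi_pmf_glue[OF assms(1,2,5)]
  have 1: "Q1 (glue D1 f g) = Q1 f" for f g
    by (rule dep_onD[OF assms(6)]) (auto simp: glue_def)
  have 2: "Q2 (glue D1 f g) = Q2 g" for f g
    by (rule dep_onD[OF assms(7)]) (use assms(4) in \<open>auto simp: glue_def\<close>)
  show ?thesis
    by (simp add: * 1 2 of_bool_conj)
qed

lemma prob_Pi_pmf_family_indep:
  fixes Q :: "'i \<Rightarrow> ('a \<Rightarrow> 'b) \<Rightarrow> bool"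
  assumes "finite A" "finite I" "\<And>i. i \<in> I \<Longrightarrow> D i \<subseteq> A"
    and "\<And>i j. i \<in> I \<Longrightarrow> j \<in> I \<Longrightarrow> i \<noteq> j \<Longrightarrow> D i \<inter> D j = {}" "\<And>x. finite (set_pmf (q x))"
    and "\<And>i. i \<in> I \<Longrightarrow> dep_on (D i) (Q i)"
  shows "measure_pmf.prob (Pi_pmf A dflt q) {f. \<forall>i\<in>I. Q i f} =
    (\<Prod>i\<in>I. measure_pmf.prob (Pi_pmf A dflt q) {f. Q i f})"
  using assms(2,3,4,6)
proof (induction I rule: finite_induct)
  case empty
  then show ?case by simp
next
  case (insert j I)
  have dep: "dep_on (\<Union>i\<in>I. D i) (\<lambda>f. \<forall>i\<in>I. Q i f)"
    unfolding dep_on_def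
  proof (intro allI impI)
    fix f g :: "'a \<Rightarrow> 'b" assume fg: "\<forall>x\<in>\<Union> (D ` I). f x = g x"
    have "Q i f = Q i g" if "i \<in> I" for i
      by (rule dep_onD[OF insert.prems(3)[of i]]) (use fg that in auto)
    then show "(\<forall>i\<in>I. Q i f) = (\<forall>i\<in>I. Q i g)" by auto
  qed
  have "measure_pmf.prob (Pi_pmf A dflt q) {f. \<forall>i\<in>insert j I. Q i f} =
      measure_pmf.prob (Pi_pmf A dflt q) {f. Q j f \<and> (\<forall>i\<in>I. Q i f)}"
    by simp
  also have "\<dots> = measure_pmf.prob (Pi_pmf A dflt q) {f. Q j f} *
      measure_pmf.prob (Pi_pmf A dflt q) {f. \<forall>i\<in>I. Q i f}"
  proof (rule prob_Pi_pmf_indep[OF assms(1) _ _ _ assms(5) _ dep])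
    show "D j \<inter> (\<Union>i\<in>I. D i) = {}" using insert.prems(2)[of j] insert.hyps(2) by fastforce
  qed (use insert.prems in auto)
  finally show ?case using insert by simp
qed

lemma prob_bernoulli_cylinder:
  assumes "finite A" "D1 \<subseteq> A" "D0 \<subseteq> A" "D1 \<inter> D0 = {}" "0 \<le> p" "p \<le> 1"
  shows "measure_pmf.prob (Pi_pmf A False (\<lambda>_. bernoulli_pmf p))
      {f. (\<forall>e\<in>D1. f e) \<and> (\<forall>e\<in>D0. \<not> f e)} = p ^ card D1 * (1 - p) ^ card D0"
proof -
  define B where "B e = (if e \<in> D1 then {True} else if e \<in> D0 then {False} else UNIV)" for e
  have fin: "finite D1" "finite D0" using assms(1-3) by (auto intro: finite_subset)
  have "{f. (\<forall>e\<in>D1. f e) \<and> (\<forall>e\<in>D0. \<not> f e)} = Pi A B"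
    using assms(2-4) by (fastforce simp: B_def Pi_def split: if_splits)
  hence "measure_pmf.prob (Pi_pmf A False (\<lambda>_. bernoulli_pmf p))
      {f. (\<forall>e\<in>D1. f e) \<and> (\<forall>e\<in>D0. \<not> f e)} = (\<Prod>e\<in>A. measure_pmf.prob (bernoulli_pmf p) (B e))"
    using assms(1) by (simp add: measure_Pi_pmf_Pi)
  also have "\<dots> = (\<Prod>e\<in>D1 \<union> D0. measure_pmf.prob (bernoulli_pmf p) (B e))"
    using assms by (intro prod.mono_neutral_right) (auto simp: B_def)
  also have "\<dots> = (\<Prod>e\<in>D1. measure_pmf.prob (bernoulli_pmf p) (B e)) *
      (\<Prod>e\<in>D0. measure_pmf.prob (bernoulli_pmf p) (B e))"
    using fin assms(4) by (rule prod.union_disjoint)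
  also have "(\<Prod>e\<in>D1. measure_pmf.prob (bernoulli_pmf p) (B e)) = (\<Prod>e\<in>D1. p)"
    using assms(5,6) by (intro prod.cong) (auto simp: B_def measure_pmf_single)
  also have "(\<Prod>e\<in>D0. measure_pmf.prob (bernoulli_pmf p) (B e)) = (\<Prod>e\<in>D0. 1 - p)"
    using assms(4-6) by (intro prod.cong) (auto simp: B_def measure_pmf_single)
  finally show ?thesis by simp
qed

section \<open>McDiarmid's inequality through exponential moments\<close>

lemma expectation_mono_finite:
  fixes f g :: "'a \<Rightarrow> real"
  assumes "finite (set_pmf P)" "\<And>x. f x \<le> g x"
  shows "measure_pmf.expectation P f \<le> measure_pmf.expectation P g"
  using assms by (intro integral_mono integrable_measure_pmf_finite) auto

text \<open>Averaging out one block \<open>A j\<close> leaves a function \<open>g\<close> of the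
  other blocks with the same Lipschitz constant, so induction over the blocks applies. With the
  other blocks fixed, \<open>f\<close> is confined to an interval of length \<open>c\<close>, and
  Hoeffding's lemma supplies one factor \<open>exp (l\<^sup>2 * c\<^sup>2 / 8)\<close> per
  block.\<close>

lemma mcdiarmid_mgf:
  fixes f :: "('a \<Rightarrow> 'b) \<Rightarrow> real" and dflt :: 'b
  assumes "finite I" "\<And>i. i \<in> I \<Longrightarrow> finite (A i)"
    and "\<And>i j. i \<in> I \<Longrightarrow> j \<in> I \<Longrightarrow> i \<noteq> j \<Longrightarrow> A i \<inter> A j = {}"
    and fin: "\<And>x. finite (set_pmf (q x))"
    and "\<And>i \<omega> \<omega>'. i \<in> I \<Longrightarrow> (\<And>x. x \<notin> A i \<Longrightarrow> \<omega> x = \<omega>' x) \<Longrightarrow> \<bar>f \<omega> - f \<omega>'\<bar> \<le> c"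
    and l: "l > 0" and c: "c \<ge> 0"
  defines "P \<equiv> \<lambda>I. Pi_pmf (\<Union>i\<in>I. A i) dflt q"
  shows "measure_pmf.expectation (P I) (\<lambda>\<omega>. exp (l * (f \<omega> - measure_pmf.expectation (P I) f)))
    \<le> exp (l\<^sup>2 * c\<^sup>2 / 8 * card I)"
  using assms(1-3,5)
proof (induction I arbitrary: f rule: finite_induct)
  case empty
  then show ?case by (simp add: P_def)
next
  case (insert j I)
  define Q where "Q = Pi_pmf (A j) dflt q"
  define g where "g = (\<lambda>\<omega>. measure_pmf.expectation Q (\<lambda>\<eta>. f (glue (A j) \<eta> \<omega>)))"
  have finQ: "finite (set_pmf Q)" and finP: "finite (set_pmf (P I))"
    using insert.prems insert.hyps fin by (auto simp: Q_def P_def intro!: finite_set_Pi_pmf)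
  note int = integrable_measure_pmf_finite[OF finQ]
  have sub: "(\<Union>i\<in>insert j I. A i) - A j = (\<Union>i\<in>I. A i)"
    using insert.prems(2)[of j] insert.hyps(2) by fastforce
  have E: "measure_pmf.expectation (P (insert j I)) h =
      measure_pmf.expectation (P I) (\<lambda>\<omega>. measure_pmf.expectation Q (\<lambda>\<eta>. h (glue (A j) \<eta> \<omega>)))" for h :: "_ \<Rightarrow> real"
    unfolding P_def Q_def
    by (subst expectation_Pi_pmf_glue_swap[where D = "A j"])
       (use insert.prems(1) insert.hyps fin in \<open>auto simp: sub[simplified]\<close>)
  define \<mu> where "\<mu> = measure_pmf.expectation (P (insert j I)) f"
  have \<mu>: "\<mu> = measure_pmf.expectation (P I) g"
    by (simp add: \<mu>_def E g_def)
  have lip: "\<bar>g \<omega> - g \<omega>'\<bar> \<le> c" if i: "i \<in> I" and eq: "\<And>x. x \<notin> A i \<Longrightarrow> \<omega> x = \<omega>' x" for i \<omega> \<omega>'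
  proof -
    have "g \<omega> - g \<omega>' = measure_pmf.expectation Q (\<lambda>\<eta>. f (glue (A j) \<eta> \<omega>) - f (glue (A j) \<eta> \<omega>'))"
      unfolding g_def by (intro Bochner_Integration.integral_diff[symmetric] int)
    also have "\<bar>\<dots>\<bar> \<le> measure_pmf.expectation Q (\<lambda>\<eta>. \<bar>f (glue (A j) \<eta> \<omega>) - f (glue (A j) \<eta> \<omega>')\<bar>)"
      by (rule integral_abs_bound)
    also have "\<dots> \<le> measure_pmf.expectation Q (\<lambda>\<eta>. c)"
    proof (rule expectation_mono_finite[OF finQ])
      show "\<bar>f (glue (A j) \<eta> \<omega>) - f (glue (A j) \<eta> \<omega>')\<bar> \<le> c" for \<eta>
        using i eq by (intro insert.prems(3)[of i]) (auto simp: glue_def)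
    qed
    finally show ?thesis by simp
  qed
  have inner: "measure_pmf.expectation Q (\<lambda>\<eta>. exp (l * (f (glue (A j) \<eta> \<omega>) - g \<omega>))) \<le> exp (l\<^sup>2 * c\<^sup>2 / 8)" for \<omega>
  proof -
    define F where "F = (\<lambda>\<eta>. f (glue (A j) \<eta> \<omega>))"
    define a where "a = Inf (range F)"
    have dif: "\<bar>F \<eta> - F \<eta>'\<bar> \<le> c" for \<eta> \<eta>'
      unfolding F_def by (rule insert.prems(3)[of j]) (auto simp: glue_def)
    have bdd: "bdd_below (range F)"
      using dif[of undefined] by (intro bdd_belowI[of _ "F undefined - c"]) (auto simp: abs_le_iff algebra_simps)
    have lower: "a \<le> F \<eta>" for \<eta> unfolding a_def by (rule cInf_lower[OF _ bdd]) auto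
    have upper: "F \<eta> \<le> a + c" for \<eta>
    proof -
      have "F \<eta> - c \<le> a" unfolding a_def
        by (rule cInf_greatest) (use dif[of \<eta>] in \<open>auto simp: abs_le_iff algebra_simps\<close>)
      thus ?thesis by simp
    qed
    interpret interval_bounded_random_variable "measure_pmf Q" F a "a + c"
      by unfold_locales (auto simp: lower upper)
    have "nn_integral Q (\<lambda>x. exp (l * (F x - measure_pmf.expectation Q F))) \<le> ennreal (exp (l\<^sup>2 * c\<^sup>2 / 8))"
      using Hoeffdings_lemma_nn_integral[OF l] by simp
    moreover have "nn_integral Q (\<lambda>x. exp (l * (F x - measure_pmf.expectation Q F))) =
       ennreal (measure_pmf.expectation Q (\<lambda>x. exp (l * (F x - measure_pmf.expectation Q F))))"
      by (intro nn_integral_eq_integral int) auto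
    ultimately show ?thesis by (simp add: g_def F_def)
  qed
  have "measure_pmf.expectation (P (insert j I)) (\<lambda>\<omega>. exp (l * (f \<omega> - \<mu>))) =
     measure_pmf.expectation (P I) (\<lambda>\<omega>. measure_pmf.expectation Q (\<lambda>\<eta>. exp (l * (g \<omega> - \<mu>)) * exp (l * (f (glue (A j) \<eta> \<omega>) - g \<omega>))))"
    by (simp add: E flip: exp_add) (simp add: algebra_simps)
  also have "\<dots> = measure_pmf.expectation (P I) (\<lambda>\<omega>. exp (l * (g \<omega> - \<mu>)) * measure_pmf.expectation Q (\<lambda>\<eta>. exp (l * (f (glue (A j) \<eta> \<omega>) - g \<omega>))))"
    by simp
  also have "\<dots> \<le> measure_pmf.expectation (P I) (\<lambda>\<omega>. exp (l * (g \<omega> - \<mu>)) * exp (l\<^sup>2 * c\<^sup>2 / 8))"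
    by (rule expectation_mono_finite[OF finP]) (simp add: inner)
  also have "\<dots> = measure_pmf.expectation (P I) (\<lambda>\<omega>. exp (l * (g \<omega> - \<mu>))) * exp (l\<^sup>2 * c\<^sup>2 / 8)"
    by simp
  also have "\<dots> \<le> exp (l\<^sup>2 * c\<^sup>2 / 8 * card I) * exp (l\<^sup>2 * c\<^sup>2 / 8)"
    unfolding \<mu> using insert.prems lip by (intro mult_right_mono insert.IH) auto
  also have "\<dots> = exp (l\<^sup>2 * c\<^sup>2 / 8 * card (insert j I))"
    using insert.hyps by (simp add: algebra_simps flip: exp_add)
  finally show ?case by (simp add: \<mu>_def)
qed

lemma mcdiarmid_upper:
  fixes f :: "('a \<Rightarrow> 'b) \<Rightarrow> real" and dflt :: 'b
  assumes "finite I" "\<And>i. i \<in> I \<Longrightarrow> finite (A i)"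
    and "\<And>i j. i \<in> I \<Longrightarrow> j \<in> I \<Longrightarrow> i \<noteq> j \<Longrightarrow> A i \<inter> A j = {}"
    and fin: "\<And>x. finite (set_pmf (q x))"
    and "\<And>i \<omega> \<omega>'. i \<in> I \<Longrightarrow> (\<And>x. x \<notin> A i \<Longrightarrow> \<omega> x = \<omega>' x) \<Longrightarrow> \<bar>f \<omega> - f \<omega>'\<bar> \<le> c"
    and t: "t > 0" and c: "c > 0" and I: "I \<noteq> {}"
  defines "P \<equiv> Pi_pmf (\<Union>i\<in>I. A i) dflt q"
  shows "measure_pmf.prob P {\<omega>. f \<omega> \<ge> measure_pmf.expectation P f + t} \<le> exp (- 2 * t\<^sup>2 / (c\<^sup>2 * card I))"
proof -
  define \<mu> where "\<mu> = measure_pmf.expectation P f"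
  have cI: "real (card I) > 0" using I assms(1) by (simp add: card_gt_0_iff)
  \<comment> \<open>This value minimises \<open>l\<^sup>2 * c\<^sup>2 / 8 * card I - l * t\<close>,
    the exponent left by Markov's inequality.\<close>
  define l where "l = 4 * t / (c\<^sup>2 * card I)"
  have l: "l > 0" using t c cI by (simp add: l_def)
  have finP: "finite (set_pmf P)" using assms(1,2) fin by (auto simp: P_def intro!: finite_set_Pi_pmf)
  have "measure_pmf.prob P {\<omega>. f \<omega> \<ge> \<mu> + t} = measure_pmf.expectation P (\<lambda>\<omega>. of_bool (f \<omega> \<ge> \<mu> + t))"
    by (rule prob_eq_expectation_of_bool)
  also have "\<dots> \<le> measure_pmf.expectation P (\<lambda>\<omega>. exp (l * (f \<omega> - \<mu>)) * exp (- l * t))"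
  proof (rule expectation_mono_finite[OF finP])
    fix \<omega>
    show "of_bool (f \<omega> \<ge> \<mu> + t) \<le> exp (l * (f \<omega> - \<mu>)) * exp (- l * t)"
    proof (cases "f \<omega> \<ge> \<mu> + t")
      case True
      then have "0 \<le> l * (f \<omega> - \<mu> - t)" using l by simp
      then show ?thesis using True by (simp add: algebra_simps flip: exp_add)
    qed simp
  qed
  also have "\<dots> = measure_pmf.expectation P (\<lambda>\<omega>. exp (l * (f \<omega> - \<mu>))) * exp (- l * t)"
    by simp
  also have "\<dots> \<le> exp (l\<^sup>2 * c\<^sup>2 / 8 * card I) * exp (- l * t)"
    unfolding \<mu>_def P_def using l c
    by (intro mult_right_mono mcdiarmid_mgf[OF assms(1-5)]) auto
  also have "\<dots> = exp (- 2 * t\<^sup>2 / (c\<^sup>2 * card I))"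
    using c cI by (simp add: l_def field_simps power2_eq_square flip: exp_add)
  finally show ?thesis by (simp add: \<mu>_def)
qed

lemma mcdiarmid_lower:
  fixes f :: "('a \<Rightarrow> 'b) \<Rightarrow> real" and dflt :: 'b
  assumes "finite I" "\<And>i. i \<in> I \<Longrightarrow> finite (A i)"
    and "\<And>i j. i \<in> I \<Longrightarrow> j \<in> I \<Longrightarrow> i \<noteq> j \<Longrightarrow> A i \<inter> A j = {}"
    and fin: "\<And>x. finite (set_pmf (q x))"
    and lip: "\<And>i \<omega> \<omega>'. i \<in> I \<Longrightarrow> (\<And>x. x \<notin> A i \<Longrightarrow> \<omega> x = \<omega>' x) \<Longrightarrow> \<bar>f \<omega> - f \<omega>'\<bar> \<le> c"
    and t: "t > 0" and c: "c > 0" and I: "I \<noteq> {}"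
  defines "P \<equiv> Pi_pmf (\<Union>i\<in>I. A i) dflt q"
  shows "measure_pmf.prob P {\<omega>. f \<omega> \<le> measure_pmf.expectation P f - t} \<le> exp (- 2 * t\<^sup>2 / (c\<^sup>2 * card I))"
proof -
  have "\<bar>- f \<omega> - (- f \<omega>')\<bar> \<le> c" if "i \<in> I" "\<And>x. x \<notin> A i \<Longrightarrow> \<omega> x = \<omega>' x" for i \<omega> \<omega>'
  proof -
    have "\<bar>f \<omega> - f \<omega>'\<bar> \<le> c" by (rule lip[OF that(1)]) (rule that(2))
    then show ?thesis by linarith
  qed
  from mcdiarmid_upper[where f = "\<lambda>\<omega>. - f \<omega>", OF assms(1-4) this t c I, where dflt = dflt]
  show ?thesis by (simp add: P_def algebra_simps)
qed

text \<open>Chebyshev's inequality is useless when the ratio \<open>R\<close> of moments is large.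
  This Cauchy-Schwarz form still gives probability \<open>1 / R\<close>, even for exponentially
  large \<open>R\<close>.\<close>

lemma second_moment_method:
  fixes S :: "'b set" and Q :: "'b \<Rightarrow> 'a \<Rightarrow> bool"
  assumes finP: "finite (set_pmf P)" and S: "finite S"
    and m: "(\<Sum>x\<in>S. measure_pmf.prob P {\<omega>. Q x \<omega>}) = m" "m > 0"
    and R: "(\<Sum>x\<in>S. \<Sum>y\<in>S. measure_pmf.prob P {\<omega>. Q x \<omega> \<and> Q y \<omega>}) \<le> R * m\<^sup>2" "R > 0"
  shows "measure_pmf.prob P {\<omega>. \<exists>x\<in>S. Q x \<omega>} \<ge> 1 / R"
proof -
  define X :: "'a \<Rightarrow> real" where "X = (\<lambda>\<omega>. \<Sum>x\<in>S. of_bool (Q x \<omega>))"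
  note int = integrable_measure_pmf_finite[OF finP]
  have EX: "measure_pmf.expectation P X = m"
    unfolding X_def m(1)[symmetric] prob_eq_expectation_of_bool by (subst Bochner_Integration.integral_sum) (auto intro: int)
  have X2: "X \<omega> * X \<omega> = (\<Sum>x\<in>S. \<Sum>y\<in>S. of_bool (Q x \<omega> \<and> Q y \<omega>))" for \<omega>
    by (simp add: X_def sum_product of_bool_conj)
  have EX2: "measure_pmf.expectation P (\<lambda>\<omega>. X \<omega> * X \<omega>) \<le> R * m\<^sup>2"
    using R(1) unfolding X2 prob_eq_expectation_of_bool
    by (simp add: Bochner_Integration.integral_sum int)
  \<comment> \<open>For every \<open>c\<close>, the indicator of \<open>X > 0\<close> is at least \<open>2 c X - (c X)\<^sup>2\<close>.\<close>
  define c where "c = 1 / (R * m)"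
  have "1 / R = 2 * c * m - c\<^sup>2 * (R * m\<^sup>2)"
    using m(2) R(2) by (simp add: c_def field_simps power2_eq_square)
  also have "\<dots> \<le> 2 * c * m - c\<^sup>2 * measure_pmf.expectation P (\<lambda>\<omega>. X \<omega> * X \<omega>)"
    using EX2 by (simp add: mult_left_mono)
  also have "\<dots> = measure_pmf.expectation P (\<lambda>\<omega>. 2 * c * X \<omega> - c\<^sup>2 * (X \<omega> * X \<omega>))"
    by (subst Bochner_Integration.integral_diff) (auto simp: int EX)
  also have "\<dots> \<le> measure_pmf.expectation P (\<lambda>\<omega>. of_bool (\<exists>x\<in>S. Q x \<omega>))"
  proof (rule expectation_mono_finite[OF finP])
    fix \<omega>
    show "2 * c * X \<omega> - c\<^sup>2 * (X \<omega> * X \<omega>) \<le> of_bool (\<exists>x\<in>S. Q x \<omega>)"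
    proof (cases "\<exists>x\<in>S. Q x \<omega>")
      case True
      have "0 \<le> (1 - c * X \<omega>)\<^sup>2" by simp
      then show ?thesis using True by (simp add: power2_eq_square algebra_simps)
    next
      case False
      then have "X \<omega> = 0" by (simp add: X_def)
      then show ?thesis using False by simp
    qed
  qed
  finally show ?thesis by (simp add: prob_eq_expectation_of_bool)
qed

section \<open>The second moment of the number of induced paths\<close>

fun path_edges :: "'a list \<Rightarrow> 'a set set" where
  "path_edges (x # y # zs) = insert {x, y} (path_edges (y # zs))"
| "path_edges _ = {}"

lemma path_edges_subset: "distinct xs \<Longrightarrow> path_edges xs \<subseteq> nsets (set xs) 2"
proof (induction xs rule: path_edges.induct)
  case (1 x y zs)
  then have "path_edges (y # zs) \<subseteq> nsets (set (x # y # zs)) 2"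
    using nsets_mono[of "set (y # zs)" "set (x # y # zs)" 2] by auto
  with 1 show ?case by auto
qed auto

lemma path_edges_subset_set: "e \<in> path_edges xs \<Longrightarrow> e \<subseteq> set xs"
  by (induction xs rule: path_edges.induct) auto

lemma finite_path_edges [simp]: "finite (path_edges xs)"
  by (induction xs rule: path_edges.induct) auto

lemma card_path_edges: "distinct xs \<Longrightarrow> card (path_edges xs) = length xs - 1"
proof (induction xs rule: path_edges.induct)
  case (1 x y zs)
  have "{x, y} \<notin> path_edges (y # zs)" using path_edges_subset_set[of "{x, y}" "y # zs"] 1 by auto
  with 1 show ?case by simp
qed auto

text \<open>The clause on the head strengthens the induction: a new first vertex raises the degree
  of the old head only, which therefore must have had degree at most 1 before.\<close>

lemma path_edges_degree:
  "distinct xs \<Longrightarrow> card {v. {v, u} \<in> path_edges xs} \<le> (if xs \<noteq> [] \<and> hd xs = u then 1 else 2)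
    \<and> finite {v. {v, u} \<in> path_edges xs}"
proof (induction xs rule: path_edges.induct)
  case (1 x y zs)
  let ?N = "{v. {v, u} \<in> path_edges (y # zs)}"
  have eq: "{v. {v, u} \<in> path_edges (x # y # zs)} = {v. {v, u} = {x, y}} \<union> ?N" by auto
  consider "u = x" | "u = y" "u \<noteq> x" | "u \<noteq> x" "u \<noteq> y" by auto
  then show ?case
  proof cases
    case 1
    then have "?N = {}" using path_edges_subset_set[of _ "y # zs"] "1.prems" by auto
    moreover have "{v. {v, u} = {x, y}} = {y}" using 1 "1.prems" by (auto simp: doubleton_eq_iff)
    ultimately show ?thesis using 1 eq by simp
  next
    case 2
    then have "{v. {v, u} = {x, y}} = {x}" by (auto simp: doubleton_eq_iff)
    moreover have "card ({x} \<union> ?N) \<le> 1 + card ?N" using card_Un_le[of "{x}" ?N] by simp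
    ultimately show ?thesis using 2 "1.IH" "1.prems" eq by simp
  next
    case 3
    then have "{v. {v, u} = {x, y}} = {}" by (auto simp: doubleton_eq_iff)
    then show ?thesis using 3 "1.IH" "1.prems" eq by simp
  qed
qed auto

definition induces_path :: "('a set \<Rightarrow> bool) \<Rightarrow> 'a list \<Rightarrow> bool" where
  "induces_path \<omega> xs \<longleftrightarrow>
     (\<forall>e\<in>path_edges xs. \<omega> e) \<and> (\<forall>e\<in>nsets (set xs) 2 - path_edges xs. \<not> \<omega> e)"

section \<open>Sequences with at most one vertex per block\<close>

definition block_seqs :: "'a set \<Rightarrow> ('a \<Rightarrow> 'b) \<Rightarrow> nat \<Rightarrow> 'a list set" where
  "block_seqs V blk k = {xs. length xs = k \<and> set xs \<subseteq> V \<and> distinct (map blk xs)}"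

lemma finite_block_seqs: "finite V \<Longrightarrow> finite (block_seqs V blk k)"
  using finite_lists_length_eq[of V k] by (auto simp: block_seqs_def elim!: rev_finite_subset)

lemma block_seqs_distinct: "xs \<in> block_seqs V blk k \<Longrightarrow> distinct xs"
  by (auto simp: block_seqs_def distinct_map)

lemma block_seqs_Suc:
  "block_seqs V blk (Suc k) =
    (\<lambda>(ys, v). v # ys) ` (SIGMA ys:block_seqs V blk k. {v \<in> V. blk v \<notin> blk ` set ys})"
  by (force simp: block_seqs_def length_Suc_conv image_iff)

lemma sum_block_seqs_Suc:
  assumes "finite V"
  shows "sum g (block_seqs V blk (Suc k)) =
    (\<Sum>ys\<in>block_seqs V blk k. \<Sum>v\<in>{v \<in> V. blk v \<notin> blk ` set ys}. g (v # ys))"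
proof -
  have "inj_on (\<lambda>(ys, v). v # ys) (SIGMA ys:block_seqs V blk k. {v \<in> V. blk v \<notin> blk ` set ys})"
    by (auto simp: inj_on_def)
  then show ?thesis
    unfolding block_seqs_Suc using assms
    by (simp add: sum.reindex sum.Sigma finite_block_seqs case_prod_unfold)
qed

text \<open>Since the blocks have equal size, the number of ways to extend a sequence depends on its
  length alone. Sums over sequences thereby turn into one-step recursions.\<close>

locale block_partition =
  fixes V :: "'a set" and blk :: "'a \<Rightarrow> nat" and B m :: nat
  assumes finV: "finite V" and blk_less: "\<And>v. v \<in> V \<Longrightarrow> blk v < B"
    and card_blk: "\<And>b. b < B \<Longrightarrow> card {v \<in> V. blk v = b} = m"
begin

lemma card_free:
  assumes "ys \<in> block_seqs V blk k"
  shows "card {v \<in> V. blk v \<notin> blk ` set ys} = (B - k) * m"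
proof -
  have sub: "blk ` set ys \<subseteq> {..<B}" using assms blk_less by (auto simp: block_seqs_def)
  have "distinct (map blk ys)" "length ys = k" using assms by (auto simp: block_seqs_def)
  then have "card (blk ` set ys) = k" using distinct_card[of "map blk ys"] by simp
  then have c: "card ({..<B} - blk ` set ys) = B - k" using sub by (simp add: card_Diff_subset)
  have "{v \<in> V. blk v \<notin> blk ` set ys} = (\<Union>b\<in>{..<B} - blk ` set ys. {v \<in> V. blk v = b})"
    using blk_less by auto
  then have "card {v \<in> V. blk v \<notin> blk ` set ys} = (\<Sum>b\<in>{..<B} - blk ` set ys. card {v \<in> V. blk v = b})"
    using finV by (simp, intro card_UN_disjoint) auto
  also have "\<dots> = (B - k) * m" using card_blk c by simp
  finally show ?thesis .
qed

lemma card_block_seqs_Suc: "card (block_seqs V blk (Suc k)) = (B - k) * m * card (block_seqs V blk k)"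
  using sum_block_seqs_Suc[OF finV, of "\<lambda>_. 1::nat" blk k] card_free by simp

lemma card_block_seqs_pos: "k \<le> B \<Longrightarrow> m > 0 \<Longrightarrow> card (block_seqs V blk k) > 0"
proof (induction k)
  case 0
  have "block_seqs V blk 0 = {[]}" by (auto simp: block_seqs_def)
  then show ?case by simp
next
  case (Suc k)
  then show ?case by (simp add: card_block_seqs_Suc)
qed

end

text \<open>The weight factorises along the list, so that it can be summed over all lists one entry at a
  time.\<close>

fun overlap_weight :: "'a set \<Rightarrow> 'a set set \<Rightarrow> real \<Rightarrow> real \<Rightarrow> 'a list \<Rightarrow> real" where
  "overlap_weight X E z p [] = 1"
| "overlap_weight X E z p (v # ys) =
     (if v \<in> X then z * (if ys \<noteq> [] \<and> {v, hd ys} \<in> E then 1 / p else 1) else 1) *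
     overlap_weight X E z p ys"

lemma overlap_weight_eq:
  assumes "E \<subseteq> nsets X 2" "distinct ys"
  shows "overlap_weight X E z p ys =
    z ^ card (set ys \<inter> X) * (1 / p) ^ card (path_edges ys \<inter> E)"
  using assms(2)
proof (induction ys)
  case (Cons v ys)
  have vX: "card (set (v # ys) \<inter> X) = (if v \<in> X then 1 else 0) + card (set ys \<inter> X)"
    using Cons.prems by (simp add: Int_insert_left)
  have "card (path_edges (v # ys) \<inter> E) =
      (if ys \<noteq> [] \<and> {v, hd ys} \<in> E then 1 else 0) + card (path_edges ys \<inter> E)"
  proof (cases ys)
    case (Cons u zs)
    have "{v, u} \<notin> path_edges (u # zs)"
      using path_edges_subset_set[of "{v, u}" "u # zs"] Cons.prems Cons by auto
    then show ?thesis using Cons by (simp add: Int_insert_left)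
  qed simp
  moreover have "v \<in> X" if "{v, hd ys} \<in> E" using that assms(1) by (auto simp: nsets_def)
  ultimately show ?case using Cons vX by (auto simp: algebra_simps)
qed simp

lemma overlap_weight_nonneg: "z \<ge> 0 \<Longrightarrow> p > 0 \<Longrightarrow> overlap_weight X E z p ys \<ge> 0"
  by (induction ys) auto

context block_partition
begin

text \<open>An entry of \<open>ys\<close> is free, or one of \<open>card X\<close> elements of \<open>X\<close> at cost \<open>z\<close>, or continues along
  one of two edges of \<open>E\<close> at cost \<open>z / p\<close>. The last option exists only after an entry in \<open>X\<close>;
  the factor 2 for lists with head in \<open>X\<close> turns the resulting two-state recursion into a
  one-step bound.\<close>

lemma sum_overlap_weight:
  assumes E: "E \<subseteq> nsets X 2" and deg: "\<And>u. card {v. {v, u} \<in> E} \<le> 2" "\<And>u. finite {v. {v, u} \<in> E}"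
    and X: "finite X" and z: "z \<ge> 0" and p: "0 < p" "p \<le> 1"
    and b: "8 * z \<le> p * (real B * real m)" and m: "m > 0"
    and k: "2 * k \<le> B"
  shows "(\<Sum>ys\<in>block_seqs V blk k. overlap_weight X E z p ys * (if ys \<noteq> [] \<and> hd ys \<in> X then 2 else 1))
     \<le> (1 + 4 * z * card X / (real B * real m)) ^ k * card (block_seqs V blk k)"
  using k
proof (induction k)
  case 0
  have "block_seqs V blk 0 = {[]}" by (auto simp: block_seqs_def)
  then show ?case by simp
next
  case (Suc k)
  let ?w = "overlap_weight X E z p"
  let ?F = "\<lambda>ys. ?w ys * (if ys \<noteq> [] \<and> hd ys \<in> X then 2 else 1)"
  define c where "c = 4 * z * card X / (real B * real m)"
  define n where "n = real (B - k) * real m"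
  have Bm: "real B * real m > 0" using Suc.prems m by simp
  have c0: "c \<ge> 0" using z by (simp add: c_def)
  \<comment> \<open>At most half of the blocks are occupied, so the candidates for the next entry
    still make up at least half of \<open>V\<close>.\<close>
  have n: "real B * real m \<le> 2 * n"
  proof -
    have "real B \<le> 2 * real (B - k)" using Suc.prems by (simp add: of_nat_diff)
    then have "real B * real m \<le> 2 * real (B - k) * real m" by (rule mult_right_mono) simp
    then show ?thesis by (simp add: n_def)
  qed
  have step: "(\<Sum>v\<in>{v \<in> V. blk v \<notin> blk ` set ys}. ?F (v # ys)) \<le> n * (1 + c) * ?F ys"
    if ys: "ys \<in> block_seqs V blk k" for ys
  proof -
    let ?A = "{v \<in> V. blk v \<notin> blk ` set ys}"
    define N where "N = {v. ys \<noteq> [] \<and> {v, hd ys} \<in> E}"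
    have finN: "finite N" using deg(2) by (simp add: N_def)
    have cN: "card N \<le> 2" using deg(1)[of "hd ys"] by (cases "ys = []") (simp_all add: N_def)
    have N0: "N = {}" if "\<not> (ys \<noteq> [] \<and> hd ys \<in> X)"
      using that E by (auto simp: N_def nsets_def)
    have finA: "finite ?A" using finV by simp
    have w0: "?w ys \<ge> 0" using z p by (intro overlap_weight_nonneg) auto
    have "(\<Sum>v\<in>?A. ?F (v # ys)) \<le> (\<Sum>v\<in>?A. ?w ys * (1 + 2 * z * indicator X v + 2 * z / p * indicator N v))"
    proof (rule sum_mono)
      fix v
      have "2 * z * (if ys \<noteq> [] \<and> {v, hd ys} \<in> E then 1 / p else 1) \<le> 1 + 2 * z + 2 * z / p * indicator N v"
        using z p by (auto simp: N_def)
      then have "(if v \<in> X then 2 * z * (if ys \<noteq> [] \<and> {v, hd ys} \<in> E then 1 / p else 1) else 1)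
          \<le> 1 + 2 * z * indicator X v + 2 * z / p * indicator N v"
        using z p by (auto split: split_indicator)
      from mult_left_mono[OF this w0]
      show "?F (v # ys) \<le> ?w ys * (1 + 2 * z * indicator X v + 2 * z / p * indicator N v)"
        by (auto simp: algebra_simps split: if_splits)
    qed
    also have "\<dots> = ?w ys * (card ?A + 2 * z * card (X \<inter> ?A) + 2 * z / p * card (N \<inter> ?A))"
      unfolding sum_distrib_left[symmetric] sum.distrib
      using sum_indicator_eq_card[OF finA, of X, THEN arg_cong, of real]
        sum_indicator_eq_card[OF finA, of N, THEN arg_cong, of real]
      by (simp add: Int_commute real_of_nat_indicator)
    also have "\<dots> \<le> ?w ys * (n + 2 * z * card X + 2 * z / p * card N)"
      using w0 z p X finN unfolding card_free[OF ys] n_def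
      by (intro mult_left_mono add_mono) (auto intro!: mult_left_mono divide_right_mono card_mono)
    also have "\<dots> \<le> ?w ys * (n * (1 + c) * (if ys \<noteq> [] \<and> hd ys \<in> X then 2 else 1))"
    proof (rule mult_left_mono[OF _ w0])
      have 1: "2 * z * card X \<le> n * c"
      proof -
        have "2 * z * card X = (real B * real m) / 2 * c" using Bm Suc.prems m by (simp add: c_def)
        also have "\<dots> \<le> n * c" using n c0 by (intro mult_right_mono) auto
        finally show ?thesis .
      qed
      have 2: "2 * z / p * card N \<le> n" 
      proof -
        have "2 * z / p * card N \<le> 2 * z / p * 2" using z p cN by (intro mult_left_mono) auto
        also have "\<dots> \<le> (real B * real m) / 2" using b p by (simp add: field_simps)
        finally show ?thesis using n by simp
      qed
      \<comment> \<open>If the previous entry lies in \<open>X\<close>, the factor 2 on the right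
        absorbs the extra \<open>n\<close> caused by \<open>N\<close>; otherwise \<open>N\<close> is
        empty and nothing has to be absorbed.\<close>
      show "n + 2 * z * card X + 2 * z / p * card N \<le> n * (1 + c) * (if ys \<noteq> [] \<and> hd ys \<in> X then 2 else 1)"
      proof (cases "ys \<noteq> [] \<and> hd ys \<in> X")
        case True
        have "n * c \<ge> 0" using c0 n Bm by simp
        with True 1 2 show ?thesis by (simp add: algebra_simps)
      next
        case False
        then have "N = {}" by (rule N0)
        with False 1 show ?thesis by (simp only: if_not_P) (simp add: algebra_simps)
      qed
    qed
    finally show ?thesis by (simp add: algebra_simps)
  qed
  have "(\<Sum>ys\<in>block_seqs V blk (Suc k). ?F ys) \<le> (\<Sum>ys\<in>block_seqs V blk k. n * (1 + c) * ?F ys)"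
    unfolding sum_block_seqs_Suc[OF finV] by (rule sum_mono) (rule step)
  also have "\<dots> = n * (1 + c) * (\<Sum>ys\<in>block_seqs V blk k. ?F ys)" by (simp add: sum_distrib_left)
  also have "\<dots> \<le> n * (1 + c) * ((1 + c) ^ k * card (block_seqs V blk k))"
    using Suc c0 by (intro mult_left_mono) (auto simp: c_def n_def)
  also have "\<dots> = (1 + c) ^ Suc k * card (block_seqs V blk (Suc k))"
    by (simp add: card_block_seqs_Suc n_def)
  finally show ?case by (simp add: c_def)
qed

lemma sum_overlap_weight_exp:
  assumes x: "x \<in> block_seqs V blk k" and z: "z \<ge> 0" and p: "0 < p" "p \<le> 1"
    and b: "8 * z \<le> p * (real B * real m)" and m: "m > 0"
    and k: "2 * k \<le> B"
  shows "(\<Sum>y\<in>block_seqs V blk k.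
      z ^ card (set y \<inter> set x) * (1 / p) ^ card (path_edges y \<inter> path_edges x))
     \<le> exp (4 * z * (real k)\<^sup>2 / (real B * real m)) * card (block_seqs V blk k)"
proof -
  let ?w = "overlap_weight (set x) (path_edges x) z p"
  have dx: "distinct x" using x by (rule block_seqs_distinct)
  have cx: "card (set x) = k" using dx x by (simp add: distinct_card block_seqs_def)
  have "(\<Sum>y\<in>block_seqs V blk k.
      z ^ card (set y \<inter> set x) * (1 / p) ^ card (path_edges y \<inter> path_edges x)) =
      (\<Sum>y\<in>block_seqs V blk k. ?w y)"
    using path_edges_subset[OF dx]
    by (intro sum.cong overlap_weight_eq[symmetric]) (auto intro: block_seqs_distinct)
  also have "\<dots> \<le> (\<Sum>y\<in>block_seqs V blk k. ?w y * (if y \<noteq> [] \<and> hd y \<in> set x then 2 else 1))"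
    using z p by (intro sum_mono) (auto intro: overlap_weight_nonneg)
  also have "\<dots> \<le> (1 + 4 * z * card (set x) / (real B * real m)) ^ k * card (block_seqs V blk k)"
  proof (rule sum_overlap_weight[OF path_edges_subset[OF dx]])
    show "card {v. {v, u} \<in> path_edges x} \<le> 2" for u
      using path_edges_degree[OF dx, of u] by (auto split: if_splits)
    show "finite {v. {v, u} \<in> path_edges x}" for u
      using path_edges_degree[OF dx, of u] by auto
  qed (use assms in auto)
  also have "\<dots> \<le> exp (4 * z * card (set x) / (real B * real m)) ^ k * card (block_seqs V blk k)"
    using z by (intro mult_right_mono power_mono exp_ge_add_one_self) auto
  also have "exp (4 * z * card (set x) / (real B * real m)) ^ k = exp (4 * z * (real k)\<^sup>2 / (real B * real m))"
    by (simp add: cx flip: exp_of_nat_mult) (simp add: power2_eq_square)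
  finally show ?thesis .
qed

section \<open>First and second moments of the number of induced paths\<close>

lemma prob_induces_path:
  assumes A: "finite A" "nsets V 2 \<subseteq> A" and p: "0 \<le> p" "p \<le> 1" and x: "x \<in> block_seqs V blk k"
  shows "measure_pmf.prob (Pi_pmf A False (\<lambda>_. bernoulli_pmf p)) {\<omega>. induces_path \<omega> x} =
    p ^ (k - 1) * (1 - p) ^ ((k choose 2) - (k - 1))"
proof -
  have dx: "distinct x" and sx: "set x \<subseteq> V" and lx: "length x = k"
    using x by (auto simp: block_seqs_distinct) (auto simp: block_seqs_def)
  have sub: "path_edges x \<subseteq> nsets (set x) 2" "nsets (set x) 2 \<subseteq> A"
    using path_edges_subset[OF dx] nsets_mono[OF sx] A by auto
  have "card (nsets (set x) 2 - path_edges x) = (k choose 2) - (k - 1)"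
    using sub(1) by (simp add: card_Diff_subset card_nsets card_path_edges dx lx distinct_card)
  moreover have "card (path_edges x) = k - 1" by (simp add: card_path_edges dx lx)
  ultimately show ?thesis
    unfolding induces_path_def using sub A p
    by (subst prob_bernoulli_cylinder) auto
qed

text \<open>Compared with the product of the two probabilities, common edges and common non-edges
  are paid for once instead of twice. A common non-edge is a pair of common vertices, whence the
  binomial coefficient. There is only an inequality because one path may demand an edge that the
  other forbids, and then the probability is 0.\<close>

lemma prob_induces_two_paths:
  assumes A: "finite A" "nsets V 2 \<subseteq> A" and p: "0 < p" "p < 1"
    and x: "x \<in> block_seqs V blk k" and y: "y \<in> block_seqs V blk k"
  shows "measure_pmf.prob (Pi_pmf A False (\<lambda>_. bernoulli_pmf p)) {\<omega>. induces_path \<omega> x \<and> induces_path \<omega> y}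
    \<le> (p ^ (k - 1) * (1 - p) ^ ((k choose 2) - (k - 1)))\<^sup>2 *
       ((1 / p) ^ card (path_edges y \<inter> path_edges x) * (1 / (1 - p)) ^ (card (set y \<inter> set x) choose 2))"
proof -
  let ?Ex = "path_edges x" and ?Ey = "path_edges y"
  let ?Nx = "nsets (set x) 2 - path_edges x" and ?Ny = "nsets (set y) 2 - path_edges y"
  let ?P = "measure_pmf.prob (Pi_pmf A False (\<lambda>_. bernoulli_pmf p))"
  define c where "c = (k choose 2) - (k - 1)"
  have dx: "distinct x" and sx: "set x \<subseteq> V" and lx: "length x = k"
    using x by (auto simp: block_seqs_distinct) (auto simp: block_seqs_def)
  have dy: "distinct y" and sy: "set y \<subseteq> V" and ly: "length y = k"
    using y by (auto simp: block_seqs_distinct) (auto simp: block_seqs_def)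
  have subx: "?Ex \<subseteq> nsets (set x) 2" "nsets (set x) 2 \<subseteq> A"
    using path_edges_subset[OF dx] nsets_mono[OF sx] A by auto
  have suby: "?Ey \<subseteq> nsets (set y) 2" "nsets (set y) 2 \<subseteq> A"
    using path_edges_subset[OF dy] nsets_mono[OF sy] A by auto
  have fin: "finite (nsets (set x) 2)" "finite (nsets (set y) 2)" by (auto intro: finite_imp_finite_nsets)
  have cNx: "card ?Nx = c" and cNy: "card ?Ny = c"
    using subx(1) suby(1) by (simp_all add: card_Diff_subset card_nsets card_path_edges dx lx dy ly distinct_card c_def)
  have cE: "card ?Ex = k - 1" "card ?Ey = k - 1" by (simp_all add: card_path_edges dx lx dy ly)
  have "{\<omega>. induces_path \<omega> x \<and> induces_path \<omega> y} =
      {\<omega>. (\<forall>e\<in>?Ex \<union> ?Ey. \<omega> e) \<and> (\<forall>e\<in>?Nx \<union> ?Ny. \<not> \<omega> e)}" (is "?L = ?R")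
    unfolding induces_path_def by blast
  moreover have "?P ?R \<le> p ^ card (?Ex \<union> ?Ey) * (1 - p) ^ card (?Nx \<union> ?Ny)"
  proof (cases "(?Ex \<union> ?Ey) \<inter> (?Nx \<union> ?Ny) = {}")
    case True
    then show ?thesis using subx suby A p by (subst prob_bernoulli_cylinder) auto
  next
    case False
    then have "?R = {}" by blast
    then have "?P ?R = 0" by (simp only: measure_empty)
    then show ?thesis using p by simp
  qed
  moreover have "p ^ card (?Ex \<union> ?Ey) * p ^ card (?Ey \<inter> ?Ex) = p ^ (k - 1) * p ^ (k - 1)"
    using card_Un_Int[of ?Ex ?Ey] cE by (simp add: Int_commute flip: power_add)
  then have "p ^ card (?Ex \<union> ?Ey) = (p ^ (k - 1))\<^sup>2 * (1 / p) ^ card (?Ey \<inter> ?Ex)"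
    using p by (simp add: field_simps power2_eq_square)
  moreover have "(1 - p) ^ card (?Nx \<union> ?Ny) \<le> ((1 - p) ^ c)\<^sup>2 * (1 / (1 - p)) ^ (card (set y \<inter> set x) choose 2)"
  proof -
    have "?Nx \<inter> ?Ny \<subseteq> nsets (set y \<inter> set x) 2" by (auto simp: nsets_def)
    then have "card (?Nx \<inter> ?Ny) \<le> card (nsets (set y \<inter> set x) 2)"
      by (intro card_mono finite_imp_finite_nsets) auto
    then have le: "card (?Nx \<inter> ?Ny) \<le> card (set y \<inter> set x) choose 2" by (simp add: card_nsets)
    have "(1 - p) ^ card (?Nx \<union> ?Ny) * (1 - p) ^ (card (set y \<inter> set x) choose 2) \<le>
        (1 - p) ^ card (?Nx \<union> ?Ny) * (1 - p) ^ card (?Nx \<inter> ?Ny)"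
      using p le by (intro mult_left_mono power_decreasing) auto
    also have "\<dots> = (1 - p) ^ c * (1 - p) ^ c"
      using card_Un_Int[of ?Nx ?Ny] cNx cNy fin by (simp flip: power_add)
    finally show ?thesis using p by (simp add: field_simps power2_eq_square)
  qed
  ultimately have "?P ?L \<le> (p ^ (k - 1))\<^sup>2 * (1 / p) ^ card (?Ey \<inter> ?Ex) *
      (((1 - p) ^ c)\<^sup>2 * (1 / (1 - p)) ^ (card (set y \<inter> set x) choose 2))"
    using p by (smt (verit, best) mult_left_mono zero_le_power zero_le_mult_iff zero_le_divide_1_iff)
  then show ?thesis by (simp add: c_def power_mult_distrib algebra_simps)
qed

text \<open>The factor for \<open>s\<close> common vertices has an exponent quadratic in
  \<open>s\<close> and does not factorise along a sequence. Hypothesis \<open>bound\<close> replaces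
  it by two geometric terms, to which \<open>overlap_weight\<close> applies: \<open>z1\<close> is
  meant for small overlaps, \<open>z2\<close> for large ones, where a tiny \<open>w\<close> makes up
  for the larger base.\<close>

theorem prob_ex_induces_path:
  assumes A: "finite A" "nsets V 2 \<subseteq> A" and p: "0 < p" "p < 1" and m: "m > 0" and k: "2 * k \<le> B"
    and z: "z1 \<ge> 0" "z2 \<ge> 0" "8 * z1 \<le> p * (real B * real m)" "8 * z2 \<le> p * (real B * real m)"
    and w: "w \<ge> 0"
    and bound: "\<And>s. s \<le> k \<Longrightarrow> (1 / (1 - p)) ^ (s choose 2) \<le> z1 ^ s + w * z2 ^ s"
  shows "measure_pmf.prob (Pi_pmf A False (\<lambda>_. bernoulli_pmf p))
      {\<omega>. \<exists>x\<in>block_seqs V blk k. induces_path \<omega> x} \<ge>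
    1 / (exp (4 * z1 * (real k)\<^sup>2 / (real B * real m)) + w * exp (4 * z2 * (real k)\<^sup>2 / (real B * real m)))"
    (is "_ \<ge> 1 / ?R")
proof -
  let ?P = "measure_pmf.prob (Pi_pmf A False (\<lambda>_. bernoulli_pmf p))"
  let ?S = "block_seqs V blk k"
  define \<mu> where "\<mu> = p ^ (k - 1) * (1 - p) ^ ((k choose 2) - (k - 1))"
  let ?e = "\<lambda>x y. (1 / p) ^ card (path_edges y \<inter> path_edges x)"
  have \<mu>: "\<mu> > 0" using p by (simp add: \<mu>_def)
  have cS: "card ?S > 0" using k m by (intro card_block_seqs_pos) auto
  have inner: "(\<Sum>y\<in>?S. ?P {\<omega>. induces_path \<omega> x \<and> induces_path \<omega> y}) \<le> \<mu>\<^sup>2 * (?R * card ?S)"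
    if x: "x \<in> ?S" for x
  proof -
    have "(\<Sum>y\<in>?S. ?P {\<omega>. induces_path \<omega> x \<and> induces_path \<omega> y}) \<le>
        (\<Sum>y\<in>?S. \<mu>\<^sup>2 * (z1 ^ card (set y \<inter> set x) * ?e x y + w * (z2 ^ card (set y \<inter> set x) * ?e x y)))"
    proof (rule sum_mono)
      fix y assume y: "y \<in> ?S"
      have "card (set y \<inter> set x) \<le> card (set x)" by (rule card_mono) auto
      also have "\<dots> \<le> k" using x card_length[of x] by (simp add: block_seqs_def)
      finally have "?e x y * (1 / (1 - p)) ^ (card (set y \<inter> set x) choose 2) \<le>
          ?e x y * (z1 ^ card (set y \<inter> set x) + w * z2 ^ card (set y \<inter> set x))"
        using p bound by (intro mult_left_mono) auto
      then have "\<mu>\<^sup>2 * (?e x y * (1 / (1 - p)) ^ (card (set y \<inter> set x) choose 2)) \<le>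
          \<mu>\<^sup>2 * (?e x y * (z1 ^ card (set y \<inter> set x) + w * z2 ^ card (set y \<inter> set x)))"
        by (rule mult_left_mono) simp
      then show "?P {\<omega>. induces_path \<omega> x \<and> induces_path \<omega> y} \<le>
          \<mu>\<^sup>2 * (z1 ^ card (set y \<inter> set x) * ?e x y + w * (z2 ^ card (set y \<inter> set x) * ?e x y))"
        using prob_induces_two_paths[OF A p x y] by (simp add: \<mu>_def algebra_simps)
    qed
    also have "\<dots> = \<mu>\<^sup>2 * ((\<Sum>y\<in>?S. z1 ^ card (set y \<inter> set x) * ?e x y) +
        w * (\<Sum>y\<in>?S. z2 ^ card (set y \<inter> set x) * ?e x y))"
      by (simp only: sum.distrib flip: sum_distrib_left)
    also have "\<dots> \<le> \<mu>\<^sup>2 * (exp (4 * z1 * (real k)\<^sup>2 / (real B * real m)) * card ?S +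
        w * (exp (4 * z2 * (real k)\<^sup>2 / (real B * real m)) * card ?S))"
      using p z m k w x by (intro mult_left_mono add_mono sum_overlap_weight_exp) auto
    finally show ?thesis by (simp add: algebra_simps)
  qed
  show ?thesis
  proof (rule second_moment_method[where m = "\<mu> * card ?S"])
    show "(\<Sum>x\<in>?S. ?P {\<omega>. induces_path \<omega> x}) = \<mu> * card ?S"
      using prob_induces_path[OF A, of p _ k] p by (simp add: \<mu>_def)
    have "(\<Sum>x\<in>?S. \<Sum>y\<in>?S. ?P {\<omega>. induces_path \<omega> x \<and> induces_path \<omega> y}) \<le>
        (\<Sum>x\<in>?S. \<mu>\<^sup>2 * (?R * card ?S))"
      by (rule sum_mono) (rule inner)
    then show "(\<Sum>x\<in>?S. \<Sum>y\<in>?S. ?P {\<omega>. induces_path \<omega> x \<and> induces_path \<omega> y}) \<le>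
        ?R * (\<mu> * card ?S)\<^sup>2" by (simp add: power2_eq_square algebra_simps)
    show "0 < \<mu> * card ?S" using \<mu> cS by simp
    show "0 < ?R" using w by (simp add: add_pos_nonneg)
    show "finite ?S" using finV by (rule finite_block_seqs)
  qed (use A in \<open>auto intro!: finite_set_Pi_pmf\<close>)
qed

end

section \<open>Chains with few defects\<close>

fun chordless :: "('a set \<Rightarrow> bool) \<Rightarrow> 'a list \<Rightarrow> bool" where
  "chordless \<omega> [] \<longleftrightarrow> True"
| "chordless \<omega> (x # ys) \<longleftrightarrow> (\<forall>z\<in>set (tl ys). \<not> \<omega> {x, z}) \<and> chordless \<omega> ys"

fun defects :: "('a set \<Rightarrow> bool) \<Rightarrow> 'a list \<Rightarrow> nat" where
  "defects \<omega> (x # y # zs) = (if \<omega> {x, y} then 0 else 1) + defects \<omega> (y # zs)"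
| "defects \<omega> _ = 0"

text \<open>Deleting \<open>v\<close> makes only its two neighbours in the list newly consecutive,
  and consecutive pairs are exempt from the chord condition. For the same reason a deletion creates
  at most one defect.\<close>

lemma chordless_remove: "chordless \<omega> (as @ v # cs) \<Longrightarrow> chordless \<omega> (as @ cs)"
proof (induction as)
  case (Cons a as)
  have "set (tl (as @ cs)) \<subseteq> set (tl (as @ v # cs))"
    by (cases as; cases cs) auto
  then show ?case using Cons by auto
qed simp

lemma defects_remove: "defects \<omega> (as @ cs) \<le> Suc (defects \<omega> (as @ v # cs))"
proof (induction as)
  case Nil
  then show ?case by (cases cs) auto
next
  case (Cons a as)
  then show ?case by (cases as; cases cs) auto
qed

lemma chordless_cong:
  "(\<And>x y. x \<in> set xs \<Longrightarrow> y \<in> set xs \<Longrightarrow> \<omega> {x, y} = \<omega>' {x, y}) \<Longrightarrow> chordless \<omega> xs = chordless \<omega>' xs"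
proof (induction xs)
  case (Cons x xs)
  have "set (tl xs) \<subseteq> set xs" by (cases xs) auto
  then have "(\<forall>z\<in>set (tl xs). \<not> \<omega> {x, z}) = (\<forall>z\<in>set (tl xs). \<not> \<omega>' {x, z})"
    using Cons.prems by (intro ball_cong) auto
  with Cons show ?case by simp
qed simp

lemma defects_cong:
  "(\<And>x y. x \<in> set xs \<Longrightarrow> y \<in> set xs \<Longrightarrow> \<omega> {x, y} = \<omega>' {x, y}) \<Longrightarrow> defects \<omega> xs = defects \<omega>' xs"
  by (induction \<omega> xs rule: defects.induct) auto

lemma chordless_nth:
  "chordless \<omega> xs \<Longrightarrow> Suc i < j \<Longrightarrow> j < length xs \<Longrightarrow> \<not> \<omega> {xs ! i, xs ! j}"
proof (induction xs arbitrary: i j)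
  case (Cons x xs)
  show ?case
  proof (cases i)
    case 0
    obtain j' where j: "j = Suc (Suc j')" using Cons.prems 0 by (cases j; cases "j - 1") auto
    then have "xs ! Suc j' = tl xs ! j'" "j' < length (tl xs)" using Cons.prems by (auto simp: nth_tl)
    then have "xs ! Suc j' \<in> set (tl xs)" by auto
    then show ?thesis using Cons.prems 0 j by auto
  next
    case (Suc i')
    then show ?thesis using Cons.IH[of i' "j - 1"] Cons.prems by (cases j) auto
  qed
qed simp

lemma defects_eq_sum:
  "defects \<omega> xs = (\<Sum>i<length xs - 1. of_bool (\<not> \<omega> {xs ! i, xs ! Suc i}))"
proof (induction \<omega> xs rule: defects.induct)
  case (1 \<omega> x y zs)
  then show ?case by (simp add: sum.lessThan_Suc_shift del: sum.lessThan_Suc)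
qed auto

lemma defects_eq_card:
  "defects \<omega> xs = card {i. Suc i < length xs \<and> \<not> \<omega> {xs ! i, xs ! Suc i}}"
proof -
  have "{i. Suc i < length xs \<and> \<not> \<omega> {xs ! i, xs ! Suc i}} =
      {..<length xs - 1} \<inter> {i. \<not> \<omega> {xs ! i, xs ! Suc i}}"
    by auto
  then show ?thesis by (simp add: defects_eq_sum)
qed

lemma induces_path_chordless:
  assumes "induces_path \<omega> xs" "distinct xs"
  shows "chordless \<omega> xs \<and> defects \<omega> xs = 0"
proof -
  have "path_edges (x # xs) = (if xs = [] then {} else insert {x, hd xs} (path_edges xs))" for x :: 'a and xs
    by (cases xs) auto
  note pe = this
  have sub: "chordless \<omega> ys \<and> defects \<omega> ys = 0" if "induces_path \<omega> ys" "distinct ys" for ys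
    using that
  proof (induction ys)
    case (Cons y ys)
    have 1: "e \<notin> path_edges ys" if "y \<in> e" for e
      using path_edges_subset_set[of e ys] that Cons.prems by auto
    have "induces_path \<omega> ys"
      unfolding induces_path_def
    proof (intro conjI ballI)
      fix e assume "e \<in> path_edges ys"
      then have "e \<in> path_edges (y # ys)" by (subst pe) auto
      then show "\<omega> e" using Cons.prems(1) unfolding induces_path_def by blast
    next
      fix e assume e: "e \<in> nsets (set ys) 2 - path_edges ys"
      then have "e \<in> nsets (set (y # ys)) 2" "y \<notin> e" using Cons.prems(2) by (auto simp: nsets_def)
      then have "e \<in> nsets (set (y # ys)) 2 - path_edges (y # ys)" using e by (subst pe) auto
      then show "\<not> \<omega> e" using Cons.prems(1) unfolding induces_path_def by blast
    qed
    then have IH: "chordless \<omega> ys \<and> defects \<omega> ys = 0" using Cons by simp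
    have "\<not> \<omega> {y, z}" if "z \<in> set (tl ys)" for z
    proof -
      obtain u zs where ys: "ys = u # zs" "z \<in> set zs" using \<open>z \<in> set (tl ys)\<close> by (cases ys) auto
      then have zy: "z \<in> set ys" "z \<noteq> y" "z \<noteq> hd ys" "ys \<noteq> []" using Cons.prems(2) by auto
      then have "{y, z} \<notin> path_edges (y # ys)" using 1[of "{y, z}"] by (subst pe) (auto simp: doubleton_eq_iff)
      then have "{y, z} \<in> nsets (set (y # ys)) 2 - path_edges (y # ys)" using zy by auto
      then show ?thesis using Cons.prems(1) unfolding induces_path_def by blast
    qed
    moreover have "\<omega> {y, hd ys}" if "ys \<noteq> []"
    proof -
      have "{y, hd ys} \<in> path_edges (y # ys)" using that by (subst pe) auto
      then show ?thesis using Cons.prems(1) unfolding induces_path_def by blast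
    qed
    ultimately show ?case using IH by (cases ys) auto
  qed simp
  show ?thesis using sub assms by blast
qed

text \<open>\<open>P j i\<close> is the vertex number \<open>i\<close> of path \<open>j\<close>. The
  index set is arbitrary because the pieces of a chain that contain a defect are discarded and leave
  gaps in the numbering.\<close>

definition path_system ::
  "('a set \<Rightarrow> bool) \<Rightarrow> 'a set \<Rightarrow> nat set \<Rightarrow> nat \<Rightarrow> (nat \<Rightarrow> nat \<Rightarrow> 'a) \<Rightarrow> bool" where
  "path_system \<omega> V J l P \<longleftrightarrow>
     (\<forall>j\<in>J. \<forall>i<l. P j i \<in> V) \<and>
     inj_on (\<lambda>(j, i). P j i) (J \<times> {..<l}) \<and>
     (\<forall>j\<in>J. \<forall>i i'. i < i' \<longrightarrow> i' < l \<longrightarrow> \<omega> {P j i, P j i'} = (i' = Suc i)) \<and>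
     (\<forall>j\<in>J. \<forall>j'\<in>J. j \<noteq> j' \<longrightarrow> (\<forall>i<l. \<forall>i'<l. \<not> \<omega> {P j i, P j' i'}))"

text \<open>The chain is cut into pieces of \<open>Suc l\<close> vertices, and the last vertex of
  each piece is thrown away. Indices from different pieces then differ by at least 2, so
  chordlessness excludes edges between the pieces. A defect spoils at most the piece in which it
  begins.\<close>

lemma path_system_of_chordless:
  assumes ch: "chordless \<omega> xs" and d: "distinct xs" and V: "set xs \<subseteq> V"
    and N: "N + defects \<omega> xs \<le> length xs div Suc l"
  shows "\<exists>J P. finite J \<and> card J = N \<and> path_system \<omega> V J l P"
proof -
  let ?L = "Suc l"
  let ?D = "{i. Suc i < length xs \<and> \<not> \<omega> {xs ! i, xs ! Suc i}}"
  have finD: "finite ?D" by (rule finite_subset[of _ "{..<length xs}"]) auto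
  define J0 where "J0 = {..<length xs div ?L} - (\<lambda>i. i div ?L) ` ?D"
  have "card J0 \<ge> length xs div ?L - card ((\<lambda>i. i div ?L) ` ?D)"
    unfolding J0_def using diff_card_le_card_Diff[of "(\<lambda>i. i div ?L) ` ?D" "{..<length xs div ?L}"] finD by simp
  moreover have "card ((\<lambda>i. i div ?L) ` ?D) \<le> defects \<omega> xs"
    unfolding defects_eq_card by (rule card_image_le[OF finD])
  ultimately have "N \<le> card J0" using N by linarith
  then obtain J where J: "J \<subseteq> J0" "card J = N" "finite J"
    by (meson obtain_subset_with_card_n)
  define P where "P = (\<lambda>j i. xs ! (j * ?L + i))"
  have len: "j * ?L + i < length xs" if "j \<in> J" "i \<le> l" for j i
  proof -
    have "Suc j \<le> length xs div ?L" using that J by (auto simp: J0_def)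
    then have "Suc j * ?L \<le> length xs" by (metis less_eq_div_iff_mult_less_eq zero_less_Suc)
    then show ?thesis using that by simp
  qed
  have divL: "(j * ?L + i) div ?L = j" if "i \<le> l" for j i
    using that by (simp add: div_add1_eq flip: mult_Suc_right)
  have idx: "j = j' \<and> i = i'" if "j * ?L + i = j' * ?L + i'" "i \<le> l" "i' \<le> l" for j i j' i'
  proof -
    have "j = (j' * ?L + i') div ?L" using divL[OF that(2), of j] that(1) by (simp only:)
    then have "j = j'" using divL[OF that(3), of j'] by (simp only:)
    then show ?thesis using that(1) by simp
  qed
  have gap: "\<not> \<omega> {P j i, P j' i'}" if "j \<in> J" "j' \<in> J" "j < j'" "i < l" "i' < l" for j j' i i'
  proof -
    have "Suc j * ?L \<le> j' * ?L" using that(3) by (intro mult_le_mono1) simp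
    then have "j * ?L + ?L \<le> j' * ?L" by simp
    then have "Suc (j * ?L + i) < j' * ?L + i'" using that by linarith
    then show ?thesis unfolding P_def using ch len[of j' i'] that by (intro chordless_nth) auto
  qed
  have "path_system \<omega> V J l P"
    unfolding path_system_def
  proof (intro conjI)
    show "\<forall>j\<in>J. \<forall>i<l. P j i \<in> V"
    proof (intro ballI allI impI)
      fix j i assume "j \<in> J" "i < l"
      then have "xs ! (j * ?L + i) \<in> set xs" using len[of j i] by (intro nth_mem) simp
      then show "P j i \<in> V" using V by (auto simp: P_def)
    qed
    show "inj_on (\<lambda>(j, i). P j i) (J \<times> {..<l})"
    proof (rule inj_onI, safe)
      fix j i j' i' assume *: "j \<in> J" "i < l" "j' \<in> J" "i' < l" and eq: "P j i = P j' i'"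
      have "j * ?L + i = j' * ?L + i'"
        using nth_eq_iff_index_eq[OF d len[of j i] len[of j' i']] eq * unfolding P_def by simp
      then have "j = j' \<and> i = i'" using * by (intro idx) simp_all
      then show "j = j'" "i = i'" by simp_all
    qed
    show "\<forall>j\<in>J. \<forall>i i'. i < i' \<longrightarrow> i' < l \<longrightarrow> \<omega> {P j i, P j i'} = (i' = Suc i)"
    proof (intro ballI allI impI)
      fix j i i' assume *: "j \<in> J" "i < i'" "i' < l"
      show "\<omega> {P j i, P j i'} = (i' = Suc i)"
      proof (cases "i' = Suc i")
        case True
        have "j * ?L + i \<notin> ?D"
        proof
          assume "j * ?L + i \<in> ?D"
          moreover have "j = (j * ?L + i) div ?L" by (rule divL[symmetric]) (use * in simp)
          ultimately have "j \<in> (\<lambda>i. i div ?L) ` ?D" by (rule rev_image_eqI)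
          then show False using *(1) J(1) unfolding J0_def by blast
        qed
        moreover have "Suc (j * ?L + i) < length xs" using True len[of j i'] * by simp
        ultimately have "\<omega> {xs ! (j * ?L + i), xs ! Suc (j * ?L + i)}" by blast
        then show ?thesis using True by (simp add: P_def)
      next
        case False
        have "\<not> \<omega> {xs ! (j * ?L + i), xs ! (j * ?L + i')}"
          by (rule chordless_nth[OF ch]) (use False * len[of j i'] in auto)
        then show ?thesis using False by (simp only: P_def)
      qed
    qed
    show "\<forall>j\<in>J. \<forall>j'\<in>J. j \<noteq> j' \<longrightarrow> (\<forall>i<l. \<forall>i'<l. \<not> \<omega> {P j i, P j' i'})"
    proof (intro ballI allI impI)
      fix j j' i i' assume *: "j \<in> J" "j' \<in> J" "j \<noteq> j'" "i < l" "i' < l"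
      show "\<not> \<omega> {P j i, P j' i'}"
      proof (cases "j < j'")
        case True
        then show ?thesis using * by (intro gap)
      next
        case False
        then have "\<not> \<omega> {P j' i', P j i}" using * by (intro gap) simp_all
        then show ?thesis by (metis insert_commute)
      qed
    qed
  qed
  then show ?thesis using J by blast
qed

section \<open>The penalised longest chain and its concentration\<close>

context block_partition
begin

definition chains :: "('a set \<Rightarrow> bool) \<Rightarrow> 'a list set" where
  "chains \<omega> = {xs. set xs \<subseteq> V \<and> distinct (map blk xs) \<and> chordless \<omega> xs}"

definition chain_value :: "real \<Rightarrow> ('a set \<Rightarrow> bool) \<Rightarrow> 'a list \<Rightarrow> real" where
  "chain_value \<kappa> \<omega> xs = real (length xs) - \<kappa> * real (defects \<omega> xs)"

definition max_chain :: "real \<Rightarrow> ('a set \<Rightarrow> bool) \<Rightarrow> real" where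
  "max_chain \<kappa> \<omega> = Max (chain_value \<kappa> \<omega> ` chains \<omega>)"

lemma finite_chains: "finite (chains \<omega>)"
proof (rule finite_subset)
  show "chains \<omega> \<subseteq> {xs. set xs \<subseteq> V \<and> length xs \<le> card V}"
  proof
    fix xs assume xs: "xs \<in> chains \<omega>"
    then have "distinct xs" "set xs \<subseteq> V" by (auto simp: chains_def distinct_map)
    then have "length xs \<le> card V" by (metis card_mono distinct_card finV)
    then show "xs \<in> {xs. set xs \<subseteq> V \<and> length xs \<le> card V}" using \<open>set xs \<subseteq> V\<close> by simp
  qed
  show "finite {xs. set xs \<subseteq> V \<and> length xs \<le> card V}" by (rule finite_lists_length_le[OF finV])
qed

lemma chain_value_le_max: "xs \<in> chains \<omega> \<Longrightarrow> chain_value \<kappa> \<omega> xs \<le> max_chain \<kappa> \<omega>"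
  unfolding max_chain_def using finite_chains by (intro Max_ge) auto

lemma max_chain_attained: "\<exists>xs\<in>chains \<omega>. max_chain \<kappa> \<omega> = chain_value \<kappa> \<omega> xs"
proof -
  have "[] \<in> chains \<omega>" by (simp add: chains_def)
  then have "max_chain \<kappa> \<omega> \<in> chain_value \<kappa> \<omega> ` chains \<omega>"
    unfolding max_chain_def using finite_chains by (intro Max_in) auto
  then show ?thesis by auto
qed

text \<open>Deleting the vertex of the changed block from an optimal chain costs one vertex and creates at
  most one new defect.\<close>

lemma max_chain_lipschitz_aux:
  assumes \<kappa>: "\<kappa> \<ge> 0" and eq: "\<And>e. (\<And>v. v \<in> e \<Longrightarrow> blk v \<noteq> b) \<Longrightarrow> \<omega> e = \<omega>' e"
  shows "max_chain \<kappa> \<omega> - (1 + \<kappa>) \<le> max_chain \<kappa> \<omega>'"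
proof -
  obtain xs where xs: "xs \<in> chains \<omega>" "max_chain \<kappa> \<omega> = chain_value \<kappa> \<omega> xs"
    using max_chain_attained by blast
  obtain ys where ys: "set ys \<subseteq> set xs" "distinct (map blk ys)" "chordless \<omega> ys" "\<forall>v\<in>set ys. blk v \<noteq> b"
    "length xs \<le> Suc (length ys)" "defects \<omega> ys \<le> Suc (defects \<omega> xs)"
  proof (cases "\<exists>v\<in>set xs. blk v = b")
    case True
    then obtain v as cs where v: "xs = as @ v # cs" "blk v = b" by (auto dest!: split_list)
    show ?thesis
      using v xs(1) chordless_remove[of \<omega> as v cs] defects_remove[of \<omega> as cs v]
      by (intro that[of "as @ cs"]) (auto simp: chains_def rev_image_eqI)
  next
    case False
    then show ?thesis using xs(1) by (intro that[of xs]) (auto simp: chains_def)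
  qed
  have agree: "\<omega> {x, y} = \<omega>' {x, y}" if "x \<in> set ys" "y \<in> set ys" for x y
    using that ys(4) by (intro eq) auto
  have "ys \<in> chains \<omega>'"
    using xs(1) ys chordless_cong[of ys \<omega> \<omega>', OF agree] by (auto simp: chains_def)
  then have "chain_value \<kappa> \<omega>' ys \<le> max_chain \<kappa> \<omega>'" by (rule chain_value_le_max)
  moreover have "\<kappa> * real (defects \<omega> ys) \<le> \<kappa> * (1 + real (defects \<omega> xs))"
    using ys(6) \<kappa> by (intro mult_left_mono) auto
  ultimately show ?thesis
    using xs(2) ys(5) defects_cong[of ys \<omega> \<omega>', OF agree] by (simp add: chain_value_def algebra_simps)
qed

lemma max_chain_lipschitz:
  assumes "\<kappa> \<ge> 0" "\<And>e. (\<And>v. v \<in> e \<Longrightarrow> blk v \<noteq> b) \<Longrightarrow> \<omega> e = \<omega>' e"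
  shows "\<bar>max_chain \<kappa> \<omega> - max_chain \<kappa> \<omega>'\<bar> \<le> 1 + \<kappa>"
proof -
  have "max_chain \<kappa> \<omega> - (1 + \<kappa>) \<le> max_chain \<kappa> \<omega>'"
    using assms by (rule max_chain_lipschitz_aux)
  moreover have "max_chain \<kappa> \<omega>' - (1 + \<kappa>) \<le> max_chain \<kappa> \<omega>"
    using assms(1) by (rule max_chain_lipschitz_aux) (rule assms(2)[symmetric])
  ultimately show ?thesis by (simp add: abs_le_iff)
qed

text \<open>Concentration is used twice, and the mean is never computed. If the mean were at most
  \<open>k - t\<close>, the upper tail would bound the probability of an induced path on
  \<open>k\<close> vertices by less than \<open>exp (- s)\<close>, against \<open>ex\<close>. Hence
  the mean exceeds \<open>k - t\<close>, and the lower tail costs another \<open>t\<close>.\<close>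

theorem prob_max_chain_le:
  fixes p s t \<kappa> :: real
  assumes \<kappa>: "\<kappa> \<ge> 0" and t: "t > 0" and B: "B > 0"
    and s: "s < 2 * t\<^sup>2 / ((1 + \<kappa>)\<^sup>2 * B)"
  defines "P \<equiv> Pi_pmf (nsets V 2) False (\<lambda>_. bernoulli_pmf p)"
  assumes ex: "measure_pmf.prob P {\<omega>. \<exists>x\<in>block_seqs V blk k. induces_path \<omega> x} \<ge> exp (- s)"
  shows "measure_pmf.prob P {\<omega>. max_chain \<kappa> \<omega> \<le> real k - 2 * t} \<le> exp (- 2 * t\<^sup>2 / ((1 + \<kappa>)\<^sup>2 * B))"
proof -
  \<comment> \<open>Each pair is assigned to the larger of the blocks of its two vertices. This
    partitions the independent coordinates into \<open>B\<close> groups, and a change in group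
    \<open>b\<close> concerns only pairs that meet block \<open>b\<close>.\<close>
  define A where "A b = {e \<in> nsets V 2. Max (blk ` e) = b}" for b
  have finE: "finite (nsets V 2)" by (rule finite_imp_finite_nsets[OF finV])
  have fin: "finite (A b)" if "b \<in> {..<B}" for b using finE by (simp add: A_def)
  have disj: "A i \<inter> A j = {}" if "i \<in> {..<B}" "j \<in> {..<B}" "i \<noteq> j" for i j using that(3) unfolding A_def by blast
  have Max_in: "Max (blk ` e) \<in> blk ` e" if "e \<in> nsets V 2" for e
  proof -
    have "finite e" "card e = 2" using that by (auto simp: nsets_def)
    then have "finite e" "e \<noteq> {}" by auto
    then show ?thesis by (intro Max_in) auto
  qed
  have Un: "nsets V 2 = (\<Union>b\<in>{..<B}. A b)"
  proof -
    have "Max (blk ` e) < B" if "e \<in> nsets V 2" for e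
      using Max_in[OF that] that blk_less by (auto simp: nsets_def)
    then show ?thesis by (auto simp: A_def)
  qed
  have lip: "\<bar>max_chain \<kappa> \<omega> - max_chain \<kappa> \<omega>'\<bar> \<le> 1 + \<kappa>" if "b \<in> {..<B}" "\<And>e. e \<notin> A b \<Longrightarrow> \<omega> e = \<omega>' e" for b \<omega> \<omega>'
  proof (rule max_chain_lipschitz[OF \<kappa>])
    fix e assume *: "\<And>v. v \<in> e \<Longrightarrow> blk v \<noteq> b"
    have "b \<notin> blk ` e" using * by blast
    have "e \<notin> A b"
    proof
      assume "e \<in> A b"
      then have "e \<in> nsets V 2" "Max (blk ` e) = b" by (simp_all add: A_def)
      with Max_in[of e] \<open>b \<notin> blk ` e\<close> show False by simp
    qed
    then show "\<omega> e = \<omega>' e" by (rule that(2))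
  qed
  have P: "P = Pi_pmf (\<Union>b\<in>{..<B}. A b) False (\<lambda>_. bernoulli_pmf p)" by (simp add: P_def Un)
  have ne: "{..<B} \<noteq> {}" using B by auto
  define \<mu> where "\<mu> = measure_pmf.expectation P (max_chain \<kappa>)"
  note mcd = mcdiarmid_upper[where A = A and I = "{..<B}" and f = "max_chain \<kappa>" and c = "1 + \<kappa>"
      and q = "\<lambda>_. bernoulli_pmf p" and dflt = False and t = t, folded P, folded \<mu>_def]
    mcdiarmid_lower[where A = A and I = "{..<B}" and f = "max_chain \<kappa>" and c = "1 + \<kappa>"
      and q = "\<lambda>_. bernoulli_pmf p" and dflt = False and t = t, folded P, folded \<mu>_def]
  have up: "measure_pmf.prob P {\<omega>. \<mu> + t \<le> max_chain \<kappa> \<omega>} \<le> exp (- 2 * t\<^sup>2 / ((1 + \<kappa>)\<^sup>2 * B))"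
  proof -
    have "measure_pmf.prob P {\<omega>. \<mu> + t \<le> max_chain \<kappa> \<omega>} \<le> exp (- 2 * t\<^sup>2 / ((1 + \<kappa>)\<^sup>2 * real (card {..<B})))"
    proof (rule mcd(1))
      show "\<bar>max_chain \<kappa> \<omega> - max_chain \<kappa> \<omega>'\<bar> \<le> 1 + \<kappa>"
        if "i \<in> {..<B}" "\<And>x. x \<notin> A i \<Longrightarrow> \<omega> x = \<omega>' x" for i \<omega> \<omega>'
        using that by (rule lip)
    qed (use fin disj t \<kappa> ne in simp_all)
    then show ?thesis by simp
  qed
  have low: "measure_pmf.prob P {\<omega>. max_chain \<kappa> \<omega> \<le> \<mu> - t} \<le> exp (- 2 * t\<^sup>2 / ((1 + \<kappa>)\<^sup>2 * B))"
  proof -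
    have "measure_pmf.prob P {\<omega>. max_chain \<kappa> \<omega> \<le> \<mu> - t} \<le> exp (- 2 * t\<^sup>2 / ((1 + \<kappa>)\<^sup>2 * real (card {..<B})))"
    proof (rule mcd(2))
      show "\<bar>max_chain \<kappa> \<omega> - max_chain \<kappa> \<omega>'\<bar> \<le> 1 + \<kappa>"
        if "i \<in> {..<B}" "\<And>x. x \<notin> A i \<Longrightarrow> \<omega> x = \<omega>' x" for i \<omega> \<omega>'
        using that by (rule lip)
    qed (use fin disj t \<kappa> ne in simp_all)
    then show ?thesis by simp
  qed
  have "\<mu> > real k - t"
  proof (rule ccontr)
    assume "\<not> \<mu> > real k - t"
    then have "{\<omega>. \<exists>x\<in>block_seqs V blk k. induces_path \<omega> x} \<subseteq> {\<omega>. \<mu> + t \<le> max_chain \<kappa> \<omega>}"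
    proof safe
      fix \<omega> x assume x: "x \<in> block_seqs V blk k" "induces_path \<omega> x" and \<mu>: "\<not> \<mu> > real k - t"
      have c: "chordless \<omega> x \<and> defects \<omega> x = 0"
        using induces_path_chordless[OF x(2) block_seqs_distinct[OF x(1)]] .
      then have "x \<in> chains \<omega>" using x(1) by (auto simp: chains_def block_seqs_def)
      from chain_value_le_max[OF this, of \<kappa>] have "real k \<le> max_chain \<kappa> \<omega>"
        using c x(1) by (simp add: chain_value_def block_seqs_def)
      then show "\<mu> + t \<le> max_chain \<kappa> \<omega>" using \<mu> by simp
    qed
    then have "measure_pmf.prob P {\<omega>. \<exists>x\<in>block_seqs V blk k. induces_path \<omega> x} \<le>
        measure_pmf.prob P {\<omega>. \<mu> + t \<le> max_chain \<kappa> \<omega>}"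
      by (intro measure_pmf.finite_measure_mono) auto
    with up ex have "exp (- s) \<le> exp (- 2 * t\<^sup>2 / ((1 + \<kappa>)\<^sup>2 * B))" by linarith
    then show False using s by simp
  qed
  then have "measure_pmf.prob P {\<omega>. max_chain \<kappa> \<omega> \<le> real k - 2 * t} \<le>
      measure_pmf.prob P {\<omega>. max_chain \<kappa> \<omega> \<le> \<mu> - t}"
    by (intro measure_pmf.finite_measure_mono) auto
  with low show ?thesis by linarith
qed

text \<open>The penalty for a defect equals the length \<open>Suc l\<close> of a piece. The value of
  a chain is thus its length after paying for every piece that a defect may destroy.\<close>

lemma path_system_of_max_chain:
  assumes "max_chain (real (Suc l)) \<omega> > K" and N: "real (Suc N) * real (Suc l) \<le> K"
  shows "\<exists>J P. finite J \<and> card J = N \<and> path_system \<omega> V J l P"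
proof -
  obtain xs where xs: "xs \<in> chains \<omega>" "max_chain (real (Suc l)) \<omega> = chain_value (real (Suc l)) \<omega> xs"
    using max_chain_attained by blast
  have "real (Suc N) * real (Suc l) < real (length xs) - real (Suc l) * real (defects \<omega> xs)"
    using assms xs(2) by (simp add: chain_value_def)
  then have "real ((Suc N + defects \<omega> xs) * Suc l) < real (length xs)"
    by (simp add: algebra_simps)
  then have "(Suc N + defects \<omega> xs) * Suc l < length xs" by (simp only: of_nat_less_iff)
  then have "(N + defects \<omega> xs) * Suc l \<le> length xs" by simp
  then have "N + defects \<omega> xs \<le> length xs div Suc l" by (simp only: less_eq_div_iff_mult_less_eq zero_less_Suc)
  then show ?thesis using xs(1)
    by (intro path_system_of_chordless[where xs = xs]) (auto simp: chains_def distinct_map)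
qed

end

section \<open>Connecting paths by depth-first search\<close>

text \<open>\<open>R z a b\<close> stands for a connector \<open>z\<close> leading from the end of
  path \<open>a\<close> to the beginning of path \<open>b\<close>, and \<open>C z y\<close> for
  compatibility of two connectors. The lists grow at the front, so the head of the first one is the
  path from which the search continues.\<close>

inductive dfs_stack :: "('z \<Rightarrow> 'a \<Rightarrow> 'a \<Rightarrow> bool) \<Rightarrow> ('z \<Rightarrow> 'z \<Rightarrow> bool) \<Rightarrow> 'a list \<Rightarrow> 'z list \<Rightarrow> bool"
  for R C where
  base: "dfs_stack R C [a] []"
| push: "dfs_stack R C (a # ps) cs \<Longrightarrow> R z a b \<Longrightarrow> b \<notin> set (a # ps) \<Longrightarrow> \<forall>y\<in>set cs. C z y \<Longrightarrow>
    dfs_stack R C (b # a # ps) (z # cs)"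

text \<open>\<open>U\<close> contains the unvisited elements, \<open>F\<close> the popped ones,
  \<open>Z\<close> every connector used so far. The inequality for \<open>card Z\<close> holds
  because each new connector takes an element out of \<open>U\<close>; it keeps the set of forbidden
  vertices within the size for which further connectors are guaranteed.\<close>

definition dfs_inv ::
  "('z \<Rightarrow> 'a \<Rightarrow> 'a \<Rightarrow> bool) \<Rightarrow> ('z \<Rightarrow> 'z \<Rightarrow> bool) \<Rightarrow> 'a set \<Rightarrow> 'z set \<Rightarrow> 'a set \<Rightarrow> 'a set \<Rightarrow> 'a list \<Rightarrow> 'z list \<Rightarrow> 'z set \<Rightarrow> bool"
  where
  "dfs_inv R C J W U F ps cs Z \<longleftrightarrow>
     U \<inter> F = {} \<and> distinct ps \<and> set ps \<inter> U = {} \<and> set ps \<inter> F = {} \<and> U \<union> F \<union> set ps = J \<and>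
     (ps = [] \<and> cs = [] \<or> dfs_stack R C ps cs) \<and> set cs \<subseteq> Z \<and> Z \<subseteq> W \<and> finite Z \<and>
     card Z + card U \<le> card J \<and> (\<forall>a\<in>F. \<forall>b\<in>U. \<forall>z. \<not> (R z a b \<and> (\<forall>y\<in>Z. C z y)))"

text \<open>A push moves an element from \<open>U\<close> to the stack and a pop shortens the stack,
  so \<open>2 * card U + length ps\<close> decreases in both cases. As \<open>U\<close> loses at
  most one element at a time, its size cannot skip the value \<open>r\<close> at which the search is
  stopped.\<close>

lemma dfs_inv_step:
  assumes inv: "dfs_inv R C J W U F ps cs Z" and J: "finite J" and U: "U \<noteq> {}"
    and W: "\<And>z a b. R z a b \<Longrightarrow> z \<in> W"
  obtains U' F' ps' cs' Z' where "dfs_inv R C J W U' F' ps' cs' Z'"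
    "2 * card U' + length ps' < 2 * card U + length ps" "card U \<le> Suc (card U')"
proof (cases ps)
  case Nil
  obtain u where u: "u \<in> U" using U by auto
  have finU: "finite U" using inv J by (auto simp: dfs_inv_def intro: finite_subset)
  have cU: "card U = Suc (card (U - {u}))" using finU u by (rule card.remove)
  have "card Z + card U \<le> card J" using inv by (simp add: dfs_inv_def)
  then have "card Z + card (U - {u}) \<le> card J" using cU by linarith
  then have "dfs_inv R C J W (U - {u}) F [u] [] Z"
    using inv u Nil unfolding dfs_inv_def by (auto intro: dfs_stack.base)
  moreover have "2 * card (U - {u}) + length [u] < 2 * card U + length ps" using cU Nil by simp
  moreover have "card U \<le> Suc (card (U - {u}))" using cU by linarith
  ultimately show ?thesis by (rule that)
next
  case (Cons a ps')
  have finU: "finite U" using inv J by (auto simp: dfs_inv_def intro: finite_subset)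
  have st: "dfs_stack R C (a # ps') cs" using inv Cons by (auto simp: dfs_inv_def)
  show ?thesis
  proof (cases "\<exists>b\<in>U. \<exists>z. R z a b \<and> (\<forall>y\<in>Z. C z y)")
    case True
    then obtain b z where b: "b \<in> U" "R z a b" "\<forall>y\<in>Z. C z y" by blast
    have cU: "card U = Suc (card (U - {b}))" using finU b(1) by (rule card.remove)
    have cs: "set cs \<subseteq> Z" "finite Z" using inv by (auto simp: dfs_inv_def)
    have "dfs_stack R C (b # a # ps') (z # cs)"
      using b inv Cons cs by (intro dfs_stack.push[OF st]) (auto simp: dfs_inv_def)
    moreover have "card (insert z Z) + card (U - {b}) \<le> card J"
    proof -
      have "card Z + card U \<le> card J" using inv by (simp add: dfs_inv_def)
      moreover have "card (insert z Z) \<le> Suc (card Z)" using cs by (simp add: card_insert_if)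
      ultimately show ?thesis using cU by linarith
    qed
    ultimately have "dfs_inv R C J W (U - {b}) F (b # ps) (z # cs) (insert z Z)"
      using inv b Cons W[OF b(2)] unfolding dfs_inv_def by auto
    moreover have "2 * card (U - {b}) + length (b # ps) < 2 * card U + length ps" using cU by simp
    moreover have "card U \<le> Suc (card (U - {b}))" using cU by linarith
    ultimately show ?thesis by (rule that)
  next
    case False
    obtain cs' where cs': "ps' = [] \<and> cs' = [] \<or> dfs_stack R C ps' cs'" "set cs' \<subseteq> set cs"
      using st by (cases rule: dfs_stack.cases) auto
    have "dfs_inv R C J W U (insert a F) ps' cs' Z"
      using inv Cons False cs' by (auto simp: dfs_inv_def)
    then show ?thesis using Cons by (intro that) auto
  qed
qed

text \<open>Depth-first search. All connectors ever used stay in \<open>Z\<close>, so an element that was popped because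
  no further connector existed cannot be connected to an unvisited element later either.\<close>

lemma dfs_long_stack:
  assumes J: "finite J" and r: "0 < r" "2 * r \<le> card J"
    and W: "\<And>z a b. R z a b \<Longrightarrow> z \<in> W"
    and hyp: "\<And>S T Z. S \<subseteq> J \<Longrightarrow> T \<subseteq> J \<Longrightarrow> S \<inter> T = {} \<Longrightarrow> card S = r \<Longrightarrow> card T = r \<Longrightarrow>
      Z \<subseteq> W \<Longrightarrow> finite Z \<Longrightarrow> card Z \<le> card J \<Longrightarrow> \<exists>a\<in>S. \<exists>b\<in>T. \<exists>z. R z a b \<and> (\<forall>y\<in>Z. C z y)"
  obtains ps cs where "dfs_stack R C ps cs" "set ps \<subseteq> J" "distinct ps" "set cs \<subseteq> W"
    "card J < length ps + 2 * r"
proof -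
  have reach: "\<exists>U' F' ps' cs' Z'. dfs_inv R C J W U' F' ps' cs' Z' \<and> card U' = r"
    if "dfs_inv R C J W U F ps cs Z" "r \<le> card U" for U F ps cs Z
    using that
  proof (induction "2 * card U + length ps" arbitrary: U F ps cs Z rule: less_induct)
    case less
    show ?case
    proof (cases "card U = r")
      case False
      have "U \<noteq> {}" using less.prems r by auto
      obtain U' F' ps' cs' Z' where *: "dfs_inv R C J W U' F' ps' cs' Z'"
        "2 * card U' + length ps' < 2 * card U + length ps" "card U \<le> Suc (card U')"
      proof (rule dfs_inv_step[OF less.prems(1) J \<open>U \<noteq> {}\<close>])
        show "z \<in> W" if "R z a b" for z a b using that by (rule W)
      qed (rule that)
      then show ?thesis using less.hyps[of U' ps' F' cs' Z'] less.prems(2) False by auto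
    qed (use less in blast)
  qed
  have "dfs_inv R C J W J {} [] [] {}" by (auto simp: dfs_inv_def)
  then obtain U F ps cs Z where inv: "dfs_inv R C J W U F ps cs Z" and U: "card U = r"
    using reach[of J "{}" "[]" "[]" "{}"] r by auto
  have fin: "finite U" "finite F" using inv J by (auto simp: dfs_inv_def intro: finite_subset)
  \<comment> \<open>The search is stopped with exactly \<open>r\<close> unvisited elements. With
    \<open>r\<close> popped elements as \<open>S\<close> and \<open>U\<close> as \<open>T\<close>,
    \<open>hyp\<close> would produce a connector that the last clause of the invariant rules out.
    Fewer than \<open>2 * r\<close> elements are therefore off the stack.\<close>
  have "card F < r"
  proof (rule ccontr)
    assume "\<not> card F < r"
    then obtain S where S: "S \<subseteq> F" "card S = r" by (meson not_less obtain_subset_with_card_n)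
    have "\<exists>a\<in>S. \<exists>b\<in>U. \<exists>z. R z a b \<and> (\<forall>y\<in>Z. C z y)"
      using inv S U by (intro hyp) (auto simp: dfs_inv_def)
    then obtain a b z where "a \<in> S" "b \<in> U" "R z a b" "\<forall>y\<in>Z. C z y" by blast
    moreover have "\<forall>a\<in>F. \<forall>b\<in>U. \<forall>z. \<not> (R z a b \<and> (\<forall>y\<in>Z. C z y))"
      using inv by (simp add: dfs_inv_def)
    ultimately show False using S(1) by blast
  qed
  moreover have "card J = card U + card F + length ps"
  proof -
    have "card J = card (U \<union> F \<union> set ps)" using inv by (simp add: dfs_inv_def)
    also have "\<dots> = card (U \<union> F) + card (set ps)"
      using fin inv by (intro card_Un_disjoint) (auto simp: dfs_inv_def)
    also have "card (U \<union> F) = card U + card F"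
      using fin inv by (intro card_Un_disjoint) (auto simp: dfs_inv_def)
    finally show ?thesis using inv by (simp add: dfs_inv_def distinct_card)
  qed
  ultimately have len: "card J < length ps + 2 * r" using U by simp
  then have "ps \<noteq> []" using r by auto
  then have "dfs_stack R C ps cs" using inv by (auto simp: dfs_inv_def)
  then show ?thesis using inv len by (intro that) (auto simp: dfs_inv_def)
qed

text \<open>\<open>induces_path\<close> describes an induced path by its edge set, which suits
  probabilities; this form by indices suits concatenation.\<close>

definition ipath :: "('a set \<Rightarrow> bool) \<Rightarrow> 'a list \<Rightarrow> bool" where
  "ipath \<omega> xs \<longleftrightarrow> distinct xs \<and>
     (\<forall>i j. i < j \<longrightarrow> j < length xs \<longrightarrow> \<omega> {xs ! i, xs ! j} = (j = Suc i))"

lemma ipath_of_chordless: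
  assumes "chordless \<omega> xs" "defects \<omega> xs = 0" "distinct xs"
  shows "ipath \<omega> xs"
  unfolding ipath_def
proof (intro conjI allI impI)
  fix i j assume ij: "i < j" "j < length xs"
  have "finite {i. Suc i < length xs \<and> \<not> \<omega> {xs ! i, xs ! Suc i}}"
    by (rule finite_subset[of _ "{..<length xs}"]) auto
  then have "{i. Suc i < length xs \<and> \<not> \<omega> {xs ! i, xs ! Suc i}} = {}"
    using assms(2) by (simp add: defects_eq_card)
  then have *: "\<omega> {xs ! i, xs ! Suc i}" if "Suc i < length xs" for i using that by blast
  show "\<omega> {xs ! i, xs ! j} = (j = Suc i)"
  proof (cases "j = Suc i")
    case False
    then have "\<not> \<omega> {xs ! i, xs ! j}" using ij by (intro chordless_nth[OF assms(1)]) auto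
    then show ?thesis using False by blast
  qed (use * ij in blast)
qed (rule assms(3))

lemma ipath_append:
  assumes us: "ipath \<omega> us" "us \<noteq> []" and vs: "ipath \<omega> vs" "vs \<noteq> []" and "set us \<inter> set vs = {}"
    and cross: "\<And>u v. u \<in> set us \<Longrightarrow> v \<in> set vs \<Longrightarrow> \<omega> {u, v} = (u = last us \<and> v = hd vs)"
  shows "ipath \<omega> (us @ vs)"
  unfolding ipath_def
proof (intro conjI allI impI)
  show "distinct (us @ vs)" using assms by (auto simp: ipath_def)
  have du: "distinct us" and dv: "distinct vs" using us vs by (auto simp: ipath_def)
  fix i j assume ij: "i < j" "j < length (us @ vs)"
  consider "j < length us" | "length us \<le> i" | "i < length us" "length us \<le> j" using ij by linarith
  then show "\<omega> {(us @ vs) ! i, (us @ vs) ! j} = (j = Suc i)"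
  proof cases
    case 1
    then show ?thesis using us ij by (simp add: ipath_def nth_append)
  next
    case 2
    then have "\<omega> {vs ! (i - length us), vs ! (j - length us)} = (j - length us = Suc (i - length us))"
      using vs ij by (auto simp: ipath_def)
    then show ?thesis using 2 ij by (simp add: nth_append) linarith
  next
    case 3
    let ?j = "j - length us"
    have j: "?j < length vs" using 3 ij by auto
    have "\<omega> {us ! i, vs ! ?j} = (us ! i = last us \<and> vs ! ?j = hd vs)"
      using 3 j by (intro cross) auto
    also have "us ! i = last us \<longleftrightarrow> i = length us - 1"
      using us 3 by (simp add: last_conv_nth nth_eq_iff_index_eq[OF du])
    also have "vs ! ?j = hd vs \<longleftrightarrow> ?j = 0"
      using vs(2) j by (simp add: hd_conv_nth nth_eq_iff_index_eq[OF dv])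
    also have "i = length us - 1 \<and> ?j = 0 \<longleftrightarrow> j = Suc i" using 3 by linarith
    finally show ?thesis using 3 by (simp add: nth_append)
  qed
qed

section \<open>Gluing the paths of a stack along their connectors\<close>

definition segs :: "(nat \<Rightarrow> nat \<Rightarrow> 'a) \<Rightarrow> nat set \<Rightarrow> nat set \<Rightarrow> 'a set" where
  "segs P S I = (\<lambda>(j, i). P j i) ` (S \<times> I)"

text \<open>The neighbours of \<open>z\<close> are prescribed on all paths of the system, including
  those not yet visited, so that \<open>z\<close> cannot become the end of a chord later.\<close>

definition connects ::
  "('a set \<Rightarrow> bool) \<Rightarrow> nat set \<Rightarrow> nat \<Rightarrow> (nat \<Rightarrow> nat \<Rightarrow> 'a) \<Rightarrow> nat \<Rightarrow> 'a \<Rightarrow> nat \<Rightarrow> nat \<Rightarrow> bool" where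
  "connects \<omega> J l P h z a b \<longleftrightarrow> (\<exists>i j. l - h \<le> j \<and> j < l \<and> i < h \<and>
     (\<forall>w\<in>segs P J {..<l}. \<omega> {z, w} = (w = P a j \<or> w = P b i)))"

text \<open>The path on top of the stack has been entered at position \<open>i\<close>, but where it
  will be left depends on the next connector. Hence the claim for every cut \<open>q\<close>. A path
  that has been left runs from an entry below \<open>h\<close> to an exit at \<open>l - h\<close> or
  later and contributes at least \<open>l - 2 * h\<close> vertices. The first conjunct keeps the
  used connectors non-adjacent to paths that may be pushed later.\<close>

lemma ipath_of_dfs_stack:
  assumes ps: "path_system \<omega> V J l P" and h: "2 * h < l" "0 < h" and V2: "V \<inter> V2 = {}"
    and R: "\<And>z a b. R z a b \<Longrightarrow> z \<in> V2 \<and> connects \<omega> J l P h z a b"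
    and C: "\<And>z y. C z y \<Longrightarrow> z \<noteq> y \<and> \<not> \<omega> {z, y}"
    and st: "dfs_stack R C as cs" and J: "set as \<subseteq> J"
  shows "(\<forall>y\<in>set cs. y \<in> V2 \<and> (\<forall>a\<in>J - set as. \<forall>i<l. \<not> \<omega> {y, P a i})) \<and>
    (\<exists>xs i. i < h \<and> set xs \<subseteq> segs P (set (tl as)) {..<l} \<union> set cs \<and>
       (length as - 1) * (l - 2 * h) \<le> length xs \<and>
       (\<forall>q. i < q \<longrightarrow> q \<le> l \<longrightarrow> ipath \<omega> (xs @ map (P (hd as)) [i..<q])))"
  using st J
proof (induction rule: dfs_stack.induct)
  have seg: "ipath \<omega> (map (P a) [i..<q])" if "a \<in> J" "q \<le> l" for a i q
    using ps that unfolding ipath_def path_system_def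
    by (auto simp: distinct_map inj_on_def)
  note seg' = this
  {
    case (base a)
    show ?case using seg[of a _ 0] base h by (intro conjI exI[of _ "[]"] exI[of _ 0]) auto
  next
    case (push a as cs z b)
    let ?as = "a # as"
    have inJ: "a \<in> J" "b \<in> J" "set as \<subseteq> J" using push.prems by auto
    obtain xs i where xs: "i < h" "set xs \<subseteq> segs P (set as) {..<l} \<union> set cs"
        "length as * (l - 2 * h) \<le> length xs"
        "\<And>q. i < q \<Longrightarrow> q \<le> l \<Longrightarrow> ipath \<omega> (xs @ map (P a) [i..<q])"
      using push.IH push.prems by auto
    have cs: "y \<in> V2" "\<And>a' k. a' \<in> J - set ?as \<Longrightarrow> k < l \<Longrightarrow> \<not> \<omega> {y, P a' k}" if "y \<in> set cs" for y
      using push.IH push.prems that by auto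
    obtain i' j where z: "l - h \<le> j" "j < l" "i' < h"
        "\<And>w. w \<in> segs P J {..<l} \<Longrightarrow> \<omega> {z, w} = (w = P a j \<or> w = P b i')"
      using R[OF push.hyps(2)] unfolding connects_def by blast
    have zV: "z \<in> V2" using R[OF push.hyps(2)] by blast
    have inV: "P a' k \<in> V" if "a' \<in> J" "k < l" for a' k using ps that by (auto simp: path_system_def)
    have inj: "a1 = a2 \<and> k1 = k2" if "P a1 k1 = P a2 k2" "a1 \<in> J" "a2 \<in> J" "k1 < l" "k2 < l" for a1 a2 k1 k2
    proof -
      have "inj_on (\<lambda>(j, i). P j i) (J \<times> {..<l})" using ps by (simp add: path_system_def)
      from inj_onD[OF this, of "(a1, k1)" "(a2, k2)"] that show ?thesis by simp
    qed
    have zP: "\<omega> {z, P a' k} = ((a' = a \<and> k = j) \<or> (a' = b \<and> k = i'))" if "a' \<in> J" "k < l" for a' k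
    proof -
      have "\<omega> {z, P a' k} = (P a' k = P a j \<or> P a' k = P b i')"
        using that by (intro z(4)) (auto simp: segs_def)
      moreover have "P a' k = P a j \<longleftrightarrow> a' = a \<and> k = j" using inj[of a' k a j] that inJ z by auto
      moreover have "P a' k = P b i' \<longleftrightarrow> a' = b \<and> k = i'" using inj[of a' k b i'] that inJ z h by auto
      ultimately show ?thesis by simp
    qed
    have ij: "i \<le> j" using xs(1) z(1) h by linarith
    \<comment> \<open>The new connector fixes the exit \<open>j\<close> of path \<open>a\<close>,
      and the open segment is cut right after it.\<close>
    define us where "us = xs @ map (P a) [i..<Suc j]"
    have us: "ipath \<omega> us" "us \<noteq> []" "last us = P a j"
      using xs(4)[of "Suc j"] z ij by (auto simp: us_def last_map)
    have us_set: "set us \<subseteq> segs P (set ?as) {..<l} \<union> set cs"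
      using xs(2) z by (auto simp: us_def segs_def)
    have bas: "b \<notin> set ?as" using push.hyps(3) .
    have ext: "ipath \<omega> (us @ z # map (P b) [i'..<q])" if q: "i' < q" "q \<le> l" for q
    proof (rule ipath_append[OF us(1,2)])
      let ?vs = "map (P b) [i'..<q]"
      have "ipath \<omega> ([z] @ ?vs)"
      proof (rule ipath_append)
        show "ipath \<omega> [z]" by (simp add: ipath_def)
        show "ipath \<omega> ?vs" using seg'[OF inJ(2) q(2)] .
        show "?vs \<noteq> []" using q by simp
        have "z \<noteq> P b k" if "k < q" for k using zV V2 inV[of b k] inJ(2) q that by auto
        then have "\<forall>k\<in>{i'..<q}. z \<noteq> P b k" by simp
        then have "z \<notin> P b ` {i'..<q}" by blast
        then show "set [z] \<inter> set ?vs = {}" by simp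
        fix u v assume "u \<in> set [z]" "v \<in> set ?vs"
        then obtain k where k: "u = z" "v = P b k" "i' \<le> k" "k < q" by auto
        have "P b k = P b i' \<longleftrightarrow> k = i'" using inj[of b k b i'] inJ k q by auto
        moreover have "hd ?vs = P b i'" using q by (simp add: hd_map)
        ultimately show "\<omega> {u, v} = (u = last [z] \<and> v = hd ?vs)"
          using zP[of b k] k q inJ bas by auto
      qed simp
      then show "ipath \<omega> (z # ?vs)" by simp
      show "set us \<inter> set (z # ?vs) = {}"
      proof (rule ccontr)
        assume "set us \<inter> set (z # ?vs) \<noteq> {}"
        then obtain u where u0: "u \<in> set us" "u \<in> set (z # ?vs)" by blast
        have "u = z \<or> u \<in> P b ` {i'..<q}" using u0(2) by simp
        then have u: "u \<in> set us" "u = z \<or> (\<exists>k. u = P b k \<and> k < l)" using u0(1) q by force+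
        consider a' k where "u = P a' k" "a' \<in> set ?as" "k < l" | "u \<in> set cs"
          using u(1) us_set by (auto simp: segs_def)
        then show False
        proof cases
          case 1
          have aJ: "a' \<in> J" using 1 inJ by auto
          then have "u \<noteq> z" using inV[of a' k] 1 zV V2 by auto
          then obtain k' where "u = P b k'" "k' < l" using u by auto
          then have "a' = b" using inj[of a' k b k'] 1 aJ inJ by auto
          then show False using 1 bas by simp
        next
          case 2
          have "u \<noteq> z" using push.hyps(4) C[of z u] 2 by auto
          then obtain k' where "u = P b k'" "k' < l" using u by auto
          then show False using inV[of b k'] inJ cs(1)[OF 2] V2 by auto
        qed
      qed
      fix u v assume u: "u \<in> set us" and v: "v \<in> set (z # ?vs)"
      consider a' k where "u = P a' k" "a' \<in> set ?as" "k < l" | "u \<in> set cs"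
        using u us_set by (auto simp: segs_def)
      note ucases = this
      show "\<omega> {u, v} = (u = last us \<and> v = hd (z # ?vs))"
      proof (cases "v = z")
        case True
        from ucases show ?thesis
        proof cases
          case 1
          have aJ: "a' \<in> J" using 1 inJ by auto
          have "\<omega> {z, P a' k} = (a' = a \<and> k = j)" using zP[OF aJ 1(3)] 1 bas by auto
          moreover have "P a' k = P a j \<longleftrightarrow> a' = a \<and> k = j" using inj[of a' k a j] 1 aJ inJ z by auto
          ultimately show ?thesis using True 1 us(3) by (simp add: insert_commute)
        next
          case 2
          have "\<not> \<omega> {z, u}" using push.hyps(4) C[of z u] 2 by auto
          moreover have "u \<noteq> P a j" using cs(1)[OF 2] inV[of a j] inJ z V2 by auto
          ultimately show ?thesis using True us(3) by (simp add: insert_commute)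
        qed
      next
        case False
        then have "v \<in> P b ` {i'..<q}" using v by simp
        then obtain k' where v: "v = P b k'" "k' < l" using q by force
        from ucases have "\<not> \<omega> {u, v}"
        proof cases
          case 1
          have aJ: "a' \<in> J" using 1 inJ by auto
          have "a' \<noteq> b" using 1 bas by auto
          then show ?thesis using ps 1 v aJ inJ unfolding path_system_def by blast
        next
          case 2
          then show ?thesis using cs(2)[OF 2, of b k'] v inJ bas by auto
        qed
        then show ?thesis using False by simp
      qed
    qed simp
    show ?case
    proof (intro conjI ballI)
      fix y assume y: "y \<in> set (z # cs)"
      then show "y \<in> V2" using zV cs by auto
      fix a' assume a': "a' \<in> J - set (b # a # as)"
      show "\<forall>k<l. \<not> \<omega> {y, P a' k}"
      proof (cases "y = z")
        case True
        then show ?thesis using zP[of a'] a' by auto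
      next
        case False
        then show ?thesis using y cs(2)[of y a'] a' by auto
      qed
    next
      have "l - 2 * h \<le> length (map (P a) [i..<Suc j])"
        using xs(1) z(1) h ij by (simp only: length_map length_upt)
      then have "(length (b # a # as) - 1) * (l - 2 * h) \<le> length (us @ [z])"
        using xs(3) by (simp add: us_def)
      moreover have "set (us @ [z]) \<subseteq> segs P (set (tl (b # a # as))) {..<l} \<union> set (z # cs)"
        using us_set by auto
      ultimately show "\<exists>xs i. i < h \<and> set xs \<subseteq> segs P (set (tl (b # a # as))) {..<l} \<union> set (z # cs) \<and>
          (length (b # a # as) - 1) * (l - 2 * h) \<le> length xs \<and>
          (\<forall>q. i < q \<longrightarrow> q \<le> l \<longrightarrow> ipath \<omega> (xs @ map (P (hd (b # a # as))) [i..<q]))"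
        using z(3) ext by (intro exI[of _ "us @ [z]"] exI[of _ i']) auto
    qed
  }
qed

text \<open>\<open>Z\<close> stands for the connectors already in use. For \<open>w\<close> in
  \<open>Z\<close> the equivalence amounts to non-adjacency of \<open>z\<close> and
  \<open>w\<close>, because \<open>u\<close> and \<open>v\<close> lie on the paths, outside
  \<open>V2\<close> in all applications.\<close>

definition connectable ::
  "('a set \<Rightarrow> bool) \<Rightarrow> nat set \<Rightarrow> nat \<Rightarrow> (nat \<Rightarrow> nat \<Rightarrow> 'a) \<Rightarrow> nat \<Rightarrow> nat \<Rightarrow> 'a set \<Rightarrow> bool" where
  "connectable \<omega> J l P h r V2 \<longleftrightarrow>
     (\<forall>S T Z. S \<subseteq> J \<longrightarrow> T \<subseteq> J \<longrightarrow> S \<inter> T = {} \<longrightarrow> card S = r \<longrightarrow> card T = r \<longrightarrow> Z \<subseteq> V2 \<longrightarrow> card Z \<le> card J \<longrightarrow>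
       (\<exists>z\<in>V2 - Z. \<exists>u\<in>segs P S {l - h..<l}. \<exists>v\<in>segs P T {..<h}.
          \<forall>w\<in>segs P J {..<l} \<union> Z. \<omega> {z, w} = (w = u \<or> w = v)))"

lemma ipath_of_connectable:
  assumes ps: "path_system \<omega> V J l P" and h: "2 * h < l" "0 < h" and V2: "V \<inter> V2 = {}"
    and J: "finite J" and r: "0 < r" "2 * r \<le> card J"
    and con: "connectable \<omega> J l P h r V2"
  shows "\<exists>xs. ipath \<omega> xs \<and> set xs \<subseteq> V \<union> V2 \<and> (card J - 2 * r) * (l - 2 * h) \<le> length xs"
proof -
  define R where "R z a b \<longleftrightarrow> z \<in> V2 \<and> connects \<omega> J l P h z a b" for z a b
  define C where "C z y \<longleftrightarrow> z \<noteq> y \<and> \<not> \<omega> {z, y}" for z y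
  have PV: "P a k \<in> V" if "a \<in> J" "k < l" for a k using ps that by (auto simp: path_system_def)
  have "\<exists>a\<in>S. \<exists>b\<in>T. \<exists>z. R z a b \<and> (\<forall>y\<in>Z. C z y)"
    if *: "S \<subseteq> J" "T \<subseteq> J" "S \<inter> T = {}" "card S = r" "card T = r" "Z \<subseteq> V2" "card Z \<le> card J" for S T Z
  proof -
    obtain z u v where z: "z \<in> V2 - Z" "u \<in> segs P S {l - h..<l}" "v \<in> segs P T {..<h}"
        "\<And>w. w \<in> segs P J {..<l} \<union> Z \<Longrightarrow> \<omega> {z, w} = (w = u \<or> w = v)"
      using con[unfolded connectable_def, rule_format, OF *] by blast
    obtain a j where a: "a \<in> S" "l - h \<le> j" "j < l" "u = P a j" using z(2) by (auto simp: segs_def)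
    obtain b i where b: "b \<in> T" "i < h" "v = P b i" using z(3) by (auto simp: segs_def)
    have "connects \<omega> J l P h z a b"
      unfolding connects_def using a b z(4) by blast
    moreover have "\<forall>y\<in>Z. C z y"
    proof
      fix y assume y: "y \<in> Z"
      have "u \<in> V" "v \<in> V" using a b PV[of a j] PV[of b i] * h by auto
      then have "y \<noteq> u" "y \<noteq> v" using y *(6) V2 by auto
      then show "C z y" using z(1) z(4)[of y] y by (auto simp: C_def)
    qed
    ultimately show ?thesis using a(1) b(1) z(1) by (auto simp: R_def)
  qed
  note hyp = this
  obtain as cs where as: "dfs_stack R C as cs" "set as \<subseteq> J" "distinct as" "set cs \<subseteq> V2"
      "card J < length as + 2 * r"
  proof (rule dfs_long_stack[OF J r, where R = R and C = C and W = V2])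
    show "z \<in> V2" if "R z a b" for z a b using that by (simp add: R_def)
  qed (use hyp in blast)+
  have "\<exists>xs i. i < h \<and> set xs \<subseteq> segs P (set (tl as)) {..<l} \<union> set cs \<and>
       (length as - 1) * (l - 2 * h) \<le> length xs \<and>
       (\<forall>q. i < q \<longrightarrow> q \<le> l \<longrightarrow> ipath \<omega> (xs @ map (P (hd as)) [i..<q]))"
    using ipath_of_dfs_stack[OF ps h V2 _ _ as(1,2)] by (auto simp: R_def C_def)
  then obtain xs i where xs: "i < h" "set xs \<subseteq> segs P (set (tl as)) {..<l} \<union> set cs"
      "(length as - 1) * (l - 2 * h) \<le> length xs" "ipath \<omega> (xs @ map (P (hd as)) [i..<l])"
    using h by auto
  have ne: "as \<noteq> []" using as(5) r by auto
  have "set (tl as) \<subseteq> J" "hd as \<in> J" using as(2) ne by (auto dest: list.set_sel(2)) 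
  moreover from this have "segs P (set (tl as)) {..<l} \<subseteq> V" using PV by (auto simp: segs_def)
  ultimately have "set (xs @ map (P (hd as)) [i..<l]) \<subseteq> V \<union> V2"
    using xs(2) as(4) PV by auto
  moreover have "(card J - 2 * r) * (l - 2 * h) \<le> length (xs @ map (P (hd as)) [i..<l])"
  proof -
    \<comment> \<open>The path on top of the stack is followed to its very end and supplies the
      summand that is missing in \<open>length as - 1\<close>.\<close>
    have "(card J - 2 * r) * (l - 2 * h) \<le> (length as - 1 + 1) * (l - 2 * h)"
      using as(5) by (intro mult_le_mono1) linarith
    also have "\<dots> = (length as - 1) * (l - 2 * h) + (l - 2 * h)" by (simp add: add_mult_distrib)
    also have "\<dots> \<le> length xs + (l - i)" using xs(1,3) by (intro add_mono) linarith+
    finally show ?thesis by simp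
  qed
  ultimately show ?thesis using xs(4) by blast
qed

section \<open>Existence of connectors\<close>

text \<open>The neighbourhood of \<open>z\<close> in \<open>W\<close> determines the pair
  \<open>(u, v)\<close>, as \<open>X\<close> and \<open>Y\<close> are disjoint. The events for
  different pairs are therefore disjoint and their probabilities simply add up.\<close>

lemma prob_star_two_neighbours:
  assumes A: "finite A" "(\<lambda>w. {z, w}) ` W \<subseteq> A" and W: "finite W"
    and XY: "X \<subseteq> W" "Y \<subseteq> W" "X \<inter> Y = {}" and p: "0 \<le> p" "p \<le> 1"
  shows "real (card X) * real (card Y) * p\<^sup>2 * (1 - p) ^ card W \<le>
    measure_pmf.prob (Pi_pmf A False (\<lambda>_. bernoulli_pmf p))
      {\<omega>. \<exists>u\<in>X. \<exists>v\<in>Y. \<forall>w\<in>W. \<omega> {z, w} = (w = u \<or> w = v)}"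
proof -
  let ?P = "measure_pmf.prob (Pi_pmf A False (\<lambda>_. bernoulli_pmf p))"
  define F where "F = (\<lambda>(u, v). {\<omega>. \<forall>w\<in>W. \<omega> {z, w} = (w = u \<or> w = v)})"
  have inj: "{z, u} = {z, v} \<longleftrightarrow> u = v" for u v by (auto simp: doubleton_eq_iff)
  have fin: "finite X" "finite Y" using XY W by (auto intro: finite_subset)
  have PF: "p\<^sup>2 * (1 - p) ^ card W \<le> ?P (F uv)" if uv: "uv \<in> X \<times> Y" for uv
  proof -
    obtain u v where uv': "uv = (u, v)" "u \<in> X" "v \<in> Y" using uv by auto
    have ne: "u \<noteq> v" using uv' XY by auto
    let ?D1 = "{{z, u}, {z, v}}" and ?D0 = "(\<lambda>w. {z, w}) ` (W - {u, v})"
    have F_eq: "F uv = {\<omega>. (\<forall>e\<in>?D1. \<omega> e) \<and> (\<forall>e\<in>?D0. \<not> \<omega> e)}"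
      using uv' XY by (auto simp: F_def)
    have "{z, u} \<in> A" "{z, v} \<in> A" "?D0 \<subseteq> A" using A(2) uv' XY by auto
    then have "?P (F uv) = p ^ card ?D1 * (1 - p) ^ card ?D0"
      unfolding F_eq using A(1) p by (intro prob_bernoulli_cylinder) (auto simp: inj)
    also have "card ?D1 = 2" using ne by (simp add: inj)
    finally have "?P (F uv) = p\<^sup>2 * (1 - p) ^ card ?D0" .
    moreover have "card ?D0 \<le> card W"
      using card_image_le[of "W - {u, v}" "\<lambda>w. {z, w}"] card_mono[of W "W - {u, v}"] W by auto
    then have "(1 - p) ^ card W \<le> (1 - p) ^ card ?D0" using p by (intro power_decreasing) auto
    ultimately show ?thesis by (simp add: mult_left_mono)
  qed
  have disj: "disjoint_family_on F (X \<times> Y)"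
    unfolding disjoint_family_on_def
  proof (intro ballI impI equals0I)
    fix a b \<omega> assume ab: "a \<in> X \<times> Y" "b \<in> X \<times> Y" "a \<noteq> b" and \<omega>: "\<omega> \<in> F a \<inter> F b"
    obtain u v u' v' where uv: "a = (u, v)" "b = (u', v')" by (metis surj_pair)
    have nb: "w = u \<or> w = v \<longleftrightarrow> w = u' \<or> w = v'" if "w \<in> W" for w
      using \<omega> that by (auto simp: F_def uv)
    have mem: "u \<in> X" "v \<in> Y" "u' \<in> X" "v' \<in> Y" using ab by (auto simp: uv)
    then have "u = u' \<or> u = v'" "v = u' \<or> v = v'" using nb[of u] nb[of v] XY by auto
    then show False using mem ab(3) XY(3) by (auto simp: uv)
  qed
  have "real (card X) * real (card Y) * p\<^sup>2 * (1 - p) ^ card W = (\<Sum>uv\<in>X \<times> Y. p\<^sup>2 * (1 - p) ^ card W)"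
    by (simp add: card_cartesian_product)
  also have "\<dots> \<le> (\<Sum>uv\<in>X \<times> Y. ?P (F uv))" by (rule sum_mono) (rule PF)
  also have "\<dots> = ?P (\<Union>uv\<in>X \<times> Y. F uv)"
    using fin disj by (intro measure_pmf.finite_measure_finite_Union[symmetric]) auto
  also have "(\<Union>uv\<in>X \<times> Y. F uv) = {\<omega>. \<exists>u\<in>X. \<exists>v\<in>Y. \<forall>w\<in>W. \<omega> {z, w} = (w = u \<or> w = v)}"
    by (auto simp: F_def)
  finally show ?thesis .
qed

text \<open>Generating function argument: every small set is weighted by at least
  \<open>x ^ N\<close>, and the total weight of all subsets is \<open>(1 + x) ^ card V\<close>. The
  parameter \<open>x\<close> remains free to balance the two factors.\<close>

lemma card_small_subsets_le:
  assumes "finite V" "0 < x" "x \<le> (1::real)"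
  shows "real (card {Z. Z \<subseteq> V \<and> card Z \<le> N}) \<le> (1 / x) ^ N * exp (x * real (card V))"
proof -
  have "x ^ N * real (card {Z. Z \<subseteq> V \<and> card Z \<le> N}) = (\<Sum>Z\<in>{Z. Z \<subseteq> V \<and> card Z \<le> N}. x ^ N)"
    by simp
  also have "\<dots> \<le> (\<Sum>Z\<in>{Z. Z \<subseteq> V \<and> card Z \<le> N}. x ^ card Z)"
    using assms by (intro sum_mono power_decreasing) auto
  also have "\<dots> \<le> (\<Sum>Z\<in>Pow V. x ^ card Z)"
    using assms by (intro sum_mono2) auto
  also have "\<dots> = (1 + x) ^ card V"
    using prod_add[OF assms(1), of "\<lambda>_. x" "\<lambda>_. 1"] by (simp add: add.commute)
  also have "\<dots> \<le> exp x ^ card V" using assms by (intro power_mono exp_ge_add_one_self) auto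
  finally show ?thesis using assms(2) by (simp add: field_simps power_divide flip: exp_of_nat_mult)
qed

text \<open>Union bound over the triples \<open>(S, T, Z)\<close>; \<open>4 ^ N\<close> counts
  \<open>S\<close> and \<open>T\<close>, the next factor counts \<open>Z\<close>. For a fixed triple
  the vertices of \<open>V2 - Z\<close> fail independently, because their edges to the paths and to
  \<open>Z\<close> form disjoint stars, and each succeeds with probability at least
  \<open>\<pi>\<close>.\<close>

lemma prob_not_connectable:
  assumes A: "finite A" "\<And>z w. z \<in> V2 \<Longrightarrow> w \<in> V1 \<union> V2 \<Longrightarrow> z \<noteq> w \<Longrightarrow> {z, w} \<in> A"
    and J: "finite J" "card J = N" and P: "\<And>j i. j \<in> J \<Longrightarrow> i < l \<Longrightarrow> P j i \<in> V1"
    and inj: "inj_on (\<lambda>(j, i). P j i) (J \<times> {..<l})"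
    and V: "V1 \<inter> V2 = {}" "finite V2" and h: "h \<le> l" and p: "0 \<le> p" "p \<le> 1"
    and x: "0 < x" "x \<le> 1"
  shows "measure_pmf.prob (Pi_pmf A False (\<lambda>_. bernoulli_pmf p)) {\<omega>. \<not> connectable \<omega> J l P h r V2}
    \<le> 4 ^ N * ((1 / x) ^ N * exp (x * real (card V2))) *
       exp (- ((real r * real h * p)\<^sup>2 * (1 - p) ^ (N * l + N)) * (real (card V2) - real N))"
proof -
  let ?P = "measure_pmf.prob (Pi_pmf A False (\<lambda>_. bernoulli_pmf p))"
  define \<pi> where "\<pi> = (real r * real h * p)\<^sup>2 * (1 - p) ^ (N * l + N)"
  define good where "good S T Z z \<omega> \<longleftrightarrow> (\<exists>u\<in>segs P S {l - h..<l}. \<exists>v\<in>segs P T {..<h}.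
      \<forall>w\<in>segs P J {..<l} \<union> Z. \<omega> {z, w} = (w = u \<or> w = v))" for S T Z z and \<omega> :: "'a set \<Rightarrow> bool"
  define I where "I = {(S, T, Z). S \<subseteq> J \<and> T \<subseteq> J \<and> S \<inter> T = {} \<and> card S = r \<and> card T = r \<and> Z \<subseteq> V2 \<and> card Z \<le> N}"
  have finPJ: "finite (segs P J {..<l})" using J by (auto simp: segs_def)
  have cPJ: "card (segs P J {..<l}) = N * l"
    using J inj by (simp add: segs_def card_image card_cartesian_product)
  have PJ: "segs P J {..<l} \<subseteq> V1" using P by (auto simp: segs_def)
  have single: "?P {\<omega>. \<forall>z\<in>V2 - Z. \<not> good S T Z z \<omega>} \<le> exp (- \<pi> * (real (card V2) - real N))"
    if "(S, T, Z) \<in> I" for S T Z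
  proof -
    have S: "S \<subseteq> J" "T \<subseteq> J" "S \<inter> T = {}" "card S = r" "card T = r" "Z \<subseteq> V2" "card Z \<le> N"
      using that by (auto simp: I_def)
    let ?W = "segs P J {..<l} \<union> Z"
    have finZ: "finite Z" using S V by (auto intro: finite_subset)
    have finW: "finite ?W" using finPJ finZ by simp
    have cW: "card ?W \<le> N * l + N" using card_Un_le[of "segs P J {..<l}" Z] cPJ S(7) by simp
    have card_seg: "card (segs P S' I') = card S' * card I'" if "S' \<subseteq> J" "I' \<subseteq> {..<l}" for S' I'
      unfolding segs_def by (subst card_image) (use that in \<open>auto intro!: inj_on_subset[OF inj] simp: card_cartesian_product\<close>)
    have good_prob: "\<pi> \<le> ?P {\<omega>. good S T Z z \<omega>}" if z: "z \<in> V2 - Z" for z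
    proof -
      have zW: "z \<notin> ?W" using z PJ V by auto
      have "(\<lambda>w. {z, w}) ` ?W \<subseteq> A" using z zW PJ S(6) by (intro image_subsetI A(2)) auto
      moreover have "segs P S {l - h..<l} \<subseteq> ?W" "segs P T {..<h} \<subseteq> ?W"
        using S h by (auto simp: segs_def)
      moreover have "segs P S {l - h..<l} \<inter> segs P T {..<h} = {}"
      proof (rule ccontr)
        assume "segs P S {l - h..<l} \<inter> segs P T {..<h} \<noteq> {}"
        then obtain j i j' i' where *: "j \<in> S" "i < l" "j' \<in> T" "i' < h" "P j i = P j' i'"
          by (auto simp: segs_def)
        then have "j = j'" using inj_onD[OF inj, of "(j, i)" "(j', i')"] S h by auto
        then show False using * S by auto
      qed
      ultimately have "real (card (segs P S {l - h..<l})) * real (card (segs P T {..<h})) * p\<^sup>2 * (1 - p) ^ card ?W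
          \<le> ?P {\<omega>. good S T Z z \<omega>}"
        unfolding good_def using A(1) finW p by (intro prob_star_two_neighbours)
      moreover have "card (segs P S {l - h..<l}) = r * h"
        using S h by (subst card_seg) auto
      moreover have "card (segs P T {..<h}) = r * h"
        using S h by (subst card_seg) auto
      moreover have "(1 - p) ^ (N * l + N) \<le> (1 - p) ^ card ?W"
        using p cW by (intro power_decreasing) auto
      then have "(real r * real h * p)\<^sup>2 * (1 - p) ^ (N * l + N) \<le> (real r * real h * p)\<^sup>2 * (1 - p) ^ card ?W"
        by (rule mult_left_mono) simp
      ultimately show ?thesis by (simp add: \<pi>_def power_mult_distrib power2_eq_square algebra_simps)
    qed
    have "?P {\<omega>. \<forall>z\<in>V2 - Z. \<not> good S T Z z \<omega>} = (\<Prod>z\<in>V2 - Z. ?P {\<omega>. \<not> good S T Z z \<omega>})"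
    proof (rule prob_Pi_pmf_family_indep[OF A(1), where D = "\<lambda>z. (\<lambda>w. {z, w}) ` ?W"])
      show "finite (V2 - Z)" using V by simp
      fix z assume z: "z \<in> V2 - Z"
      have zW: "z \<notin> ?W" using z PJ V by auto
      show "(\<lambda>w. {z, w}) ` ?W \<subseteq> A" using z zW PJ S(6) by (intro image_subsetI A(2)) auto
      show "dep_on ((\<lambda>w. {z, w}) ` ?W) (\<lambda>\<omega>. \<not> good S T Z z \<omega>)"
        unfolding dep_on_def
      proof (intro allI impI)
        fix f g :: "'a set \<Rightarrow> bool"
        assume "\<forall>e\<in>(\<lambda>w. {z, w}) ` ?W. f e = g e"
        then have "f {z, w} = g {z, w}" if "w \<in> ?W" for w using that by blast
        then show "(\<not> good S T Z z f) = (\<not> good S T Z z g)"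
          unfolding good_def by (simp cong: ball_cong)
      qed
      fix z' assume z': "z' \<in> V2 - Z" "z \<noteq> z'"
      have "z' \<notin> ?W" using z' PJ V by auto
      then show "(\<lambda>w. {z, w}) ` ?W \<inter> (\<lambda>w. {z', w}) ` ?W = {}"
        using zW z' by (auto simp: doubleton_eq_iff)
    qed auto
    also have "\<dots> \<le> (\<Prod>z\<in>V2 - Z. exp (- \<pi>))"
    proof (intro prod_mono conjI)
      fix z assume z: "z \<in> V2 - Z"
      have "?P {\<omega>. \<not> good S T Z z \<omega>} = 1 - ?P {\<omega>. good S T Z z \<omega>}"
        using measure_pmf.prob_compl[of "{\<omega>. good S T Z z \<omega>}" "Pi_pmf A False (\<lambda>_. bernoulli_pmf p)"]
        by (simp add: Compl_eq_Diff_UNIV[symmetric] Collect_neg_eq)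
      also have "\<dots> \<le> 1 + - \<pi>" using good_prob[OF z] by simp
      also have "\<dots> \<le> exp (- \<pi>)" by (rule exp_ge_add_one_self)
      finally show "?P {\<omega>. \<not> good S T Z z \<omega>} \<le> exp (- \<pi>)" .
    qed simp
    also have "\<dots> = exp (- \<pi> * real (card (V2 - Z)))"
      by (simp add: mult.commute flip: exp_of_nat_mult)
    also have "\<dots> \<le> exp (- \<pi> * (real (card V2) - real N))"
    proof -
      have "card (V2 - Z) = card V2 - card Z" using finZ S by (simp add: card_Diff_subset)
      then have "real (card V2) - real N \<le> real (card (V2 - Z))" using S(7) by linarith
      moreover have "\<pi> \<ge> 0" using p by (simp add: \<pi>_def)
      ultimately have "\<pi> * (real (card V2) - real N) \<le> \<pi> * real (card (V2 - Z))" by (intro mult_left_mono)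
      then show ?thesis by simp
    qed
    finally show ?thesis .
  qed
  let ?Zs = "{Z. Z \<subseteq> V2 \<and> card Z \<le> N}"
  have finZs: "finite ?Zs" using V by simp
  have sub: "I \<subseteq> Pow J \<times> Pow J \<times> ?Zs" by (auto simp: I_def)
  have fin': "finite (Pow J \<times> Pow J \<times> ?Zs)" using J finZs by simp
  have finI: "finite I" by (rule finite_subset[OF sub fin'])
  have "card I \<le> card (Pow J \<times> Pow J \<times> ?Zs)" by (rule card_mono[OF fin' sub])
  also have "\<dots> = 4 ^ N * card ?Zs"
    using J by (simp add: card_cartesian_product card_Pow flip: power_mult_distrib)
  finally have "real (card I) \<le> real (4 ^ N * card ?Zs)" by (rule of_nat_mono)
  then have cI: "real (card I) \<le> 4 ^ N * real (card ?Zs)" by (simp only: of_nat_mult of_nat_power of_nat_numeral)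
  have "{\<omega>. \<not> connectable \<omega> J l P h r V2} \<subseteq> (\<Union>(S, T, Z)\<in>I. {\<omega>. \<forall>z\<in>V2 - Z. \<not> good S T Z z \<omega>})"
  proof
    fix \<omega> assume "\<omega> \<in> {\<omega>. \<not> connectable \<omega> J l P h r V2}"
    then obtain S T Z where "(S, T, Z) \<in> I" "\<forall>z\<in>V2 - Z. \<not> good S T Z z \<omega>"
      unfolding connectable_def I_def good_def J(2) by blast
    then show "\<omega> \<in> (\<Union>(S, T, Z)\<in>I. {\<omega>. \<forall>z\<in>V2 - Z. \<not> good S T Z z \<omega>})" by blast
  qed
  then have "?P {\<omega>. \<not> connectable \<omega> J l P h r V2} \<le> ?P (\<Union>(S, T, Z)\<in>I. {\<omega>. \<forall>z\<in>V2 - Z. \<not> good S T Z z \<omega>})"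
    by (intro measure_pmf.finite_measure_mono) auto
  also have "\<dots> \<le> (\<Sum>(S, T, Z)\<in>I. ?P {\<omega>. \<forall>z\<in>V2 - Z. \<not> good S T Z z \<omega>})"
    using measure_pmf.finite_measure_subadditive_finite[OF finI,
        of "\<lambda>(S, T, Z). {\<omega>. \<forall>z\<in>V2 - Z. \<not> good S T Z z \<omega>}" "Pi_pmf A False (\<lambda>_. bernoulli_pmf p)"]
    by (simp add: case_prod_unfold)
  also have "\<dots> \<le> (\<Sum>(S, T, Z)\<in>I. exp (- \<pi> * (real (card V2) - real N)))"
    by (rule sum_mono) (use single in auto)
  also have "\<dots> = real (card I) * exp (- \<pi> * (real (card V2) - real N))" by simp
  also have "\<dots> \<le> 4 ^ N * ((1 / x) ^ N * exp (x * real (card V2))) * exp (- \<pi> * (real (card V2) - real N))"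
    using cI card_small_subsets_le[OF V(2) x, of N]
    by (intro mult_right_mono order_trans[OF cI] mult_left_mono) auto
  finally show ?thesis by (simp add: \<pi>_def)
qed

section \<open>Combining the two halves of the vertex set\<close>

lemma path_system_cong:
  assumes "\<And>e. e \<in> nsets V 2 \<Longrightarrow> \<omega> e = \<omega>' e" "path_system \<omega> V J l P"
  shows "path_system \<omega>' V J l P"
proof -
  have V: "\<And>j i. j \<in> J \<Longrightarrow> i < l \<Longrightarrow> P j i \<in> V" and inj: "inj_on (\<lambda>(j, i). P j i) (J \<times> {..<l})"
    using assms(2) by (auto simp: path_system_def)
  have eq: "\<omega> {P j i, P j' i'} = \<omega>' {P j i, P j' i'}"
    if "j \<in> J" "j' \<in> J" "i < l" "i' < l" "(j, i) \<noteq> (j', i')" for j j' i i'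
  proof -
    have "P j i \<noteq> P j' i'" using inj_onD[OF inj, of "(j, i)" "(j', i')"] that by auto
    then show ?thesis using V that by (intro assms(1)) auto
  qed
  show ?thesis
    unfolding path_system_def
  proof (intro conjI ballI allI impI)
    fix j i i' assume *: "j \<in> J" "i < i'" "i' < l"
    have "\<omega> {P j i, P j i'} = (i' = Suc i)" using assms(2) * by (simp add: path_system_def)
    then show "\<omega>' {P j i, P j i'} = (i' = Suc i)" using eq[of j j i i'] * by simp
  next
    fix j j' i i' assume *: "j \<in> J" "j' \<in> J" "j \<noteq> j'" "i < l" "i' < l"
    have "\<not> \<omega> {P j i, P j' i'}" using assms(2) * by (simp add: path_system_def)
    then show "\<not> \<omega>' {P j i, P j' i'}" using eq[of j j' i i'] * by simp
  qed (use V inj in auto)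
qed

lemma connectable_cong:
  assumes eq: "\<And>z w. z \<in> V2 \<Longrightarrow> \<omega>' {z, w} = \<omega> {z, w}" and con: "connectable \<omega> J l P h r V2"
  shows "connectable \<omega>' J l P h r V2"
  unfolding connectable_def
proof (intro allI impI)
  fix S T Z
  assume "S \<subseteq> J" "T \<subseteq> J" "S \<inter> T = {}" "card S = r" "card T = r" "Z \<subseteq> V2" "card Z \<le> card J"
  from con[unfolded connectable_def, rule_format, OF this]
  obtain z u v where z: "z \<in> V2 - Z" and uv: "u \<in> segs P S {l - h..<l}" "v \<in> segs P T {..<h}"
    and nb: "\<And>w. w \<in> segs P J {..<l} \<union> Z \<Longrightarrow> \<omega> {z, w} = (w = u \<or> w = v)" by blast
  show "\<exists>z\<in>V2 - Z. \<exists>u\<in>segs P S {l - h..<l}. \<exists>v\<in>segs P T {..<h}.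
      \<forall>w\<in>segs P J {..<l} \<union> Z. \<omega>' {z, w} = (w = u \<or> w = v)"
  proof (intro bexI ballI)
    fix w assume "w \<in> segs P J {..<l} \<union> Z"
    from nb[OF this] show "\<omega>' {z, w} = (w = u \<or> w = v)" using z eq by simp
  qed (use z uv in auto)
qed

text \<open>Two-round exposure. The pairs inside \<open>V1\<close> are revealed first and fix a path
  system. Connectability concerns only pairs that meet \<open>V2\<close>, which are independent of
  the first round, and its failure bound is the same for every system with \<open>N\<close>
  paths.\<close>

lemma prob_no_long_ipath:
  assumes V: "finite V1" "finite V2" "V1 \<inter> V2 = {}" and h: "2 * h < l" "0 < h"
    and r: "0 < r" "2 * r \<le> N" and p: "0 \<le> p" "p \<le> 1" and x: "0 < x" "x \<le> 1"
  shows "measure_pmf.prob (Pi_pmf (nsets (V1 \<union> V2) 2) False (\<lambda>_. bernoulli_pmf p))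
      {\<omega>. \<not> (\<exists>xs. ipath \<omega> xs \<and> set xs \<subseteq> V1 \<union> V2 \<and> (N - 2 * r) * (l - 2 * h) \<le> length xs)}
    \<le> measure_pmf.prob (Pi_pmf (nsets V1 2) False (\<lambda>_. bernoulli_pmf p))
        {\<omega>. \<not> (\<exists>J P. finite J \<and> card J = N \<and> path_system \<omega> V1 J l P)} +
      4 ^ N * ((1 / x) ^ N * exp (x * real (card V2))) *
       exp (- ((real r * real h * p)\<^sup>2 * (1 - p) ^ (N * l + N)) * (real (card V2) - real N))"
    (is "?L \<le> ?R + ?\<delta>")
proof -
  let ?A = "nsets (V1 \<union> V2) 2" and ?D = "nsets V1 2"
  let ?q = "\<lambda>_. bernoulli_pmf p"
  let ?good = "\<lambda>\<omega>. \<exists>xs. ipath \<omega> xs \<and> set xs \<subseteq> V1 \<union> V2 \<and> (N - 2 * r) * (l - 2 * h) \<le> length xs"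
  let ?sys = "\<lambda>\<omega>. \<exists>J P. finite J \<and> card J = N \<and> path_system \<omega> V1 J l P"
  have finA: "finite ?A" using V by (intro finite_imp_finite_nsets) auto
  have finD: "finite ?D" using V by (intro finite_imp_finite_nsets) auto
  have sub: "?D \<subseteq> ?A" by (rule nsets_mono) auto
  have finb: "finite (set_pmf (bernoulli_pmf p))" by (rule finite_subset[of _ UNIV]) auto
  have finP: "finite (set_pmf (Pi_pmf ?D False ?q))" "finite (set_pmf (Pi_pmf (?A - ?D) False ?q))"
    using finA finD finb by (auto intro!: finite_set_Pi_pmf)
  have \<delta>: "?\<delta> \<ge> 0" using x by simp
  have inner: "measure_pmf.expectation (Pi_pmf (?A - ?D) False ?q) (\<lambda>g. of_bool (\<not> ?good (glue ?D f g)) :: real)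
      \<le> of_bool (\<not> ?sys f) + ?\<delta>" for f
  proof (cases "?sys f")
    case False
    have "measure_pmf.expectation (Pi_pmf (?A - ?D) False ?q) (\<lambda>g. of_bool (\<not> ?good (glue ?D f g)) :: real)
      \<le> measure_pmf.expectation (Pi_pmf (?A - ?D) False ?q) (\<lambda>g. 1 :: real)"
      by (rule expectation_mono_finite[OF finP(2)]) simp
    then show ?thesis using False \<delta> by simp
  next
    case True
    then obtain J P where J: "finite J" "card J = N" "path_system f V1 J l P" by blast
    have PV: "\<And>j i. j \<in> J \<Longrightarrow> i < l \<Longrightarrow> P j i \<in> V1" and inj: "inj_on (\<lambda>(j, i). P j i) (J \<times> {..<l})"
      using J(3) by (auto simp: path_system_def)
    have good: "?good (glue ?D f g)" if con: "connectable g J l P h r V2" for g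
    proof -
      have "path_system (glue ?D f g) V1 J l P"
        by (rule path_system_cong[OF _ J(3)]) (simp add: glue_def)
      moreover have "connectable (glue ?D f g) J l P h r V2"
      proof -
        have "glue ?D f g {z, w} = g {z, w}" if "z \<in> V2" for z w
          using that V(3) by (auto simp: glue_def nsets_def)
        then show ?thesis using con by (rule connectable_cong)
      qed
      ultimately show ?thesis using ipath_of_connectable[of "glue ?D f g" V1 J l P h V2 r] h V J r by blast
    qed
    have "measure_pmf.expectation (Pi_pmf (?A - ?D) False ?q) (\<lambda>g. of_bool (\<not> ?good (glue ?D f g)) :: real)
      \<le> measure_pmf.expectation (Pi_pmf (?A - ?D) False ?q) (\<lambda>g. of_bool (\<not> connectable g J l P h r V2))"
      by (rule expectation_mono_finite[OF finP(2)]) (use good in auto)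
    also have "\<dots> = measure_pmf.prob (Pi_pmf (?A - ?D) False ?q) {g. \<not> connectable g J l P h r V2}"
      by (simp only: prob_eq_expectation_of_bool)
    also have "\<dots> \<le> ?\<delta>"
    proof (rule prob_not_connectable[where ?V1.0 = V1])
      show "{z, w} \<in> ?A - ?D" if "z \<in> V2" "w \<in> V1 \<union> V2" "z \<noteq> w" for z w
        using that V(3) by auto
    qed (use finA J PV inj V h p x in auto)
    finally show ?thesis by simp
  qed
  have "?L = measure_pmf.expectation (Pi_pmf ?D False ?q) (\<lambda>f.
      measure_pmf.expectation (Pi_pmf (?A - ?D) False ?q) (\<lambda>g. of_bool (\<not> ?good (glue ?D f g))))"
    unfolding prob_eq_expectation_of_bool by (rule expectation_Pi_pmf_glue[OF finA sub finb])
  also have "\<dots> \<le> measure_pmf.expectation (Pi_pmf ?D False ?q) (\<lambda>f. of_bool (\<not> ?sys f) + ?\<delta>)"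
    by (rule expectation_mono_finite[OF finP(1) inner])
  also have "\<dots> = measure_pmf.expectation (Pi_pmf ?D False ?q) (\<lambda>f. of_bool (\<not> ?sys f)) + ?\<delta>"
    by (subst Bochner_Integration.integral_add) (auto intro: integrable_measure_pmf_finite[OF finP(1)])
  finally show ?thesis by (simp only: prob_eq_expectation_of_bool)
qed

lemma induced_subgraph_of_ipath:
  assumes xs: "ipath \<omega> xs" "set xs \<subseteq> V"
  shows "induced_subgraph (path_graph xs) (V, {e \<in> nsets V 2. \<omega> e})"
proof -
  have d: "distinct xs" using xs by (simp add: ipath_def)
  have edge: "\<omega> {xs ! i, xs ! Suc i}" "{xs ! i, xs ! Suc i} \<in> nsets V 2" if "Suc i < length xs" for i
  proof -
    show "\<omega> {xs ! i, xs ! Suc i}" using xs(1) that by (simp add: ipath_def)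
    have "xs ! i \<in> V" "xs ! Suc i \<in> V" using that xs(2) by auto
    moreover have "xs ! i \<noteq> xs ! Suc i" using d that by (simp add: nth_eq_iff_index_eq)
    ultimately show "{xs ! i, xs ! Suc i} \<in> nsets V 2" by simp
  qed
  have "\<exists>i. e = {xs ! i, xs ! Suc i} \<and> Suc i < length xs" if e: "e \<in> nsets V 2" "\<omega> e" "e \<subseteq> set xs" for e
  proof -
    obtain u v where uv: "e = {u, v}" "u \<noteq> v" using e(1) by (auto simp: nsets_def card_2_iff)
    then obtain i j where ij: "u = xs ! i" "v = xs ! j" "i < length xs" "j < length xs" "i \<noteq> j"
      using e(3) by (auto simp: in_set_conv_nth)
    have key: "\<exists>i. e = {xs ! i, xs ! Suc i} \<and> Suc i < length xs"
      if "a < b" "b < length xs" "e = {xs ! a, xs ! b}" for a b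
      using xs(1) that e(2) unfolding ipath_def by blast
    show ?thesis
    proof (cases "i < j")
      case True
      then show ?thesis using key[of i j] ij uv by simp
    next
      case False
      then show ?thesis using key[of j i] ij uv by (simp add: insert_commute)
    qed
  qed
  then show ?thesis using xs(2) edge by (auto simp: induced_subgraph_def subgraph_def path_graph_def)
qed

text \<open>The \<open>1\<close> converts numbers of vertices into lengths, since a path on
  \<open>L\<close> vertices has \<open>L - 1\<close> edges.\<close>

lemma prob_gnp_induced_path:
  assumes "K + 1 \<le> real L" and False: "L \<noteq> 0"
  shows "measure_pmf.prob (Pi_pmf (nsets {1..n} 2) False (\<lambda>_. bernoulli_pmf p))
      {\<omega>. \<exists>xs. ipath \<omega> xs \<and> set xs \<subseteq> {1..n} \<and> L \<le> length xs} \<le>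
    measure_pmf.prob (gnp n p)
      {G. \<exists>P k. induced_subgraph P G \<and> is_path_of_length P k \<and> real k \<ge> K}"
  (is "measure_pmf.prob ?M ?A \<le> _")
proof -
  have "?A \<subseteq> (\<lambda>X. ({1..n}, {e \<in> nsets {1..n} 2. X e})) -`
      {G. \<exists>P k. induced_subgraph P G \<and> is_path_of_length P k \<and> real k \<ge> K}"
  proof
    fix \<omega> assume "\<omega> \<in> ?A"
    then obtain xs where xs: "ipath \<omega> xs" "set xs \<subseteq> {1..n}" "L \<le> length xs" by blast
    have "is_path_of_length (path_graph xs) (length xs - 1)"
      unfolding is_path_of_length_def using xs False by (intro exI[of _ xs]) (auto simp: ipath_def)
    moreover have "K \<le> real (length xs - 1)" using xs(3) False assms by linarith
    ultimately show "\<omega> \<in> (\<lambda>X. ({1..n}, {e \<in> nsets {1..n} 2. X e})) -`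
      {G. \<exists>P k. induced_subgraph P G \<and> is_path_of_length P k \<and> real k \<ge> K}"
      using induced_subgraph_of_ipath[OF xs(1,2)] unfolding vimage_eq mem_Collect_eq by blast
  qed
  then show ?thesis
    unfolding gnp_def by (simp add: measure_pmf.finite_measure_mono)
qed

section \<open>The dense regime\<close>

lemma block_partition_div:
  assumes "m > 0"
  shows "block_partition {1..B * m} (\<lambda>v. (v - 1) div m) B m"
proof
  show "finite {1..B * m}" by simp
  show "(v - 1) div m < B" if "v \<in> {1..B * m}" for v
    using that assms by (auto simp: div_less_iff_less_mult)
  show "card {v \<in> {1..B * m}. (v - 1) div m = b} = m" if b: "b < B" for b
  proof -
    have "{v \<in> {1..B * m}. (v - 1) div m = b} = {b * m + 1..b * m + m}"
    proof (intro equalityI subsetI)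
      fix v assume "v \<in> {v \<in> {1..B * m}. (v - 1) div m = b}"
      then have v: "1 \<le> v" "(v - 1) div m = b" by auto
      have "b * m \<le> v - 1" using v(2) by (metis div_times_less_eq_dividend)
      moreover have "v - 1 < b * m + m" using dividend_less_div_times[OF assms, of "v - 1"] v(2) by (simp add: add.commute)
      ultimately show "v \<in> {b * m + 1..b * m + m}" using v(1) by auto
    next
      fix v assume v: "v \<in> {b * m + 1..b * m + m}"
      then have "(v - 1) div m = b" by (intro div_nat_eqI) (auto simp: algebra_simps)
      moreover have "Suc b * m \<le> B * m" using b by (intro mult_le_mono1) simp
      ultimately show "v \<in> {v \<in> {1..B * m}. (v - 1) div m = b}" using v by auto
    qed
    then show ?thesis by simp
  qed
qed

text \<open>All conditions on \<open>d\<close> hold for large \<open>d\<close>. \<open>V1\<close> is the half of the vertices that carries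
  the long path, in \<open>2 * k\<close> blocks of size \<open>m\<close>; the connectors come from \<open>V2\<close>.\<close>

locale sparse_graph =
  fixes \<epsilon> d :: real and n :: nat
  assumes eps: "0 < \<epsilon>" "\<epsilon> \<le> 1 / 4" and n_large: "20 / \<epsilon> \<le> real n / d"
    and d_large: "100 \<le> d" "1 \<le> ln d" "12 * ln d \<le> d" "32 \<le> d powr (1 / 8)"
      "36 * (ln d)\<^sup>2 * d powr (- 1 / 8) \<le> ln d / 16"
begin

definition y :: real where "y = real n / d"
definition p :: real where "p = d / real n"
definition D :: real where "D = ln d"
definition k :: nat where "k = nat \<lfloor>(3 / 2 - \<epsilon> / 2) * y * D\<rfloor>"
definition m :: nat where "m = n div (4 * k)"
definition V1 :: "nat set" where "V1 = {1..2 * k * m}"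
definition V2 :: "nat set" where "V2 = {2 * k * m + 1..n}"
definition blk :: "nat \<Rightarrow> nat" where "blk v = (v - 1) div m"

lemma y_ge: "y \<ge> 20 / \<epsilon>" "y \<ge> 80" "\<epsilon> * y \<ge> 20"
proof -
  show *: "y \<ge> 20 / \<epsilon>" using n_large by (simp add: y_def)
  then show "\<epsilon> * y \<ge> 20" using eps by (simp add: field_simps)
  have "20 / \<epsilon> \<ge> 20 / (1 / 4)" using eps by (intro divide_left_mono) auto
  then show "y \<ge> 80" using * by simp
qed

lemma n_eq: "real n = y * d" using d_large by (simp add: y_def)

lemma n_pos: "n > 0" using n_eq y_ge d_large by (intro Nat.gr0I) auto

lemma p_eq: "p = 1 / y" using d_large n_pos by (simp add: p_def y_def)

lemma p_bounds: "0 < p" "p < 1" using y_ge by (auto simp: p_eq)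

lemma D_ge: "D \<ge> 1" using d_large by (simp add: D_def)

lemma exp_D: "exp (c * D) = d powr c" using d_large by (simp add: D_def powr_def)

lemma inverse_one_minus_p_power_le: "(1 / (1 - p)) ^ j \<le> exp (real j / (y - 1))"
proof -
  have "1 / (1 - p) = 1 + 1 / (y - 1)" using y_ge by (simp add: p_eq field_simps)
  also have "\<dots> \<le> exp (1 / (y - 1))" by (rule exp_ge_add_one_self)
  finally have "(1 / (1 - p)) ^ j \<le> exp (1 / (y - 1)) ^ j" using p_bounds by (intro power_mono) auto
  then show ?thesis by (simp flip: exp_of_nat_mult)
qed

lemma one_minus_p_power_ge: "(1 - p) ^ j \<ge> exp (- (real j / (y - 1)))"
proof -
  have "exp (- (real j / (y - 1))) \<le> inverse ((1 / (1 - p)) ^ j)"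
    unfolding exp_minus using p_bounds
    by (intro le_imp_inverse_le inverse_one_minus_p_power_le) auto
  then show ?thesis by (simp add: power_divide)
qed

lemma yD_ge: "y * D \<ge> 80" "\<epsilon> * (y * D) \<ge> 20"
proof -
  have "y * D \<ge> y * 1" using y_ge D_ge by (intro mult_left_mono) auto
  then show "y * D \<ge> 80" using y_ge by linarith
  have "\<epsilon> * y * D \<ge> \<epsilon> * y * 1" using y_ge D_ge eps by (intro mult_left_mono) auto
  then show "\<epsilon> * (y * D) \<ge> 20" using y_ge by (simp add: mult.assoc)
qed

lemma k_le: "real k \<le> (3 / 2 - \<epsilon> / 2) * (y * D)"
proof -
  have "0 \<le> (3 / 2 - \<epsilon> / 2) * y * D" using eps yD_ge by (simp add: mult.assoc)
  then show ?thesis unfolding k_def by (simp add: mult.assoc)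
qed

lemma k_ge: "real k \<ge> (3 / 2 - \<epsilon> / 2) * (y * D) - 1"
  unfolding k_def by (simp add: mult.assoc) linarith

lemma k_ge_yD: "real k \<ge> y * D"
proof -
  have "(1 / 4) * (y * D) \<le> (1 / 2 - \<epsilon> / 2) * (y * D)" using eps yD_ge by (intro mult_right_mono) auto
  then show ?thesis using k_ge yD_ge by (simp add: algebra_simps)
qed

lemma k_le_yD: "real k \<le> 3 / 2 * (y * D)"
proof -
  have "(3 / 2 - \<epsilon> / 2) * (y * D) \<le> 3 / 2 * (y * D)" using eps yD_ge by (intro mult_right_mono) auto
  then show ?thesis using k_le by simp
qed

lemma k_pos: "k > 0"
proof -
  have "real k > 0" using k_ge_yD yD_ge by linarith
  then show ?thesis by simp
qed

lemma k_le_n: "8 * k \<le> n"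
proof -
  have "8 * real k \<le> 12 * (y * D)" using k_le_yD by linarith
  then have "8 * real k \<le> y * (12 * D)" by (simp only: mult.left_commute)
  also have "\<dots> \<le> y * d" using d_large y_ge by (intro mult_left_mono) (auto simp: D_def)
  finally have "real (8 * k) \<le> real n" by (simp add: n_eq)
  then show ?thesis by (simp only: of_nat_le_iff)
qed

lemma m_pos: "m > 0"
  using k_le_n k_pos by (simp add: m_def div_greater_zero_iff)

lemma M_le: "2 * k * m \<le> n div 2"
proof -
  have "4 * k * m \<le> n" unfolding m_def by (rule times_div_less_eq_dividend)
  then show ?thesis by simp
qed

lemma M_ge: "real n / 4 \<le> real (2 * k) * real m"
proof -
  have "n < 4 * k * m + 4 * k"
    unfolding m_def using dividend_less_times_div[of "4 * k" n] k_pos by simp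
  then have "n \<le> 2 * (2 * k * m) + 4 * k" by simp
  then have "2 * n \<le> 4 * (2 * k * m) + n" using k_le_n by linarith
  then have "real n \<le> real (4 * (2 * k * m))" by (intro of_nat_mono) linarith
  then show ?thesis by simp
qed

sublocale block_partition V1 blk "2 * k" m
  using block_partition_div[OF m_pos, of "2 * k"] by (simp add: V1_def blk_def[abs_def])

lemma V1V2: "V1 \<inter> V2 = {}" "V1 \<union> V2 = {1..n}" "finite V1" "finite V2"
  using M_le by (auto simp: V1_def V2_def)

lemma card_V2: "real n / 2 \<le> real (card V2)" "card V2 \<le> n"
proof -
  have "real (2 * (2 * k * m)) \<le> real n" using M_le by (intro of_nat_mono) linarith
  moreover have "real (card V2) = real n - real (2 * k * m)"
    using M_le by (simp add: V2_def of_nat_diff)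
  ultimately show "real n / 2 \<le> real (card V2)" by simp
  show "card V2 \<le> n" by (simp add: V2_def)
qed

text \<open>The estimates for powers of \<open>1 - p\<close> involve \<open>y - 1\<close> instead of
  \<open>y = 1 / p\<close>. The replacement costs \<open>\<epsilon> / 4\<close> in the coefficient,
  which \<open>\<epsilon> * y \<ge> 20\<close> pays for.\<close>

lemma k_over_y_le: "real k / (y - 1) \<le> (3 / 2 - \<epsilon> / 4) * D"
proof -
  have "(3 / 2 - \<epsilon> / 2) * y \<le> (3 / 2 - \<epsilon> / 4) * (y - 1)"
  proof -
    have "(3 / 2 - \<epsilon> / 4) * (y - 1) - (3 / 2 - \<epsilon> / 2) * y = \<epsilon> * y / 4 - 3 / 2 + \<epsilon> / 4"
      by (simp add: field_simps)
    then show ?thesis using y_ge(3) eps by linarith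
  qed
  then have "(3 / 2 - \<epsilon> / 2) * y * D \<le> (3 / 2 - \<epsilon> / 4) * (y - 1) * D" using D_ge by (intro mult_right_mono) auto
  then have "real k \<le> (3 / 2 - \<epsilon> / 4) * D * (y - 1)" using k_le by (simp add: algebra_simps)
  then show ?thesis using y_ge by (simp add: pos_divide_le_eq)
qed

text \<open>The left side is about \<open>exp (s\<^sup>2 / (2 * y))\<close>. For
  \<open>s \<le> y\<close> this is at most \<open>exp s\<close>. For larger \<open>s\<close>, the
  bound on \<open>k\<close> gives at most \<open>exp (3 / 4 * s * D)\<close>; raising 3/4 to 7/8
  gains \<open>s * D / 8\<close>, which pays for the small factor in front. The exponent 7/8 has to
  stay below 1, since the second moment requires a base that is small compared with
  \<open>d\<close>.\<close>

lemma inverse_power_bound: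
  assumes s: "s \<le> k"
  shows "(1 / (1 - p)) ^ (s choose 2) \<le> exp 1 ^ s + exp (- (y * D / 8)) * (d powr (7 / 8)) ^ s"
proof -
  have "real (s choose 2) \<le> real s * real s / 2"
  proof -
    have "2 * (s choose 2) \<le> s * (s - 1)" unfolding choose_two by (rule times_div_less_eq_dividend)
    also have "\<dots> \<le> s * s" by simp
    finally have "2 * (s choose 2) \<le> s * s" .
    then have "real (2 * (s choose 2)) \<le> real (s * s)" by (rule of_nat_mono)
    then show ?thesis by simp
  qed
  then have "real (s choose 2) / (y - 1) \<le> real s * real s / 2 / (y - 1)"
    using y_ge by (intro divide_right_mono) auto
  then have "(1 / (1 - p)) ^ (s choose 2) \<le> exp (real s * real s / 2 / (y - 1))"
    by (intro order_trans[OF inverse_one_minus_p_power_le]) simp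
  also have "\<dots> \<le> exp 1 ^ s + exp (- (y * D / 8)) * (d powr (7 / 8)) ^ s"
  proof (cases "real s \<le> y")
    case True
    have "real s / (2 * (y - 1)) \<le> 1" using True y_ge by (simp add: field_simps)
    then have "real s * (real s / (2 * (y - 1))) \<le> real s * 1" by (intro mult_left_mono) auto
    then have "exp (real s * real s / 2 / (y - 1)) \<le> exp (real s)" by simp
    also have "exp (real s) = exp 1 ^ s" by (simp flip: exp_of_nat_mult)
    finally show ?thesis by (simp add: add_increasing2)
  next
    case False
    have "real s / (y - 1) \<le> real k / (y - 1)" using s y_ge by (intro divide_right_mono) auto
    also have "\<dots> \<le> (3 / 2) * D"
      using k_over_y_le eps D_ge mult_right_mono[of "3/2 - \<epsilon>/4" "3/2" D] by linarith
    finally have le: "real s * (real s / (y - 1)) \<le> real s * ((3 / 2) * D)" by (intro mult_left_mono) auto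
    have "real s * real s / 2 / (y - 1) = real s * (real s / (y - 1)) / 2"
      using y_ge by (simp add: field_simps)
    also have "\<dots> \<le> real s * ((3 / 2) * D) / 2" using le by (rule divide_right_mono) simp
    also have "\<dots> = 3 / 4 * (real s * D)" by simp
    also have "\<dots> \<le> 7 / 8 * (real s * D) - y * D / 8"
    proof -
      have "y * D \<le> real s * D" using False D_ge by (intro mult_right_mono) auto
      then show ?thesis by linarith
    qed
    finally have "exp (real s * real s / 2 / (y - 1)) \<le> exp (7 / 8 * (real s * D) - y * D / 8)" by simp
    also have "\<dots> = exp (- (y * D / 8)) * (d powr (7 / 8)) ^ s"
      by (simp add: exp_D[symmetric] flip: exp_of_nat_mult exp_add)
    finally show ?thesis by (simp add: add_increasing)
  qed
  finally show ?thesis .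
qed

lemma k_square_le: "4 * (real k)\<^sup>2 / (real (2 * k) * real m) \<le> 36 * (y * D\<^sup>2 / d)"
proof -
  have n0: "real n > 0" using n_pos by simp
  have "4 * (real k)\<^sup>2 / (real (2 * k) * real m) \<le> 4 * (real k)\<^sup>2 / (real n / 4)"
    using M_ge n0 k_pos m_pos by (intro divide_left_mono mult_pos_pos) auto
  also have "\<dots> \<le> 4 * (3 / 2 * (y * D))\<^sup>2 / (real n / 4)"
    using k_le_yD by (intro divide_right_mono mult_left_mono power_mono) auto
  also have "\<dots> = 36 * (y * D\<^sup>2 / d)"
    using y_ge d_large unfolding n_eq by (simp add: field_simps power2_eq_square)
  finally show ?thesis .
qed

lemma pM_ge: "d / 4 \<le> p * (real (2 * k) * real m)"
proof -
  have "p * (real n / 4) \<le> p * (real (2 * k) * real m)" using M_ge p_bounds by (intro mult_left_mono) auto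
  then show ?thesis using n_pos by (simp add: p_def)
qed

theorem prob_ex_path_ge:
  assumes "finite A" "nsets V1 2 \<subseteq> A"
  shows "measure_pmf.prob (Pi_pmf A False (\<lambda>_. bernoulli_pmf p))
      {\<omega>. \<exists>x\<in>block_seqs V1 blk k. induces_path \<omega> x} \<ge>
    1 / (exp (100 * (y * D\<^sup>2 / d)) + exp (- (y / 16)))"
proof -
  define Q where "Q = 4 * (real k)\<^sup>2 / (real (2 * k) * real m)"
  define z2 where "z2 = d powr (7 / 8)"
  have z2: "32 * z2 \<le> d"
  proof -
    have "32 * z2 \<le> d powr (1 / 8) * z2" using d_large by (intro mult_right_mono) (auto simp: z2_def)
    also have "\<dots> = d" using d_large by (simp add: z2_def flip: powr_add)
    finally show ?thesis .
  qed
  \<comment> \<open>The bound 25/9 for e makes the constant round: \<open>25 / 9 * 36 = 100\<close>,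
    where 36 comes from \<open>k_square_le\<close>.\<close>
  have "exp 1 < (25 / 9 :: real)" using e_less_272 by simp
  then have e: "exp 1 \<le> (25 / 9 :: real)" by simp
  have Q: "Q \<le> 36 * (y * D\<^sup>2 / d)" unfolding Q_def by (rule k_square_le)
  have Q0: "Q \<ge> 0" by (simp add: Q_def)
  have "measure_pmf.prob (Pi_pmf A False (\<lambda>_. bernoulli_pmf p))
      {\<omega>. \<exists>x\<in>block_seqs V1 blk k. induces_path \<omega> x} \<ge>
    1 / (exp (4 * exp 1 * (real k)\<^sup>2 / (real (2 * k) * real m)) +
      exp (- (y * D / 8)) * exp (4 * z2 * (real k)\<^sup>2 / (real (2 * k) * real m)))"
  proof (rule prob_ex_induces_path[OF assms p_bounds m_pos])
    show "8 * exp 1 \<le> p * (real (2 * k) * real m)" using pM_ge e d_large by linarith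
    show "8 * z2 \<le> p * (real (2 * k) * real m)" using pM_ge z2 by linarith
  qed (use inverse_power_bound in \<open>auto simp: z2_def\<close>)
  moreover have "exp (4 * exp 1 * (real k)\<^sup>2 / (real (2 * k) * real m)) \<le> exp (100 * (y * D\<^sup>2 / d))"
  proof -
    have "exp 1 * Q \<le> 25 / 9 * (36 * (y * D\<^sup>2 / d))" using e Q Q0 by (intro mult_mono) auto
    moreover have "exp 1 * Q = 4 * exp 1 * (real k)\<^sup>2 / (real (2 * k) * real m)" by (simp add: Q_def)
    ultimately show ?thesis by simp
  qed
  moreover have "exp (- (y * D / 8)) * exp (4 * z2 * (real k)\<^sup>2 / (real (2 * k) * real m)) \<le> exp (- (y / 16))"
  proof -
    have "z2 * Q \<le> z2 * (36 * (y * D\<^sup>2 / d))" using Q by (intro mult_left_mono) (auto simp: z2_def)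
    also have "\<dots> = y * (36 * D\<^sup>2 * (z2 / d))" by simp
    also have "z2 / d = d powr (- 1 / 8)"
      using d_large powr_diff[of d "7/8" 1] by (simp add: z2_def)
    also have "y * (36 * D\<^sup>2 * d powr (- 1 / 8)) \<le> y * (D / 16)"
      using d_large y_ge by (intro mult_left_mono) (auto simp: D_def)
    finally have "z2 * Q \<le> y * D / 16" by simp
    moreover have "y * D / 16 \<ge> y * 1 / 16" using D_ge y_ge by (intro divide_right_mono mult_left_mono) auto
    ultimately have "- (y * D / 8) + z2 * Q \<le> - (y / 16)" by simp
    moreover have "z2 * Q = 4 * z2 * (real k)\<^sup>2 / (real (2 * k) * real m)" by (simp add: Q_def)
    ultimately show ?thesis by (simp flip: exp_add)
  qed
  ultimately show ?thesis
    by (smt (verit, best) divide_left_mono exp_gt_zero mult_pos_pos zero_less_one add_pos_pos)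
qed

definition target :: "nat graph set" where
  "target = {G. \<exists>P j. induced_subgraph P G \<and> is_path_of_length P j \<and>
     real j \<ge> (3 / 2 - \<epsilon>) * (real n / d) * ln d}"

lemma target_altdef: "target = {G. \<exists>P j. induced_subgraph P G \<and> is_path_of_length P j \<and>
     real j \<ge> (3 / 2 - \<epsilon>) * (y * D)}"
  by (simp add: target_def y_def D_def mult.assoc)

theorem prob_target_dense:
  assumes u: "100 * (y * D\<^sup>2 / d) \<le> \<eta> / 4" and e: "exp (- (y / 16)) \<le> \<eta> / 4" and \<eta>: "0 < \<eta>" "\<eta> \<le> 1"
  shows "measure_pmf.prob (gnp n (d / real n)) target \<ge> 1 - \<eta>"
proof -
  let ?E = "nsets {1..n} 2"
  let ?u = "100 * (y * D\<^sup>2 / d)"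
  have u0: "0 \<le> ?u" using y_ge d_large by simp
  have finE: "finite ?E" by (intro finite_imp_finite_nsets) simp
  have sub: "nsets V1 2 \<subseteq> ?E" using V1V2 by (intro nsets_mono) auto
  have "exp ?u \<le> 1 + ?u + ?u\<^sup>2" using u u0 \<eta> by (intro exp_bound) auto
  also have "?u\<^sup>2 \<le> ?u * 1" using u u0 \<eta> unfolding power2_eq_square by (intro mult_left_mono) auto
  finally have "exp ?u + exp (- (y / 16)) \<le> 1 + \<eta>" using u e \<eta> by simp
  then have "1 / (1 + \<eta>) \<le> 1 / (exp ?u + exp (- (y / 16)))"
    using \<eta> by (intro divide_left_mono mult_pos_pos add_pos_pos) auto
  moreover have "1 - \<eta> \<le> 1 / (1 + \<eta>)" using \<eta> by (simp add: field_simps)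
  ultimately have "1 - \<eta> \<le> measure_pmf.prob (Pi_pmf ?E False (\<lambda>_. bernoulli_pmf p))
      {\<omega>. \<exists>x\<in>block_seqs V1 blk k. induces_path \<omega> x}"
    using prob_ex_path_ge[OF finE sub] by linarith
  also have "\<dots> \<le> measure_pmf.prob (Pi_pmf ?E False (\<lambda>_. bernoulli_pmf p))
      {\<omega>. \<exists>xs. ipath \<omega> xs \<and> set xs \<subseteq> {1..n} \<and> k \<le> length xs}"
  proof (rule measure_pmf.finite_measure_mono, safe)
    fix \<omega> x assume x: "x \<in> block_seqs V1 blk k" "induces_path \<omega> x"
    have d: "distinct x" using x(1) by (rule block_seqs_distinct)
    have "ipath \<omega> x" using induces_path_chordless[OF x(2) d] d by (intro ipath_of_chordless) auto
    then show "\<exists>xs. ipath \<omega> xs \<and> set xs \<subseteq> {1..n} \<and> k \<le> length xs"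
      using x(1) V1V2(2) by (intro exI[of _ x]) (auto simp: block_seqs_def)
  qed simp
  also have "\<dots> \<le> measure_pmf.prob (gnp n p) target"
    unfolding target_altdef
  proof (rule prob_gnp_induced_path)
    have "(3 / 2 - \<epsilon>) * (y * D) + \<epsilon> / 2 * (y * D) = (3 / 2 - \<epsilon> / 2) * (y * D)" by (simp add: algebra_simps)
    then show "(3 / 2 - \<epsilon>) * (y * D) + 1 \<le> real k" using k_ge yD_ge by linarith
  qed (use k_pos in simp)
  finally show ?thesis by (simp add: p_def)
qed

end

section \<open>The sparse regime\<close>

lemma eventually_large_degree:
  fixes \<epsilon> b c1 c2 :: real
  assumes "0 < \<epsilon>" "\<epsilon> \<le> 1 / 4" "0 < b" "0 < c1" "0 < c2"
  shows "eventually (\<lambda>d. 100 \<le> d \<and> 1 \<le> ln d \<and> 12 * ln d \<le> d \<and> 32 \<le> d powr (1 / 8) \<and>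
      36 * (ln d)\<^sup>2 * d powr (- 1 / 8) \<le> ln d / 16 \<and>
      (ln d)\<^sup>2 \<le> d powr (\<epsilon> / 8) \<and>
      800 * ln d \<le> b * d powr (\<epsilon> / 4) \<and>
      c1 \<le> d powr (1 / 2 - \<epsilon> / 8) \<and>
      12 * (ln d)\<^sup>2 * d powr (- 3 / 2 + \<epsilon> / 8) + d powr (- 2) \<le> c2 * d powr (- 3 / 2 + \<epsilon> / 4)) at_top"
proof -
  have 1: "eventually (\<lambda>d::real. 100 \<le> d) at_top" "eventually (\<lambda>d::real. 1 \<le> ln d) at_top"
    "eventually (\<lambda>d::real. 12 * ln d \<le> d) at_top" "eventually (\<lambda>d::real. 32 \<le> d powr (1 / 8)) at_top"
    by real_asymp+
  have 2: "eventually (\<lambda>d::real. 36 * (ln d)\<^sup>2 * d powr (- 1 / 8) \<le> ln d / 16) at_top"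
    by real_asymp
  have 3: "eventually (\<lambda>d::real. (ln d)\<^sup>2 \<le> d powr (\<epsilon> / 8)) at_top"
    using assms by real_asymp
  have 4: "eventually (\<lambda>d::real. 800 * ln d \<le> b * d powr (\<epsilon> / 4)) at_top"
    using assms by real_asymp
  have "eventually (\<lambda>d::real. c1 \<le> d powr e) at_top" if "e > 0" for e
    using that assms by real_asymp
  then have 5: "eventually (\<lambda>d::real. c1 \<le> d powr (1 / 2 - \<epsilon> / 8)) at_top"
    using assms by simp
  have 6: "eventually (\<lambda>d::real. 12 * (ln d)\<^sup>2 * d powr (- 3 / 2 + \<epsilon> / 8) \<le> (c2 / 2) * d powr (- 3 / 2 + \<epsilon> / 4)) at_top"
    using assms by real_asymp
  have 7: "eventually (\<lambda>d::real. d powr (- 2) \<le> (c2 / 2) * d powr (- 3 / 2 + \<epsilon> / 4)) at_top"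
    using assms by real_asymp
  show ?thesis using 1 2 3 4 5 6 7 by eventually_elim auto
qed

text \<open>\<open>N\<close> paths of \<open>l\<close> vertices each are connected at their first and last \<open>h\<close> vertices, and up to
  \<open>2 * r\<close> of them are lost. Up to a logarithm \<open>H\<close> is \<open>k / L\<^sup>2\<close>, and every failure probability is
  exponentially small in \<open>H\<close>.\<close>

locale sparse_regime = sparse_graph +
  fixes \<beta> :: real
  assumes beta: "\<beta> = \<epsilon> / 40"
    and d_large': "800 * ln d \<le> \<beta>\<^sup>2 * d powr (\<epsilon> / 4)"
      "3 / \<beta> + 1 \<le> d powr (1 / 2 - \<epsilon> / 8)"
      "12 * (ln d)\<^sup>2 * d powr (- 3 / 2 + \<epsilon> / 8) + d powr (- 2) \<le> \<beta> ^ 4 / 128 * d powr (- 3 / 2 + \<epsilon> / 4)"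
begin

definition L :: nat where "L = nat \<lfloor>d powr (1 / 2 - \<epsilon> / 8)\<rfloor>"
definition H :: real where "H = y * d powr (\<epsilon> / 4 - 1)"
definition W :: real where "W = real k / real L"
definition l :: nat where "l = L - 1"
definition N :: nat where "N = nat \<lfloor>(1 - 2 * \<beta>) * W\<rfloor> - 1"
definition h :: nat where "h = nat \<lceil>\<beta> * real l\<rceil>"
definition r :: nat where "r = nat \<lceil>\<beta> * real N\<rceil>"

lemma beta_bounds: "0 < \<beta>" "\<beta> \<le> 1 / 160"
  using eps by (auto simp: beta)

lemma three_div_beta: "3 / \<beta> \<ge> 480"
proof -
  have "3 / \<beta> \<ge> 3 / (1 / 160)" using beta_bounds by (intro divide_left_mono) auto
  then show ?thesis by simp
qed

lemma L_bounds: "real L \<le> d powr (1 / 2 - \<epsilon> / 8)" "3 / \<beta> \<le> real L" "d powr (1 / 2 - \<epsilon> / 8) \<le> 2 * real L"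
proof -
  show "real L \<le> d powr (1 / 2 - \<epsilon> / 8)" unfolding L_def by simp
  have *: "d powr (1 / 2 - \<epsilon> / 8) - 1 \<le> real L" unfolding L_def by linarith
  then show "3 / \<beta> \<le> real L" using d_large' by linarith
  then show "d powr (1 / 2 - \<epsilon> / 8) \<le> 2 * real L" using * three_div_beta by linarith
qed

lemma L_ge: "real L \<ge> 480" using L_bounds three_div_beta by linarith

lemma l_eq: "Suc l = L" "real l = real L - 1" using L_ge by (auto simp: l_def of_nat_diff)

lemma l_half: "real l \<ge> real L / 2" using l_eq L_ge by simp

lemma y_powr_mono: "a \<le> b \<Longrightarrow> y * d powr a \<le> y * d powr b"
  using y_ge d_large by (intro mult_left_mono powr_mono) auto

lemma div_powr: "x / d powr e = x * d powr (- e)" for x e :: real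
  by (simp add: powr_minus divide_inverse)

lemma W_le: "W \<le> 3 * y * D * d powr (- 1 / 2 + \<epsilon> / 8)"
proof -
  have "W \<le> (3 / 2 * (y * D)) / (d powr (1 / 2 - \<epsilon> / 8) / 2)"
    unfolding W_def
  proof (rule frac_le)
    show "0 \<le> 3 / 2 * (y * D)" using yD_ge by linarith
    show "0 < d powr (1 / 2 - \<epsilon> / 8) / 2" using d_large(1) by simp
    show "d powr (1 / 2 - \<epsilon> / 8) / 2 \<le> real L" using L_bounds(3) by linarith
  qed (rule k_le_yD)
  also have "\<dots> = 3 * y * D / d powr (1 / 2 - \<epsilon> / 8)" by simp
  also have "\<dots> = 3 * y * D * d powr (- (1 / 2 - \<epsilon> / 8))" by (rule div_powr)
  also have "- (1 / 2 - \<epsilon> / 8) = - 1 / 2 + \<epsilon> / 8" by simp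
  finally show ?thesis .
qed

lemma W_le_k: "W \<le> real k"
proof -
  have "real k * 1 \<le> real k * real L" using L_ge by (intro mult_left_mono) auto
  then show ?thesis unfolding W_def using L_ge by (simp add: pos_divide_le_eq)
qed

lemma W_ge: "W \<ge> H"
proof -
  have "H \<le> y * d powr (- (1 / 2 - \<epsilon> / 8))" unfolding H_def using eps by (intro y_powr_mono) auto
  also have "\<dots> = y / d powr (1 / 2 - \<epsilon> / 8)" by (rule div_powr[symmetric])
  also have "\<dots> \<le> real k / real L"
  proof (rule frac_le)
    have "y * 1 \<le> y * D" using y_ge D_ge by (intro mult_left_mono) auto
    then show "y \<le> real k" using k_ge_yD by linarith
  qed (use L_bounds L_ge in auto)
  finally show ?thesis by (simp add: W_def)
qed

lemma beta_power_le: "\<beta> ^ 4 \<le> \<beta>\<^sup>2" "\<beta>\<^sup>2 \<le> \<beta>" "\<beta> ^ 4 \<le> 1"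
  using beta_bounds power_decreasing[of 2 4 \<beta>] power_decreasing[of 1 2 \<beta>] power_le_one[of \<beta> 4] by auto

end

locale sparse_regime_eta = sparse_regime +
  fixes \<eta> :: real
  assumes eta: "0 < \<eta>" "\<eta> \<le> 1" and H_ge: "128 / \<beta> ^ 4 * (1 + ln (2 / \<eta>)) \<le> H"
begin

definition lg :: real where "lg = 1 + ln (2 / \<eta>)"

lemma lg_ge_1: "lg \<ge> 1" unfolding lg_def using eta by simp

lemma beta_H: "\<beta> ^ 4 * H \<ge> 128 * lg" "\<beta>\<^sup>2 * H \<ge> 128 * lg" "\<beta> * H \<ge> 128" "H \<ge> 128"
proof -
  have b4: "\<beta> ^ 4 > 0" using beta_bounds by simp
  show 4: "\<beta> ^ 4 * H \<ge> 128 * lg" using H_ge b4 unfolding lg_def[symmetric] by (simp add: pos_divide_le_eq mult.commute)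
  have H0: "H \<ge> 0" using y_ge by (simp add: H_def)
  have "\<beta> ^ 4 * H \<le> \<beta>\<^sup>2 * H" using beta_power_le H0 by (intro mult_right_mono) auto
  with 4 show 2: "\<beta>\<^sup>2 * H \<ge> 128 * lg" by (rule order_trans)
  have "\<beta>\<^sup>2 * H \<le> \<beta> * H" using beta_power_le H0 by (intro mult_right_mono) auto
  with 2 have "128 * lg \<le> \<beta> * H" by (rule order_trans)
  then show 1: "\<beta> * H \<ge> 128" using lg_ge_1 by linarith
  have "\<beta> * H \<le> 1 * H" using beta_bounds H0 by (intro mult_right_mono) auto
  with 1 have "128 \<le> 1 * H" by (rule order_trans)
  then show "H \<ge> 128" by simp
qed

lemma exp_le_eta_half: "c \<ge> lg \<Longrightarrow> exp (- c) \<le> \<eta> / 2"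
proof -
  assume "c \<ge> lg"
  then have "exp (- c) \<le> exp (- ln (2 / \<eta>))" by (simp add: lg_def)
  also have "\<dots> = \<eta> / 2" using eta by (simp add: exp_minus)
  finally show ?thesis .
qed

lemma W_ge_128: "W \<ge> 128" "\<beta> * W \<ge> 128"
proof -
  show "W \<ge> 128" using W_ge beta_H by linarith
  have "\<beta> * H \<le> \<beta> * W" using W_ge beta_bounds by (intro mult_left_mono) auto
  with beta_H(3) show "\<beta> * W \<ge> 128" by (rule order_trans)
qed

lemma N_bounds: "(1 - 2 * \<beta>) * W - 2 \<le> real N" "real N + 1 \<le> (1 - 2 * \<beta>) * W" "real N \<le> W" "W / 2 \<le> real N"
proof -
  define w where "w = (1 - 2 * \<beta>) * W"
  have w1: "3 / 4 * W \<le> w" unfolding w_def using beta_bounds W_ge_128 by (intro mult_right_mono) auto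
  have "w \<le> 1 * W" unfolding w_def using beta_bounds W_ge_128 by (intro mult_right_mono) auto
  then have w2: "w \<le> W" by simp
  have w3: "w \<ge> 96" using w1 W_ge_128 by linarith
  have N: "real N = real_of_int \<lfloor>w\<rfloor> - 1"
  proof -
    have "\<lfloor>w\<rfloor> \<ge> 96" using w3 by (simp add: le_floor_iff)
    then have "real (nat \<lfloor>w\<rfloor>) = real_of_int \<lfloor>w\<rfloor>" "1 \<le> nat \<lfloor>w\<rfloor>" by linarith+
    then show ?thesis unfolding N_def w_def[symmetric] by (simp only: of_nat_diff of_nat_1)
  qed
  show "(1 - 2 * \<beta>) * W - 2 \<le> real N" using N unfolding w_def[symmetric] by linarith
  show "W / 2 \<le> real N" using N w1 W_ge_128 by linarith
  show "real N + 1 \<le> (1 - 2 * \<beta>) * W" using N unfolding w_def[symmetric] by linarith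
  show "real N \<le> W" using N w2 by linarith
qed

lemma prob_no_path_system:
  "measure_pmf.prob (Pi_pmf (nsets V1 2) False (\<lambda>_. bernoulli_pmf p))
     {\<omega>. \<not> (\<exists>J P. finite J \<and> card J = N \<and> path_system \<omega> V1 J l P)} \<le> \<eta> / 2"
proof -
  let ?M = "Pi_pmf (nsets V1 2) False (\<lambda>_. bernoulli_pmf p)"
  define u where "u = 100 * (y * D\<^sup>2 / d)"
  define t where "t = \<beta> * real k"
  define G where "G = 2 * t\<^sup>2 / ((1 + real L)\<^sup>2 * real (2 * k))"
  have t: "t > 0" using beta_bounds k_pos by (simp add: t_def)
  have u0: "u \<ge> 0" using y_ge d_large by (simp add: u_def)
  have G: "G \<ge> \<beta>\<^sup>2 * H * D / 4"
  proof -
    have "(1 + real L)\<^sup>2 \<le> (2 * d powr (1 / 2 - \<epsilon> / 8))\<^sup>2"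
      using L_bounds L_ge by (intro power_mono) auto
    also have "\<dots> = 4 * d powr (1 - \<epsilon> / 4)" by (simp add: power2_eq_square flip: powr_add)
    finally have le: "(1 + real L)\<^sup>2 \<le> 4 * d powr (1 - \<epsilon> / 4)" .
    have "\<epsilon> / 4 - 1 = - (1 - \<epsilon> / 4)" by simp
    then have "\<beta>\<^sup>2 * H * D / 4 = \<beta>\<^sup>2 * (y * D) * d powr (- (1 - \<epsilon> / 4)) / 4" unfolding H_def by simp
    also have "\<dots> = \<beta>\<^sup>2 * (y * D) / d powr (1 - \<epsilon> / 4) / 4" by (simp only: div_powr)
    also have "\<dots> = \<beta>\<^sup>2 * (y * D) / (4 * d powr (1 - \<epsilon> / 4))" by simp
    also have "\<dots> \<le> \<beta>\<^sup>2 * real k / (1 + real L)\<^sup>2"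
      using le k_ge_yD yD_ge L_ge by (intro frac_le mult_left_mono) auto
    also have "\<dots> = G" using k_pos by (simp add: G_def t_def power2_eq_square)
    finally show ?thesis .
  qed
  have HD: "128 * lg \<le> \<beta>\<^sup>2 * H * D"
  proof -
    have "\<beta>\<^sup>2 * H * 1 \<le> \<beta>\<^sup>2 * H * D" using D_ge beta_H by (intro mult_left_mono) auto
    then have "\<beta>\<^sup>2 * H \<le> \<beta>\<^sup>2 * H * D" by (simp only: mult_1_right)
    with beta_H(2) show ?thesis by (rule order_trans)
  qed
  have uG: "u \<le> \<beta>\<^sup>2 * H * D / 8"
  proof -
    have "u = y * D / (8 * d) * (800 * D)" using d_large by (simp add: u_def power2_eq_square)
    also have "\<dots> \<le> y * D / (8 * d) * (\<beta>\<^sup>2 * d powr (\<epsilon> / 4))"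
      using d_large' d_large yD_ge by (intro mult_left_mono) (auto simp: D_def)
    also have "\<dots> = \<beta>\<^sup>2 * (y * (d powr (\<epsilon> / 4) / d)) * D / 8" by (simp add: mult_ac)
    also have "d powr (\<epsilon> / 4) / d = d powr (\<epsilon> / 4 - 1)" using d_large by (simp add: powr_diff)
    finally show ?thesis by (simp add: H_def)
  qed
  have s: "u + 1 < G" using uG G HD lg_ge_1 by linarith
  have ex: "exp (- (u + 1)) \<le> measure_pmf.prob ?M {\<omega>. \<exists>x\<in>block_seqs V1 blk k. induces_path \<omega> x}"
  proof -
    have "exp u + exp (- (y / 16)) \<le> exp u * 2" using u0 y_ge one_le_exp_iff[of u] exp_le_one_iff[of "- (y / 16)"] by linarith
    also have "\<dots> \<le> exp u * exp 1" using exp_ge_add_one_self[of 1] by (intro mult_left_mono) auto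
    also have "\<dots> = exp (u + 1)" by (simp add: exp_add)
    finally have "1 / exp (u + 1) \<le> 1 / (exp u + exp (- (y / 16)))"
      by (intro divide_left_mono mult_pos_pos add_pos_pos) auto
    moreover have "1 / exp (u + 1) = exp (- (u + 1))" by (simp only: exp_minus inverse_eq_divide)
    ultimately show ?thesis
      using prob_ex_path_ge[OF finite_imp_finite_nsets[OF V1V2(3)] order_refl, folded u_def] by linarith
  qed
  have "measure_pmf.prob ?M {\<omega>. \<not> (\<exists>J P. finite J \<and> card J = N \<and> path_system \<omega> V1 J l P)} \<le>
      measure_pmf.prob ?M {\<omega>. max_chain (real L) \<omega> \<le> real k - 2 * t}"
  proof (rule measure_pmf.finite_measure_mono, safe, rule ccontr)
    fix \<omega>
    assume no: "\<nexists>J P. finite J \<and> card J = N \<and> path_system \<omega> V1 J l P"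
      and "\<not> max_chain (real L) \<omega> \<le> real k - 2 * t"
    then have gt: "real k - 2 * t < max_chain (real (Suc l)) \<omega>" by (simp add: l_eq(1))
    have "(real N + 1) * real L \<le> (1 - 2 * \<beta>) * W * real L" using N_bounds by (intro mult_right_mono) auto
    also have "\<dots> = (1 - 2 * \<beta>) * (W * real L)" by (rule mult.assoc)
    also have "W * real L = real k" using L_ge by (simp add: W_def)
    also have "(1 - 2 * \<beta>) * real k = real k - 2 * t" by (simp add: t_def algebra_simps)
    finally have "real (Suc N) * real (Suc l) \<le> real k - 2 * t" by (simp add: l_eq(1) add.commute)
    from path_system_of_max_chain[OF gt this] no show False by blast
  qed simp
  also have "\<dots> \<le> exp (- 2 * t\<^sup>2 / ((1 + real L)\<^sup>2 * real (2 * k)))"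
    using t k_pos s ex unfolding G_def by (intro prob_max_chain_le) auto
  also have "\<dots> = exp (- G)" by (simp add: G_def)
  also have "\<dots> \<le> \<eta> / 2" using G HD lg_ge_1 by (intro exp_le_eta_half) linarith
  finally show ?thesis .
qed

lemma hr_bounds: "real h \<ge> \<beta> * real l" "real h \<le> \<beta> * real l + 1" "real r \<ge> \<beta> * real N" "real r \<le> \<beta> * real N + 1"
proof -
  have 0: "\<beta> * real l \<ge> 0" "\<beta> * real N \<ge> 0" using beta_bounds by auto
  show "real h \<ge> \<beta> * real l" "real r \<ge> \<beta> * real N" unfolding h_def r_def by linarith+
  show "real h \<le> \<beta> * real l + 1" "real r \<le> \<beta> * real N + 1" unfolding h_def r_def using 0 by linarith+
qed

lemma l_bounds: "real L * (1 - 3 * \<beta>) \<le> real l - 2 * real h" "2 * h < l" "0 < h"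
proof -
  have bL: "\<beta> * real L \<ge> 3" using L_bounds(2) beta_bounds by (simp add: field_simps)
  have "\<beta> * real l = \<beta> * real L - \<beta>" by (simp add: l_eq algebra_simps)
  then show *: "real L * (1 - 3 * \<beta>) \<le> real l - 2 * real h"
    using hr_bounds(2) bL l_eq(2) beta_bounds by (simp add: algebra_simps)
  have "real L * (1 - 3 * \<beta>) > 0" using beta_bounds L_ge by simp
  then have "real (2 * h) < real l" using * by simp
  then show "2 * h < l" by (simp only: of_nat_less_iff)
  have "\<beta> * real l > 0" using beta_bounds l_half L_ge by simp
  then have "real h > 0" using hr_bounds(1) by linarith
  then show "0 < h" by simp
qed

lemma r_bounds: "W * (1 - 6 * \<beta>) \<le> real N - 2 * real r" "2 * r \<le> N" "0 < r"
proof -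
  have "\<beta> * real N \<le> \<beta> * W" using N_bounds beta_bounds by (intro mult_left_mono) auto
  then show *: "W * (1 - 6 * \<beta>) \<le> real N - 2 * real r"
    using hr_bounds(4) N_bounds(1) W_ge_128 by (simp add: algebra_simps)
  have "W * (1 - 6 * \<beta>) \<ge> 0" using beta_bounds W_ge_128 by simp
  then have "real (2 * r) \<le> real N" using * by simp
  then show "2 * r \<le> N" by (simp only: of_nat_le_iff)
  have "\<beta> * real N > 0" using beta_bounds N_bounds(4) W_ge_128 by simp
  then have "real r > 0" using hr_bounds(3) by linarith
  then show "0 < r" by simp
qed

lemma rhp_ge: "real r * real h * p \<ge> \<beta>\<^sup>2 / 4"
proof -
  have "real k / 4 = (W / 2) * (real L / 2)" using L_ge by (simp add: W_def)
  also have "\<dots> \<le> real N * real l" using N_bounds l_half W_ge_128 by (intro mult_mono) auto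
  finally have Nl: "real k / 4 \<le> real N * real l" .
  have "1 / 4 \<le> real k / 4 * p"
  proof -
    have "y * 1 \<le> y * D" using y_ge D_ge by (intro mult_left_mono) auto
    then have "y \<le> real k" using k_ge_yD by linarith
    then show ?thesis using y_ge by (simp add: p_eq field_simps)
  qed
  then have "\<beta>\<^sup>2 / 4 \<le> \<beta>\<^sup>2 * (real k / 4 * p)" using mult_left_mono[of "1 / 4" "real k / 4 * p" "\<beta>\<^sup>2"] by simp
  also have "\<dots> \<le> \<beta>\<^sup>2 * (real N * real l * p)"
    using Nl p_bounds by (intro mult_left_mono mult_right_mono) auto
  also have "\<dots> = (\<beta> * real N) * (\<beta> * real l) * p" by (simp add: power2_eq_square)
  also have "\<dots> \<le> real r * real h * p"
    using hr_bounds beta_bounds p_bounds by (intro mult_right_mono mult_mono) auto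
  finally show ?thesis .
qed

lemma connecting_bound:
  "4 ^ N * ((1 / (1 / d\<^sup>2)) ^ N * exp ((1 / d\<^sup>2) * real (card V2))) *
     exp (- ((real r * real h * p)\<^sup>2 * (1 - p) ^ (N * l + N)) * (real (card V2) - real N)) \<le> \<eta> / 2"
proof -
  define c where "c = \<beta> ^ 4 * d powr (- 3 / 2 + \<epsilon> / 4)"
  have c0: "c \<ge> 0" by (simp add: c_def)
  have pi: "(real r * real h * p)\<^sup>2 * (1 - p) ^ (N * l + N) \<ge> c / 16"
  proof -
    have "N * l + N = N * L" using l_eq(1) by (metis add.commute mult_Suc_right)
    moreover have "real N * real L \<le> W * real L" using N_bounds by (intro mult_right_mono) auto
    ultimately have NL: "real (N * l + N) \<le> real k" using L_ge by (simp add: W_def)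
    have "real (N * l + N) / (y - 1) \<le> real k / (y - 1)" using NL y_ge by (intro divide_right_mono) auto
    then have "real (N * l + N) / (y - 1) \<le> (3 / 2 - \<epsilon> / 4) * D" using k_over_y_le by linarith
    then have "exp ((- 3 / 2 + \<epsilon> / 4) * D) \<le> exp (- (real (N * l + N) / (y - 1)))" by (simp add: algebra_simps)
    also have "\<dots> \<le> (1 - p) ^ (N * l + N)" by (rule one_minus_p_power_ge)
    finally have 1: "d powr (- 3 / 2 + \<epsilon> / 4) \<le> (1 - p) ^ (N * l + N)" by (simp only: exp_D)
    have "(\<beta>\<^sup>2 / 4)\<^sup>2 \<le> (real r * real h * p)\<^sup>2" using rhp_ge by (intro power_mono) auto
    then have 2: "\<beta> ^ 4 / 16 \<le> (real r * real h * p)\<^sup>2" by (simp add: power_divide)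
    have "c / 16 = \<beta> ^ 4 / 16 * d powr (- 3 / 2 + \<epsilon> / 4)" by (simp add: c_def)
    also have "\<dots> \<le> (real r * real h * p)\<^sup>2 * (1 - p) ^ (N * l + N)"
      using 1 2 by (intro mult_mono) auto
    finally show ?thesis .
  qed
  have N8: "real N \<le> real n / 8"
  proof -
    have "real (8 * k) \<le> real n" using k_le_n by (simp only: of_nat_le_iff)
    then show ?thesis using N_bounds(3) W_le_k by simp
  qed
  then have V2N: "real n / 4 \<le> real (card V2) - real N" using card_V2 by linarith
  have e1: "c / 16 * (real n / 4) \<le> (real r * real h * p)\<^sup>2 * (1 - p) ^ (N * l + N) * (real (card V2) - real N)"
    using pi V2N c0 by (intro mult_mono) auto
  have e2: "4 ^ N * (1 / (1 / d\<^sup>2)) ^ N \<le> exp (4 * D * real N)"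
  proof -
    have "4 * d\<^sup>2 \<le> d\<^sup>2 * d\<^sup>2" using d_large by (intro mult_right_mono) (auto intro!: order_trans[OF _ power_mono[of 2 d 2]])
    also have "\<dots> = exp (4 * D)" using d_large by (subst exp_D) (simp add: powr_numeral flip: power_add)
    finally have "(4 * d\<^sup>2) ^ N \<le> exp (4 * D) ^ N" using d_large by (intro power_mono) auto
    then show ?thesis by (simp add: power_mult_distrib mult.commute flip: exp_of_nat_mult)
  qed
  have e3: "4 * D * real N \<le> real n * (12 * D\<^sup>2 * d powr (- 3 / 2 + \<epsilon> / 8))"
  proof -
    have "4 * D * real N \<le> 4 * D * (3 * y * D * d powr (- 1 / 2 + \<epsilon> / 8))"
      using N_bounds(3) W_le D_ge by (intro mult_left_mono) auto
    also have "\<dots> = y * (12 * D\<^sup>2 * d powr (- 1 / 2 + \<epsilon> / 8))" by (simp add: power2_eq_square)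
    also have "d powr (- 1 / 2 + \<epsilon> / 8) = d * d powr (- 3 / 2 + \<epsilon> / 8)"
      using d_large powr_add[of d 1 "- 3 / 2 + \<epsilon> / 8"] by simp
    finally show ?thesis by (simp add: n_eq algebra_simps)
  qed
  have e4: "(1 / d\<^sup>2) * real (card V2) \<le> real n * d powr (- 2)"
  proof -
    have "d powr (- 2) = 1 / d\<^sup>2" using d_large by (simp add: powr_minus_divide powr_numeral)
    then show ?thesis using card_V2(2) d_large by (simp add: field_simps)
  qed
  have tot: "4 * D * real N + (1 / d\<^sup>2) * real (card V2) - c / 16 * (real n / 4) \<le> - (c * real n / 128)"
  proof -
    define X where "X = 12 * D\<^sup>2 * d powr (- 3 / 2 + \<epsilon> / 8)"
    have "real n * (X + d powr (- 2)) \<le> real n * (c / 128)"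
      using d_large'(3) by (intro mult_left_mono) (auto simp: c_def D_def X_def)
    then have "real n * X + real n * d powr (- 2) \<le> c * real n / 128" by (simp add: algebra_simps)
    moreover have "c / 16 * (real n / 4) = c * real n / 128 + c * real n / 128" by simp
    ultimately show ?thesis using e3[folded X_def] e4 by linarith
  qed
  have cn: "lg \<le> c * real n / 128"
  proof -
    have "H \<le> y * d powr (- 1 / 2 + \<epsilon> / 4)" unfolding H_def by (intro y_powr_mono) auto
    also have "d powr (- 1 / 2 + \<epsilon> / 4) = d * d powr (- 3 / 2 + \<epsilon> / 4)"
      using d_large powr_add[of d 1 "- 3 / 2 + \<epsilon> / 4"] by simp
    finally have "\<beta> ^ 4 * H \<le> \<beta> ^ 4 * (y * (d * d powr (- 3 / 2 + \<epsilon> / 4)))"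
      using beta_bounds by (intro mult_left_mono) auto
    also have "\<dots> = c * real n" by (simp add: c_def n_eq)
    finally show ?thesis using beta_H(1) by simp
  qed
  have "4 ^ N * ((1 / (1 / d\<^sup>2)) ^ N * exp ((1 / d\<^sup>2) * real (card V2))) *
     exp (- ((real r * real h * p)\<^sup>2 * (1 - p) ^ (N * l + N)) * (real (card V2) - real N)) =
     (4 ^ N * (1 / (1 / d\<^sup>2)) ^ N) * exp ((1 / d\<^sup>2) * real (card V2)) *
     exp (- ((real r * real h * p)\<^sup>2 * (1 - p) ^ (N * l + N) * (real (card V2) - real N)))" by simp
  also have "\<dots> \<le> exp (4 * D * real N) * exp ((1 / d\<^sup>2) * real (card V2)) * exp (- (c / 16 * (real n / 4)))"
    using e1 e2 by (intro mult_mono) auto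
  also have "\<dots> = exp (4 * D * real N + (1 / d\<^sup>2) * real (card V2) - c / 16 * (real n / 4))"
    by (simp only: exp_add diff_conv_add_uminus)
  also have "\<dots> \<le> exp (- (c * real n / 128))" using tot by simp
  also have "\<dots> \<le> \<eta> / 2" using cn by (rule exp_le_eta_half)
  finally show ?thesis .
qed

lemma length_bound: "(3 / 2 - \<epsilon>) * (y * D) + 1 \<le> real ((N - 2 * r) * (l - 2 * h))"
proof -
  have "real ((N - 2 * r) * (l - 2 * h)) = (real N - 2 * real r) * (real l - 2 * real h)"
    using r_bounds(2) l_bounds(2) by (simp add: of_nat_diff)
  also have "\<dots> \<ge> (W * (1 - 6 * \<beta>)) * (real L * (1 - 3 * \<beta>))"
  proof (rule mult_mono[OF r_bounds(1) l_bounds(1)])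
    have "real (2 * r) \<le> real N" using r_bounds(2) by (rule of_nat_mono)
    then show "0 \<le> real N - 2 * real r" by simp
    show "0 \<le> real L * (1 - 3 * \<beta>)" using beta_bounds by simp
  qed
  also have "(W * (1 - 6 * \<beta>)) * (real L * (1 - 3 * \<beta>)) = real k * ((1 - 6 * \<beta>) * (1 - 3 * \<beta>))"
    using L_ge by (simp add: W_def)
  finally have 1: "real k * ((1 - 6 * \<beta>) * (1 - 3 * \<beta>)) \<le> real ((N - 2 * r) * (l - 2 * h))" .
  have "(1 - 6 * \<beta>) * (1 - 3 * \<beta>) = 1 - 9 * \<beta> + 18 * \<beta>\<^sup>2" by (simp add: power2_eq_square algebra_simps)
  then have "1 - 9 * \<beta> \<le> (1 - 6 * \<beta>) * (1 - 3 * \<beta>)" by simp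
  then have 2: "real k * (1 - 9 * \<beta>) \<le> real k * ((1 - 6 * \<beta>) * (1 - 3 * \<beta>))" by (intro mult_left_mono) auto
  have "real k * (9 * \<beta>) \<le> 3 / 2 * (y * D) * (9 * \<beta>)" using k_le_yD beta_bounds by (intro mult_right_mono) auto
  also have "\<dots> = 27 / 80 * (\<epsilon> * (y * D))" by (simp add: beta)
  finally have 3: "real k * (9 * \<beta>) \<le> 27 / 80 * (\<epsilon> * (y * D))" .
  define E where "E = \<epsilon> * (y * D)"
  define q where "q = y * D"
  have k: "3 / 2 * q - E / 2 - 1 \<le> real k" using k_ge by (simp add: E_def q_def algebra_simps)
  have "real k - 27 / 80 * E \<le> real k * (1 - 9 * \<beta>)" using 3 by (simp add: E_def algebra_simps)
  also have "\<dots> \<le> real ((N - 2 * r) * (l - 2 * h))" using 2 1 by (rule order_trans)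
  finally have "real k - 27 / 80 * E \<le> real ((N - 2 * r) * (l - 2 * h))" .
  moreover have "20 \<le> E" using yD_ge(2) by (simp add: E_def)
  moreover have "(3 / 2 - \<epsilon>) * (y * D) = 3 / 2 * q - E" by (simp add: E_def q_def algebra_simps)
  ultimately show ?thesis using k by linarith
qed

theorem prob_target_sparse: "measure_pmf.prob (gnp n (d / real n)) target \<ge> 1 - \<eta>"
proof -
  let ?M = "Pi_pmf (nsets {1..n} 2) False (\<lambda>_. bernoulli_pmf p)"
  let ?K = "(N - 2 * r) * (l - 2 * h)"
  let ?S = "{\<omega>. \<exists>xs. ipath \<omega> xs \<and> set xs \<subseteq> {1..n} \<and> ?K \<le> length xs}"
  have "0 < 1 / d\<^sup>2" "1 / d\<^sup>2 \<le> 1" using d_large by (auto simp: divide_le_eq_1 one_le_power)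
  from prob_no_long_ipath[OF V1V2(3,4,1) l_bounds(2,3) r_bounds(3,2) _ _ this, of p]
  have "measure_pmf.prob ?M {\<omega>. \<not> (\<exists>xs. ipath \<omega> xs \<and> set xs \<subseteq> {1..n} \<and> ?K \<le> length xs)} \<le> \<eta> / 2 + \<eta> / 2"
    unfolding V1V2(2) using prob_no_path_system connecting_bound p_bounds by linarith
  moreover have "measure_pmf.prob ?M {\<omega>. \<not> (\<exists>xs. ipath \<omega> xs \<and> set xs \<subseteq> {1..n} \<and> ?K \<le> length xs)} =
      1 - measure_pmf.prob ?M ?S"
  proof -
    have "{\<omega>. \<not> (\<exists>xs. ipath \<omega> xs \<and> set xs \<subseteq> {1..n} \<and> ?K \<le> length xs)} = space (measure_pmf ?M) - ?S"
      by (simp only: space_measure_pmf Collect_neg_eq Compl_eq_Diff_UNIV)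
    then show ?thesis by (simp only: measure_pmf.prob_compl sets_measure_pmf UNIV_I)
  qed
  ultimately have "1 - \<eta> \<le> measure_pmf.prob ?M ?S" by linarith
  also have "\<dots> \<le> measure_pmf.prob (gnp n p) target"
    unfolding target_altdef
  proof (rule prob_gnp_induced_path)
    show "(3 / 2 - \<epsilon>) * (y * D) + 1 \<le> real ?K" by (rule length_bound)
    have "0 \<le> (3 / 2 - \<epsilon>) * (y * D)" using eps yD_ge by simp
    then have "real ?K > 0" using length_bound by linarith
    then have "0 < ?K" by (simp only: of_nat_0_less_iff)
    then show "?K \<noteq> 0" by (simp only: neq0_conv)
  qed
  finally show ?thesis by (simp add: p_def)
qed

end

lemma prob_target_uniform:
  fixes \<epsilon> :: real
  assumes eps: "0 < \<epsilon>" "\<epsilon> \<le> 1 / 4"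
  shows "\<exists>d0\<ge>1. \<forall>\<eta>. 0 < \<eta> \<and> \<eta> \<le> 1 \<longrightarrow> (\<exists>Y>0. \<forall>d n. d0 \<le> d \<and> Y \<le> real n / d \<longrightarrow>
    1 - \<eta> \<le> measure_pmf.prob (gnp n (d / real n))
      {G. \<exists>P k. induced_subgraph P G \<and> is_path_of_length P k \<and>
        real k \<ge> (3 / 2 - \<epsilon>) * (real n / d) * ln d})"
proof -
  define \<beta> where "\<beta> = \<epsilon> / 40"
  define \<tau> where "\<tau> = \<epsilon> / 8"
  have beta: "0 < \<beta>" using eps by (simp add: \<beta>_def)
  have tau: "0 < \<tau>" "\<tau> \<le> 1" using eps by (auto simp: \<tau>_def)
  have "0 < \<beta>\<^sup>2" "0 < 3 / \<beta> + 1" "0 < \<beta> ^ 4 / 128" using beta by (auto intro: add_pos_pos)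
  from eventually_large_degree[OF eps this]
  obtain d1 where d1: "\<And>d. d1 \<le> d \<Longrightarrow> 100 \<le> d \<and> 1 \<le> ln d \<and> 12 * ln d \<le> d \<and> 32 \<le> d powr (1 / 8) \<and>
      36 * (ln d)\<^sup>2 * d powr (- 1 / 8) \<le> ln d / 16 \<and>
      (ln d)\<^sup>2 \<le> d powr (\<epsilon> / 8) \<and>
      800 * ln d \<le> \<beta>\<^sup>2 * d powr (\<epsilon> / 4) \<and>
      3 / \<beta> + 1 \<le> d powr (1 / 2 - \<epsilon> / 8) \<and>
      12 * (ln d)\<^sup>2 * d powr (- 3 / 2 + \<epsilon> / 8) + d powr (- 2) \<le> \<beta> ^ 4 / 128 * d powr (- 3 / 2 + \<epsilon> / 4)"
    unfolding eventually_at_top_linorder by blast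
  have main: "\<exists>Y>0. \<forall>d n. max 1 d1 \<le> d \<and> Y \<le> real n / d \<longrightarrow>
    1 - \<eta> \<le> measure_pmf.prob (gnp n (d / real n))
      {G. \<exists>P k. induced_subgraph P G \<and> is_path_of_length P k \<and>
        real k \<ge> (3 / 2 - \<epsilon>) * (real n / d) * ln d}" if \<eta>: "0 < \<eta>" "\<eta> \<le> 1" for \<eta> :: real
  proof -
    define X where "X = 128 / \<beta> ^ 4 * (1 + ln (2 / \<eta>))"
    define c where "c = \<eta> / 400"
    define Y1 where "Y1 = (X / c powr (1 - \<tau>)) powr (1 / \<tau>)"
    define Y where "Y = max (20 / \<epsilon>) (max (16 * ln (4 / \<eta>)) Y1)"
    have c: "c > 0" using \<eta> by (simp add: c_def)
    have "0 \<le> ln (2 / \<eta>)" using \<eta> by simp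
    then have X: "X > 0" unfolding X_def using beta by (intro mult_pos_pos divide_pos_pos) auto
    have Y1: "Y1 powr \<tau> = X / c powr (1 - \<tau>)" using X c tau by (simp add: Y1_def powr_powr)
    have "1 - \<eta> \<le> measure_pmf.prob (gnp n (d / real n))
      {G. \<exists>P k. induced_subgraph P G \<and> is_path_of_length P k \<and>
        real k \<ge> (3 / 2 - \<epsilon>) * (real n / d) * ln d}" if d: "max 1 d1 \<le> d" and n: "Y \<le> real n / d" for d n
    proof -
      note large = d1[of d]
      have dd: "d1 \<le> d" using d by simp
      interpret sparse_graph \<epsilon> d n
        using eps large[OF dd] n by unfold_locales (auto simp: Y_def)
      have y: "Y \<le> y" using n by (simp add: y_def)
      show ?thesis
      proof (cases "100 * (y * D\<^sup>2 / d) \<le> \<eta> / 4")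
        case True
        have "16 * ln (4 / \<eta>) \<le> y" using y by (simp add: Y_def)
        then have "exp (- (y / 16)) \<le> exp (- ln (4 / \<eta>))" by simp
        also have "\<dots> = \<eta> / 4" using \<eta> by (simp add: exp_minus)
        finally show ?thesis using prob_target_dense[OF True _ \<eta>] by (simp add: target_def)
      next
        case False
        have d0: "d > 0" using d_large by simp
        have y0: "y > 0" using y_ge by linarith
        interpret sparse_regime \<epsilon> d n \<beta>
          using large[OF dd] by unfold_locales (auto simp: \<beta>_def)
        have "D\<^sup>2 \<le> d powr \<tau>" using large[OF dd] by (simp add: D_def \<tau>_def)
        have "c * d powr (1 - \<tau>) \<le> y"
        proof -
          have "c * d < y * D\<^sup>2" using False d0 by (simp add: c_def field_simps)
          also have "\<dots> \<le> y * d powr \<tau>" using \<open>D\<^sup>2 \<le> d powr \<tau>\<close> y0 by (intro mult_left_mono) auto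
          finally have "c * d / d powr \<tau> \<le> y" using d0 by (simp add: pos_divide_le_eq)
          then show ?thesis using d0 by (simp add: powr_diff)
        qed
        then have "(c * d powr (1 - \<tau>)) powr (1 - \<tau>) \<le> y powr (1 - \<tau>)"
          using c tau by (intro powr_mono2) auto
        moreover have "Y1 powr \<tau> \<le> y powr \<tau>"
          using y tau X c by (intro powr_mono2) (auto simp: Y_def Y1_def)
        ultimately have "Y1 powr \<tau> * (c * d powr (1 - \<tau>)) powr (1 - \<tau>) \<le> y powr \<tau> * y powr (1 - \<tau>)"
          by (intro mult_mono) auto
        also have "y powr \<tau> * y powr (1 - \<tau>) = y" using y0 by (simp flip: powr_add)
        also have "Y1 powr \<tau> * (c * d powr (1 - \<tau>)) powr (1 - \<tau>) = X * d powr ((1 - \<tau>) * (1 - \<tau>))"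
          using c d0 by (simp add: Y1 powr_mult powr_powr)
        finally have "X * d powr ((1 - \<tau>) * (1 - \<tau>)) * d powr (\<epsilon> / 4 - 1) \<le> H"
          unfolding H_def by (intro mult_right_mono) auto
        moreover have "X * 1 \<le> X * (d powr ((1 - \<tau>) * (1 - \<tau>)) * d powr (\<epsilon> / 4 - 1))"
        proof -
          have "(1 - \<tau>) * (1 - \<tau>) + (\<epsilon> / 4 - 1) = \<tau>\<^sup>2" by (simp add: \<tau>_def power2_eq_square algebra_simps)
          then have "1 \<le> d powr ((1 - \<tau>) * (1 - \<tau>) + (\<epsilon> / 4 - 1))"
            using d by (intro ge_one_powr_ge_zero) auto
          then show ?thesis using X by (intro mult_left_mono) (auto simp: powr_add)
        qed
        ultimately have "X \<le> H" by (simp add: mult.assoc)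
        then interpret sparse_regime_eta \<epsilon> d n \<beta> \<eta>
          using \<eta> by unfold_locales (auto simp: X_def)
        show ?thesis using prob_target_sparse by (simp add: target_def)
      qed
    qed
    moreover have "Y > 0" using eps by (auto simp: Y_def less_max_iff_disj)
    ultimately show ?thesis by (intro exI[of _ Y]) blast
  qed
  show ?thesis by (rule exI[of _ "max 1 d1"]) (use main in auto)
qed

theorem theorem1p1:
  fixes \<epsilon> :: real
  assumes "\<epsilon> > 0"
  shows "\<exists>d0 > 0. \<forall>d :: nat \<Rightarrow> real.
    (\<forall>n \<ge> 1. d0 \<le> d n) \<and> d \<in> o(\<lambda>n. real n) \<longrightarrow>
    (\<lambda>n. measure_pmf.prob (gnp n (d n / real n))
           {G. \<exists>P k. induced_subgraph P G \<and> is_path_of_length P k \<and>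
                 real k \<ge> (3/2 - \<epsilon>) * (real n / d n) * ln (d n)})
      \<longlonglongrightarrow> 1"
proof -
  define \<delta> where "\<delta> = min \<epsilon> (1 / 4)"
  have \<delta>: "0 < \<delta>" "\<delta> \<le> 1 / 4" "\<delta> \<le> \<epsilon>" using assms by (auto simp: \<delta>_def)
  define A where "A e x n = {G :: nat graph. \<exists>P k. induced_subgraph P G \<and> is_path_of_length P k \<and>
                 real k \<ge> (3/2 - e) * (real n / x) * ln x}" for e x :: real and n :: nat
  obtain d0 where d0: "d0 \<ge> 1" and unif: "\<And>\<eta>. 0 < \<eta> \<Longrightarrow> \<eta> \<le> 1 \<Longrightarrow> \<exists>Y>0. \<forall>x n. d0 \<le> x \<and> Y \<le> real n / x \<longrightarrow>
      1 - \<eta> \<le> measure_pmf.prob (gnp n (x / real n)) (A \<delta> x n)"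
    using prob_target_uniform[OF \<delta>(1,2)] unfolding A_def by blast
  have "(\<lambda>n. measure_pmf.prob (gnp n (d n / real n)) (A \<epsilon> (d n) n)) \<longlonglongrightarrow> 1"
    if d: "\<And>n. n \<ge> 1 \<Longrightarrow> d0 \<le> d n" "d \<in> o(\<lambda>n. real n)" for d
  proof (rule LIMSEQ_I)
    fix e :: real assume "e > 0"
    define \<eta> where "\<eta> = min 1 (e / 2)"
    have \<eta>: "0 < \<eta>" "\<eta> \<le> 1" "\<eta> < e" using \<open>e > 0\<close> by (auto simp: \<eta>_def)
    obtain Y where Y: "Y > 0" "\<And>x n. d0 \<le> x \<Longrightarrow> Y \<le> real n / x \<Longrightarrow>
        1 - \<eta> \<le> measure_pmf.prob (gnp n (x / real n)) (A \<delta> x n)"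
      using unif[OF \<eta>(1,2)] by blast
    have "eventually (\<lambda>n. norm (d n) \<le> 1 / Y * norm (real n)) sequentially"
      using Y(1) by (intro landau_o.smallD[OF d(2)]) simp
    then obtain M where M: "\<And>n. n \<ge> M \<Longrightarrow> \<bar>d n\<bar> \<le> 1 / Y * real n"
      unfolding eventually_sequentially by auto
    have "norm (measure_pmf.prob (gnp n (d n / real n)) (A \<epsilon> (d n) n) - 1) < e" if n: "n \<ge> max 1 M" for n
    proof -
      have dn: "d n \<ge> d0" "d n \<ge> 1" using d(1)[of n] n d0 by auto
      have "d n \<le> 1 / Y * real n" using M[of n] n by auto
      then have "Y \<le> real n / d n" using Y(1) dn by (simp add: field_simps)
      then have "1 - \<eta> \<le> measure_pmf.prob (gnp n (d n / real n)) (A \<delta> (d n) n)"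
        using dn by (intro Y(2)) auto
      also have "\<dots> \<le> measure_pmf.prob (gnp n (d n / real n)) (A \<epsilon> (d n) n)"
      proof (rule measure_pmf.finite_measure_mono)
        have "(3/2 - \<epsilon>) * ((real n / d n) * ln (d n)) \<le> (3/2 - \<delta>) * ((real n / d n) * ln (d n))"
          using dn \<delta> by (intro mult_right_mono mult_nonneg_nonneg) auto
        then have "(3/2 - \<epsilon>) * (real n / d n) * ln (d n) \<le> (3/2 - \<delta>) * (real n / d n) * ln (d n)"
          by (simp only: mult.assoc)
        then show "A \<delta> (d n) n \<subseteq> A \<epsilon> (d n) n" unfolding A_def by (blast intro: order_trans)
      qed simp
      finally have "1 - \<eta> \<le> measure_pmf.prob (gnp n (d n / real n)) (A \<epsilon> (d n) n)" .
      moreover have "measure_pmf.prob (gnp n (d n / real n)) (A \<epsilon> (d n) n) \<le> 1" by simp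
      ultimately show ?thesis using \<eta>(3) by simp
    qed
    then show "\<exists>no. \<forall>n\<ge>no. norm (measure_pmf.prob (gnp n (d n / real n)) (A \<epsilon> (d n) n) - 1) < e" by blast
  qed
  then show ?thesis
    unfolding A_def using d0 by (intro exI[of _ d0]) auto
qed

end
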